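(* Let $h\colon\mathbb{R}^2\to\mathbb{R}^2$ be a homeomorphism and let $K\subset\mathbb{R}^2$ be the Sierpi\'nski gasket. Then $h(K)$ is non-removable for $W^{1,2}$; that is, there exists a continuous function $f\colon\mathbb{R}^2\to\mathbb{R}$ with $f\in W^{1,2}(\mathbb{R}^2\setminus h(K))$ but $f\notin W^{1,2}(\mathbb{R}^2)$.
   Context: The Sierpi\'nski gasket $K$ is constructed as follows: take a closed equilateral triangle in the plane of sidelength $1$, subdivide it into four equilateral triangles of sidelength $1/2$, and remove the (open) middle triangle; then proceed inductively, subdividing each of the remaining three triangles into four equilateral triangles of sidelength $1/2^2$, removing the open middle ones, and so on. The remaining compact set is $K$. For an open set $U\subset\mathbb{R}^2$, $f\in W^{1,2}(U)$ means that $f\in L^2(U)$ and $f$ has weak first partial derivatives in $U$ that lie in $L^2(U)$. A compact set $E\subset\mathbb{R}^2$ is $W^{1,2}$-removable if every real-valued function that is continuous in $\mathbb{R}^2$ and lies in $W^{1,2}(\mathbb{R}^2\setminus E)$ also lies in $W^{1,2}(\mathbb{R}^2)$; otherwise it is non-removable for $W^{1,2}$. *)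

theory Defs
  imports "HOL-Analysis.Analysis"
begin

subsection \<open>The Sierpinski gasket\<close>

text \<open>Triangles are represented by their triples of vertices.\<close>

type_synonym triangle = "(real^2) \<times> (real^2) \<times> (real^2)"

fun closed_triangle :: "triangle \<Rightarrow> (real^2) set" where
  "closed_triangle (a, b, c) = convex hull {a, b, c}"

fun middle_triangle :: "triangle \<Rightarrow> triangle" where
  "middle_triangle (a, b, c) = (midpoint b c, midpoint c a, midpoint a b)"

fun corner_triangles :: "triangle \<Rightarrow> triangle set" where
  "corner_triangles (a, b, c) =
    {(a, midpoint a b, midpoint c a), (midpoint a b, b, midpoint b c), (midpoint c a, midpoint b c, c)}"

primrec gasket_triangles :: "triangle \<Rightarrow> nat \<Rightarrow> triangle set" where
  "gasket_triangles T 0 = {T}"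
| "gasket_triangles T (Suc n) = (\<Union>S\<in>gasket_triangles T n. corner_triangles S)"

primrec gasket_stage :: "triangle \<Rightarrow> nat \<Rightarrow> (real^2) set" where
  "gasket_stage T 0 = closed_triangle T"
| "gasket_stage T (Suc n) =
    gasket_stage T n - (\<Union>S\<in>gasket_triangles T n. interior (closed_triangle (middle_triangle S)))"

definition sierpinski_gasket :: "triangle \<Rightarrow> (real^2) set" where
  "sierpinski_gasket T = (\<Inter>n. gasket_stage T n)"

fun equilateral_side_1 :: "triangle \<Rightarrow> bool" where
  "equilateral_side_1 (a, b, c) \<longleftrightarrow> dist a b = 1 \<and> dist b c = 1 \<and> dist c a = 1"

lemma compact_gasket_stage: "compact (gasket_stage T n)"
proof (induction n)
  case 0
  show ?case by (cases T) (simp add: compact_convex_hull finite_imp_compact)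
next
  case (Suc n)
  then show ?case by (auto intro!: compact_diff)
qed

lemma compact_sierpinski_gasket: "compact (sierpinski_gasket T)"
  unfolding sierpinski_gasket_def
  by (rule compact_Inter) (auto simp: compact_gasket_stage)


subsection \<open>The Sobolev space and removability\<close>

definition partial_deriv :: "'a::euclidean_space \<Rightarrow> ('a \<Rightarrow> real) \<Rightarrow> 'a \<Rightarrow> real" where
  "partial_deriv b f x = frechet_derivative f (at x) b"

primrec C_times :: "nat \<Rightarrow> ('a::euclidean_space \<Rightarrow> real) \<Rightarrow> bool" where
  "C_times 0 f \<longleftrightarrow> continuous_on UNIV f"
| "C_times (Suc k) f \<longleftrightarrow>
    (\<forall>x. f differentiable (at x)) \<and> (\<forall>b\<in>Basis. C_times k (partial_deriv b f))"

definition test_function_on :: "'a::euclidean_space set \<Rightarrow> ('a \<Rightarrow> real) \<Rightarrow> bool" where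
  "test_function_on U \<phi> \<longleftrightarrow>
    (\<forall>k. C_times k \<phi>) \<and> compact (closure {x. \<phi> x \<noteq> 0}) \<and> closure {x. \<phi> x \<noteq> 0} \<subseteq> U"

definition locally_integrable_on :: "'a::euclidean_space set \<Rightarrow> ('a \<Rightarrow> real) \<Rightarrow> bool" where
  "locally_integrable_on U f \<longleftrightarrow>
    (\<forall>C. compact C \<and> C \<subseteq> U \<longrightarrow> integrable (lebesgue_on C) f)"

definition weak_partial_deriv_on ::
    "'a::euclidean_space set \<Rightarrow> 'a \<Rightarrow> ('a \<Rightarrow> real) \<Rightarrow> ('a \<Rightarrow> real) \<Rightarrow> bool" where
  "weak_partial_deriv_on U b f g \<longleftrightarrow>
    locally_integrable_on U f \<and> locally_integrable_on U g \<and>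
    (\<forall>\<phi>. test_function_on U \<phi> \<longrightarrow>
      (\<integral>x. f x * partial_deriv b \<phi> x \<partial>lebesgue_on U) = - (\<integral>x. g x * \<phi> x \<partial>lebesgue_on U))"

definition L2_on :: "'a::euclidean_space set \<Rightarrow> ('a \<Rightarrow> real) set" where
  "L2_on U = {f. f \<in> borel_measurable (lebesgue_on U) \<and> integrable (lebesgue_on U) (\<lambda>x. (f x)\<^sup>2)}"

text \<open>
  Intended for open \<open>U\<close>. Membership of \<open>f\<close> depends only on the values of \<open>f\<close> on \<open>U\<close>,
  so no explicit restriction of \<open>f\<close> to \<open>U\<close> is needed.
\<close>

definition sobolev_W12 :: "'a::euclidean_space set \<Rightarrow> ('a \<Rightarrow> real) set" where
  "sobolev_W12 U = {f. f \<in> L2_on U \<and> (\<forall>b\<in>Basis. \<exists>g\<in>L2_on U. weak_partial_deriv_on U b f g)}"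

text \<open>
  Intended for compact \<open>E\<close>. Compactness is not a conjunct of the definition, since a
  non-compact set would then be non-removable for trivial reasons.
\<close>

definition W12_removable :: "(real^2) set \<Rightarrow> bool" where
  "W12_removable E \<longleftrightarrow>
    (\<forall>f. continuous_on UNIV f \<and> f \<in> sobolev_W12 (UNIV - E) \<longrightarrow> f \<in> sobolev_W12 UNIV)"

end

theory Submission
  imports Defs "HOL-Real_Asymp.Real_Asymp"
begin

text \<open>
  Points have zero capacity in the plane. Complementary components of the gasket touch at points,
  so a function that is constant on each component can be adapted at the touching points to the
  values prescribed on neighbouring components, at arbitrarily small energy. Iterating this yields a
  continuous staircase interpolating any continuous data given on the outside and on the
  central hole, with finite energy off the gasket, whatever the homeomorphism is.
  The data are chosen to vanish outside and to decay like \<open>1 / sqrt (- ln r)\<close> in the central hole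
  near one of its vertices. This decay has finite energy inside the hole. However, every small
  square around the vertex meets both the hole and the outside, so along its boundary the function
  oscillates by \<open>1 / sqrt (- ln s)\<close>, where \<open>s\<close> is half the side; a function
  in \<open>W\<^sup>1\<^sup>,\<^sup>2\<close> of the plane would then have energy at least a multiple of the divergent integral
  of \<open>1 / (s (- ln s))\<close>.
  The area of the image of the gasket plays no role.
\<close>

text \<open>The obstacle is that \<open>h\<close> is merely a homeomorphism, so no estimate can be
  transported from the gasket to its image. What \<open>h\<close> does preserve is that a hole
  touches the already treated part in finitely many points. Hence the cutoffs are written in image
  coordinates, centred at the images of these points, while combinatorics, continuity and
  oscillation are handled in the coordinates of the gasket. The image may also have positive area
  and carry part of a weak gradient, so the energy off the image gives no control over the energy in
  the plane; non-membership therefore has to be forced by the values of the function alone. As for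
  the exponent of the cusp: every positive power of \<open>1 / (- ln r)\<close> has finite energy in
  the hole, and 1/2 is the largest one for which the forced energy still diverges.\<close>

subsection \<open>Gradients and energy\<close>

definition grad :: "('a::euclidean_space \<Rightarrow> real) \<Rightarrow> 'a \<Rightarrow> 'a" where
  "grad f w = (\<Sum>b\<in>Basis. frechet_derivative f (at w) b *\<^sub>R b)"

definition C1_on :: "'a::euclidean_space set \<Rightarrow> ('a \<Rightarrow> real) \<Rightarrow> bool" where
  "C1_on V f \<longleftrightarrow> (\<forall>w\<in>V. f differentiable (at w)) \<and> continuous_on V (grad f)"

lemma has_derivative_grad:
  assumes "f differentiable (at w)"
  shows "(f has_derivative (\<lambda>v. grad f w \<bullet> v)) (at w)"
proof -
  have d: "(f has_derivative frechet_derivative f (at w)) (at w)"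
    using assms frechet_derivative_works by blast
  then have lin: "linear (frechet_derivative f (at w))"
    using has_derivative_linear by blast
  have "frechet_derivative f (at w) v = grad f w \<bullet> v" for v
  proof -
    have "frechet_derivative f (at w) v = frechet_derivative f (at w) (\<Sum>b\<in>Basis. (v \<bullet> b) *\<^sub>R b)"
      by (simp add: euclidean_representation)
    also have "\<dots> = (\<Sum>b\<in>Basis. (v \<bullet> b) * frechet_derivative f (at w) b)"
      by (simp add: linear_sum[OF lin] linear_scale[OF lin])
    also have "\<dots> = grad f w \<bullet> v"
      by (simp add: grad_def inner_sum_left inner_sum_right inner_commute[of _ v] mult.commute)
    finally show ?thesis .
  qed
  then have "frechet_derivative f (at w) = (\<lambda>v. grad f w \<bullet> v)" by (rule ext)
  then show ?thesis using d by simp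
qed

lemma grad_eqI:
  assumes "(f has_derivative (\<lambda>v. G \<bullet> v)) (at w)"
  shows "grad f w = G"
  using frechet_derivative_at[OF assms, symmetric]
  by (simp add: grad_def euclidean_representation)

lemma partial_deriv_eq_grad:
  assumes "f differentiable (at w)"
  shows "partial_deriv b f w = grad f w \<bullet> b"
  unfolding partial_deriv_def
  by (simp add: frechet_derivative_at[OF has_derivative_grad[OF assms], symmetric])

lemma C1_onI:
  assumes "\<And>w. w \<in> V \<Longrightarrow> (f has_derivative (\<lambda>v. G w \<bullet> v)) (at w)" "continuous_on V G"
  shows "C1_on V f"
  unfolding C1_on_def
proof
  show "\<forall>w\<in>V. f differentiable at w" using assms(1) differentiable_def by blast
  show "continuous_on V (grad f)"
    by (rule continuous_on_eq[OF assms(2)]) (simp add: grad_eqI[OF assms(1)])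
qed

lemma grad_cong_open:
  assumes "open V" "\<And>w. w \<in> V \<Longrightarrow> f w = f' w" "w \<in> V"
  shows "grad f w = grad f' w" "f differentiable (at w) \<longleftrightarrow> f' differentiable (at w)"
proof -
  have eq: "(f has_derivative D) (at w) \<longleftrightarrow> (f' has_derivative D) (at w)" for D
    using has_derivative_transform_within_open[of f D w UNIV V f']
      has_derivative_transform_within_open[of f' D w UNIV V f] assms by auto
  show "grad f w = grad f' w"
    by (simp add: grad_def frechet_derivative_def eq)
  show "f differentiable (at w) \<longleftrightarrow> f' differentiable (at w)"
    by (simp add: differentiable_def eq)
qed

lemma C1_on_cong:
  assumes "open V" "\<And>w. w \<in> V \<Longrightarrow> f w = f' w" "C1_on V f"
  shows "C1_on V f'"
proof -
  have "continuous_on V (grad f')"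
    using assms(3) grad_cong_open(1)[OF assms(1,2)] unfolding C1_on_def
    by (auto intro: continuous_on_eq)
  then show ?thesis
    using assms(3) grad_cong_open(2)[OF assms(1,2)] unfolding C1_on_def by auto
qed

lemma C1_on_subset: "C1_on V f \<Longrightarrow> W \<subseteq> V \<Longrightarrow> C1_on W f"
  unfolding C1_on_def using continuous_on_subset by blast

lemma C1_on_Union:
  assumes "\<And>i. i \<in> I \<Longrightarrow> open (V i)" "\<And>i. i \<in> I \<Longrightarrow> C1_on (V i) f"
  shows "C1_on (\<Union>i\<in>I. V i) f"
  using assms unfolding C1_on_def by (auto intro: continuous_on_open_UN)

definition energy :: "(real^2) set \<Rightarrow> (real^2 \<Rightarrow> real) \<Rightarrow> ennreal" where
  "energy V f = (\<integral>\<^sup>+w\<in>V. ennreal ((norm (grad f w))\<^sup>2) \<partial>lborel)"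

section \<open>Classical gradients as weak derivatives\<close>

lemma has_derivative_mult_extend:
  fixes f h :: "'a::euclidean_space \<Rightarrow> real"
  assumes U: "open U" and f: "C1_on U f"
    and h: "\<And>x. h differentiable (at x)" and S: "closed S" "S \<subseteq> U" "\<And>x. x \<notin> S \<Longrightarrow> h x = 0"
  shows "((\<lambda>x. f x * h x) has_derivative
           (\<lambda>v. (if x \<in> U then f x *\<^sub>R grad h x + h x *\<^sub>R grad f x else 0) \<bullet> v)) (at x)"
proof (cases "x \<in> U")
  case True
  then have "(f has_derivative (\<lambda>v. grad f x \<bullet> v)) (at x)"
    using f has_derivative_grad unfolding C1_on_def by blast
  then have "((\<lambda>x. f x * h x) has_derivative (\<lambda>v. f x * (grad h x \<bullet> v) + (grad f x \<bullet> v) * h x)) (at x)"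
    using has_derivative_mult has_derivative_grad h by blast
  then show ?thesis using True by (simp add: inner_add_left mult.commute)
next
  case False
  have "((\<lambda>x. 0::real) has_derivative (\<lambda>v. 0)) (at x)" by simp
  then have "((\<lambda>x. f x * h x) has_derivative (\<lambda>v. 0)) (at x)"
    by (rule has_derivative_transform_within_open[where s="-S"]) (use S False in auto)
  then show ?thesis using False by simp
qed

lemma continuous_compact_support_integrable:
  fixes f :: "'a::euclidean_space \<Rightarrow> real"
  assumes "continuous_on UNIV f" "compact S" "\<And>x. x \<notin> S \<Longrightarrow> f x = 0"
  shows "integrable lborel f"
proof -
  have "integrable lborel (\<lambda>x. indicator S x *\<^sub>R f x)"
    using assms borel_integrable_compact continuous_on_subset by blast
  moreover have "(\<lambda>x. indicator S x *\<^sub>R f x) = f" using assms(3) by (force simp: indicator_def fun_eq_iff)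
  ultimately show ?thesis by simp
qed

text \<open>Links the Henstock-Kurzweil integral, to which the Leibniz rule is applied, with the
  Lebesgue integral of the Sobolev definitions.\<close>

lemma integral_cbox_eq_lborel:
  fixes F :: "'a::euclidean_space \<Rightarrow> real"
  assumes "continuous_on UNIV F" "\<And>x. x \<notin> cbox a b \<Longrightarrow> F x = 0"
  shows "integrable lborel F" "integral (cbox a b) F = (\<integral>x. F x \<partial>lborel)"
proof -
  show i: "integrable lborel F" using continuous_compact_support_integrable[OF assms(1) compact_cbox assms(2)] by blast
  have "F integrable_on cbox a b" using assms(1) continuous_on_subset by (blast intro: integrable_continuous)
  then have "(F has_integral integral (cbox a b) F) UNIV"
    using has_integral_on_superset[of F _ "cbox a b" UNIV] assms(2) by blast
  then show "integral (cbox a b) F = (\<integral>x. F x \<partial>lborel)"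
    using integral_lborel[OF i] by (simp add: integral_unique)
qed

text \<open>By translation invariance the integral of \<open>F (x + t *\<^sub>R b)\<close> over
  \<open>x\<close> does not depend on \<open>t\<close>. Differentiating under the integral sign at
  \<open>t = 0\<close> gives the claim.\<close>

lemma integral_directional_derivative_zero:
  fixes F :: "'a::euclidean_space \<Rightarrow> real"
  assumes F: "\<And>x. (F has_derivative (\<lambda>v. G x \<bullet> v)) (at x)" and G: "continuous_on UNIV G"
    and S: "compact S" "\<And>x. x \<notin> S \<Longrightarrow> F x = 0"
  shows "(\<integral>x. G x \<bullet> b \<partial>lborel) = 0"
proof -
  \<comment> \<open>All translates of the support by \<open>t\<close> in [-1, 1] fit into one box,
    so the domain of integration stays fixed.\<close>
  have "compact ((\<lambda>q. fst q - snd q *\<^sub>R b) ` (S \<times> {-1..1}))"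
    by (intro compact_continuous_image compact_Times S(1) continuous_intros) auto
  then obtain a where a: "(\<lambda>q. fst q - snd q *\<^sub>R b) ` (S \<times> {-1..1}) \<subseteq> cbox (-a) a"
    using bounded_subset_cbox_symmetric compact_imp_bounded by blast
  let ?C = "cbox (-a) a"
  have out: "F (x + t *\<^sub>R b) = 0" if "t \<in> {-1..1}" "x \<notin> ?C" for t x
  proof (rule S(2), rule notI)
    assume "x + t *\<^sub>R b \<in> S"
    then have "x \<in> (\<lambda>q. fst q - snd q *\<^sub>R b) ` (S \<times> {-1..1})"
      using that(1) by (intro image_eqI[of _ _ "(x + t *\<^sub>R b, t)"]) auto
    then show False using a that(2) by blast
  qed
  have G0: "G x = 0" if "x \<notin> ?C" for x
  proof -
    have "G x = grad F x" using grad_eqI[OF F] by simp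
    also have "\<dots> = grad (\<lambda>x. 0) x"
      by (rule grad_cong_open[where V="- ?C"]) (use that out[of 0] in auto)
    also have "\<dots> = 0" by (rule grad_eqI) simp
    finally show ?thesis .
  qed
  have Fc: "continuous_on A F" for A
    by (rule has_derivative_continuous_on[where f'="\<lambda>x v. G x \<bullet> v"]) (use F has_derivative_at_withinI in blast)
  have Ft: "continuous_on A (\<lambda>x. F (x + t *\<^sub>R b))" for A t
    by (intro continuous_on_compose2[OF Fc[of UNIV]] continuous_intros) auto
  have const: "integral ?C (\<lambda>x. F (x + t *\<^sub>R b)) = (\<integral>x. F x \<partial>lborel)" if "t \<in> {-1..1}" for t
  proof -
    have "(\<integral>x. F x \<partial>lborel) = (\<integral>x. F x \<partial>(distr lborel borel ((+) (t *\<^sub>R b))))" by (simp add: lborel_distr_plus)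
    also have "\<dots> = (\<integral>x. F (t *\<^sub>R b + x) \<partial>lborel)"
      using borel_measurable_continuous_onI[OF Fc] by (intro integral_distr) auto
    finally show ?thesis using integral_cbox_eq_lborel(2)[OF Ft out[OF that]] by (simp add: add.commute)
  qed
  have line: "((\<lambda>t. F (x + t *\<^sub>R b)) has_vector_derivative G (x + t *\<^sub>R b) \<bullet> b) (at t within A)" for x t A
  proof -
    have "((\<lambda>t. x + t *\<^sub>R b) has_derivative (\<lambda>h. h *\<^sub>R b)) (at t within A)"
      by (auto intro!: derivative_eq_intros)
    from has_derivative_compose[OF this F]
    show ?thesis by (simp add: has_vector_derivative_def)
  qed
  have "((\<lambda>t. integral ?C (\<lambda>x. F (x + t *\<^sub>R b))) has_vector_derivative
      integral ?C (\<lambda>x. G (x + 0 *\<^sub>R b) \<bullet> b)) (at 0 within cbox (-1) 1)"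
  proof (rule leibniz_rule_vector_derivative[OF line])
    show "(\<lambda>x. F (x + t *\<^sub>R b)) integrable_on ?C" for t by (rule integrable_continuous[OF Ft])
    show "continuous_on (cbox (-1) 1 \<times> ?C) (\<lambda>(t, x). G (x + t *\<^sub>R b) \<bullet> b)"
      unfolding split_beta by (intro continuous_intros continuous_on_compose2[OF G]) auto
  qed auto
  moreover have "((\<lambda>t. integral ?C (\<lambda>x. F (x + t *\<^sub>R b))) has_vector_derivative 0) (at 0 within cbox (-1) 1)"
    by (rule has_vector_derivative_transform[OF _ _ has_vector_derivative_const]) (use const in auto)
  ultimately have "integral ?C (\<lambda>x. G x \<bullet> b) = 0"
    using vector_derivative_unique_within_closed_interval[of "-1::real" 1 0] by fastforce
  then show ?thesis
    using integral_cbox_eq_lborel(2)[of "\<lambda>x. G x \<bullet> b" "-a" a] G G0 by (simp add: continuous_on_inner)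
qed

text \<open>The product of \<open>f\<close> with a test function is differentiable on the whole
  space, also across the boundary of \<open>U\<close>, so its derivative has integral zero. The part
  \<open>B\<close>, which carries the possibly wild gradient of \<open>f\<close>, is continuous
  because \<open>U\<close> and the complement of the support form an open cover.\<close>

lemma C1_on_imp_weak_partial_deriv_on:
  fixes f :: "'a::euclidean_space \<Rightarrow> real"
  assumes U: "open U" and fc: "continuous_on UNIV f" and f: "C1_on U f" and b: "b \<in> Basis"
  shows "weak_partial_deriv_on U b f (\<lambda>x. grad f x \<bullet> b)"
proof -
  have loc: "locally_integrable_on U k" if "continuous_on U k" for k :: "'a \<Rightarrow> real"
    unfolding locally_integrable_on_def
  proof clarify
    fix C assume C: "compact C" "C \<subseteq> U"
    have "set_integrable lborel C k"
      unfolding set_integrable_def using C that borel_integrable_compact continuous_on_subset by blast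
    then have "set_integrable lebesgue C k"
      unfolding set_integrable_def by (meson C(1) integrable_completion borel_measurable_integrable)
    then show "integrable (lebesgue_on C) k"
      using C(1) by (simp add: integrable_restrict_space set_integrable_def lmeasurable_compact fmeasurableD)
  qed
  have gc: "continuous_on U (\<lambda>x. grad f x \<bullet> b)"
    using f unfolding C1_on_def by (intro continuous_intros) auto
  moreover have "(\<integral>x. f x * partial_deriv b h x \<partial>lebesgue_on U) = - (\<integral>x. (grad f x \<bullet> b) * h x \<partial>lebesgue_on U)"
    if h: "test_function_on U h" for h
  proof -
    define S where "S = closure {x. h x \<noteq> 0}"
    have S: "compact S" "S \<subseteq> U" "\<And>x. x \<notin> S \<Longrightarrow> h x = 0"
      using h closure_subset[of "{x. h x \<noteq> 0}"] unfolding test_function_on_def S_def by blast+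
    have c1: "C_times 1 h" using h unfolding test_function_on_def by blast
    then have d: "h differentiable (at x)" for x by simp
    have pc: "continuous_on UNIV (\<lambda>x. grad h x \<bullet> b')" if "b' \<in> Basis" for b'
    proof -
      have "continuous_on UNIV (partial_deriv b' h)" using c1 that by simp
      then show ?thesis by (rule continuous_on_eq) (simp add: partial_deriv_eq_grad[OF d])
    qed
    have gcont: "continuous_on UNIV (grad h)"
      unfolding grad_def using c1 by (auto intro!: continuous_intros simp: partial_deriv_def[abs_def])
    have pc0: "continuous_on UNIV h"
      using d by (simp add: continuous_at_imp_continuous_on differentiable_imp_continuous_within)
    have g0: "grad h x = 0" if "x \<notin> S" for x
    proof -
      have "grad h x = grad (\<lambda>x. 0) x"
        by (rule grad_cong_open[where V="-S"]) (use S that compact_imp_closed in auto)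
      also have "\<dots> = 0" by (rule grad_eqI) simp
      finally show ?thesis .
    qed
    define A where "A = (\<lambda>x. f x * (grad h x \<bullet> b))"
    define B where "B = (\<lambda>x. if x \<in> U then h x *\<^sub>R grad f x else 0)"
    define G where "G = (\<lambda>x. if x \<in> U then f x *\<^sub>R grad h x + h x *\<^sub>R grad f x else 0)"
    have opS: "open (- S)" using S compact_imp_closed by auto
    have Bc: "continuous_on UNIV B"
    proof -
      have "continuous_on (U \<union> -S) B"
      proof (rule continuous_on_open_Un[OF U opS])
        have "continuous_on U (\<lambda>x. h x *\<^sub>R grad f x)"
          using f pc0 unfolding C1_on_def by (intro continuous_intros) (auto intro: continuous_on_subset)
        then show "continuous_on U B" by (rule continuous_on_eq) (simp add: B_def)
        have "continuous_on (-S) (\<lambda>x. 0::'a)" by simp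
        then show "continuous_on (-S) B" by (rule continuous_on_eq) (simp add: B_def S)
      qed
      moreover have "U \<union> -S = UNIV" using S by auto
      ultimately show ?thesis by simp
    qed
    have Geq: "G = (\<lambda>x. f x *\<^sub>R grad h x + B x)"
      using S(2) g0 by (auto simp: G_def B_def fun_eq_iff)
    have Gc: "continuous_on UNIV G"
      unfolding Geq using fc gcont Bc by (intro continuous_intros)
    have "(\<integral>x. G x \<bullet> b \<partial>lborel) = 0"
    proof (rule integral_directional_derivative_zero[OF _ Gc S(1)])
      show "((\<lambda>x. f x * h x) has_derivative (\<bullet>) (G x)) (at x)" for x
        unfolding G_def
        using has_derivative_mult_extend[OF U f d compact_imp_closed[OF S(1)] S(2,3)] by simp
    qed (use S in simp)
    moreover have "G x \<bullet> b = A x + B x \<bullet> b" for x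
      by (simp add: Geq A_def inner_add_left)
    moreover have Ai: "integrable lborel A"
      unfolding A_def by (rule continuous_compact_support_integrable[OF _ S(1)])
        (use fc pc[OF b] g0 in \<open>auto intro!: continuous_intros\<close>)
    moreover have Bi: "integrable lborel (\<lambda>x. B x \<bullet> b)"
      by (rule continuous_compact_support_integrable[OF _ S(1)])
        (use Bc S in \<open>auto intro!: continuous_intros simp: B_def\<close>)
    ultimately have sum0: "(\<integral>x. A x \<partial>lborel) + (\<integral>x. B x \<bullet> b \<partial>lborel) = 0" by simp
    have Um: "U \<in> sets lebesgue" using U by simp
    have "(\<integral>x. f x * partial_deriv b h x \<partial>lebesgue_on U) = (\<integral>x. indicator U x *\<^sub>R (f x * partial_deriv b h x) \<partial>lebesgue)"
      using Um by (simp add: integral_restrict_space)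
    also have "(\<lambda>x. indicator U x *\<^sub>R (f x * partial_deriv b h x)) = A"
      using S(2) g0 by (force simp: A_def indicator_def partial_deriv_eq_grad[OF d] fun_eq_iff)
    also have "(\<integral>x. A x \<partial>lebesgue) = (\<integral>x. A x \<partial>lborel)"
      using Ai by (intro integral_completion) auto
    finally have 1: "(\<integral>x. f x * partial_deriv b h x \<partial>lebesgue_on U) = (\<integral>x. A x \<partial>lborel)" .
    have "(\<integral>x. (grad f x \<bullet> b) * h x \<partial>lebesgue_on U) = (\<integral>x. indicator U x *\<^sub>R ((grad f x \<bullet> b) * h x) \<partial>lebesgue)"
      using Um by (simp add: integral_restrict_space)
    also have "(\<lambda>x. indicator U x *\<^sub>R ((grad f x \<bullet> b) * h x)) = (\<lambda>x. B x \<bullet> b)"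
      by (auto simp: B_def indicator_def)
    also have "(\<integral>x. B x \<bullet> b \<partial>lebesgue) = (\<integral>x. B x \<bullet> b \<partial>lborel)"
      using Bi by (intro integral_completion) auto
    finally show ?thesis using 1 sum0 by simp
  qed
  ultimately show ?thesis
    unfolding weak_partial_deriv_on_def using loc fc continuous_on_subset by blast
qed

lemma sobolev_W12_I:
  fixes f :: "real^2 \<Rightarrow> real"
  assumes U: "open U" and fc: "continuous_on UNIV f" and f: "C1_on U f"
    and S: "compact S" "\<And>x. x \<notin> S \<Longrightarrow> f x = 0" and e: "energy U f < \<infinity>"
  shows "f \<in> sobolev_W12 U"
proof -
  have Um: "U \<in> sets lebesgue" "U \<in> sets lborel" using U by auto
  have L2: "k \<in> L2_on U" if k: "continuous_on U k" and i: "integrable lborel (\<lambda>x. indicator U x *\<^sub>R (k x)\<^sup>2)"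
    for k :: "real^2 \<Rightarrow> real"
  proof -
    have "k \<in> borel_measurable (lebesgue_on U)"
      using k Um continuous_imp_measurable_on_sets_lebesgue by blast
    moreover have "integrable lebesgue (\<lambda>x. indicator U x *\<^sub>R (k x)\<^sup>2)"
      using i by (meson integrable_completion borel_measurable_integrable)
    then have "integrable (lebesgue_on U) (\<lambda>x. (k x)\<^sup>2)"
      using Um by (simp add: integrable_restrict_space)
    ultimately show ?thesis by (simp add: L2_on_def)
  qed
  have "f \<in> L2_on U"
  proof (rule L2)
    have "integrable lborel (\<lambda>x. (f x)\<^sup>2)"
      by (rule continuous_compact_support_integrable[OF _ S(1)])
        (use fc S in \<open>auto intro!: continuous_intros\<close>)
    then show "integrable lborel (\<lambda>x. indicator U x *\<^sub>R (f x)\<^sup>2)"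
      using Um integrable_mult_indicator by blast
  qed (use fc continuous_on_subset in blast)
  moreover have "(\<lambda>x. grad f x \<bullet> b) \<in> L2_on U" if b: "b \<in> Basis" for b
  proof (rule L2)
    show gc: "continuous_on U (\<lambda>x. grad f x \<bullet> b)"
      using f unfolding C1_on_def by (intro continuous_intros) auto
    have m: "(\<lambda>x. indicator U x *\<^sub>R (grad f x \<bullet> b)\<^sup>2) \<in> borel_measurable lborel"
    proof -
      have "continuous_on U (\<lambda>x. (grad f x \<bullet> b)\<^sup>2)" using gc by (intro continuous_on_power)
      then show ?thesis using borel_measurable_continuous_on_indicator[of U "\<lambda>x. (grad f x \<bullet> b)\<^sup>2"] U by simp
    qed
    have "(\<integral>\<^sup>+x. ennreal (norm (indicator U x *\<^sub>R (grad f x \<bullet> b)\<^sup>2)) \<partial>lborel) \<le> energy U f"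
      unfolding energy_def
    proof (rule nn_integral_mono)
      fix x
      have "\<bar>grad f x \<bullet> b\<bar> \<le> norm (grad f x)" using Basis_le_norm[OF b] by simp
      then have "(grad f x \<bullet> b)\<^sup>2 \<le> (norm (grad f x))\<^sup>2" by (simp add: abs_le_square_iff[symmetric])
      then show "ennreal (norm (indicator U x *\<^sub>R (grad f x \<bullet> b)\<^sup>2)) \<le> ennreal ((norm (grad f x))\<^sup>2) * indicator U x"
        by (auto simp: indicator_def ennreal_leI)
    qed
    then show "integrable lborel (\<lambda>x. indicator U x *\<^sub>R (grad f x \<bullet> b)\<^sup>2)"
      using e m by (intro integrableI_bounded) auto
  qed
  ultimately show ?thesis
    unfolding sobolev_W12_def using C1_on_imp_weak_partial_deriv_on[OF U fc f] by blast
qed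

section \<open>Subadditivity of the energy\<close>

lemma grad_square_measurable:
  assumes "open V" "C1_on V f"
  shows "(\<lambda>w. ennreal ((norm (grad f w))\<^sup>2) * indicator V w) \<in> borel_measurable borel"
proof -
  have "continuous_on V (\<lambda>w. (norm (grad f w))\<^sup>2)"
    using assms(2) unfolding C1_on_def by (intro continuous_intros) auto
  then have "(\<lambda>w. indicator V w *\<^sub>R (norm (grad f w))\<^sup>2) \<in> borel_measurable borel"
    using assms(1) by (intro borel_measurable_continuous_on_indicator) auto
  then have "(\<lambda>w. ennreal (indicator V w *\<^sub>R (norm (grad f w))\<^sup>2)) \<in> borel_measurable borel"
    by measurable
  also have "(\<lambda>w. ennreal (indicator V w *\<^sub>R (norm (grad f w))\<^sup>2)) = (\<lambda>w. ennreal ((norm (grad f w))\<^sup>2) * indicator V w)"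
    by (auto simp: indicator_def fun_eq_iff)
  finally show ?thesis .
qed

lemma energy_cong:
  assumes "open V" "\<And>w. w \<in> V \<Longrightarrow> f w = f' w"
  shows "energy V f = energy V f'"
  unfolding energy_def
  by (intro nn_integral_cong) (auto simp: indicator_def grad_cong_open[OF assms])

lemma energy_mono: "V \<subseteq> W \<Longrightarrow> energy V f \<le> energy W f"
  unfolding energy_def by (intro nn_integral_mono) (auto simp: indicator_def)

lemma energy_UN_le_suminf:
  fixes V :: "nat \<Rightarrow> (real^2) set"
  assumes "\<And>k. open (V k)" "\<And>k. C1_on (V k) f"
  shows "energy (\<Union>k. V k) f \<le> (\<Sum>k. energy (V k) f)"
proof -
  have "energy (\<Union>k. V k) f \<le> (\<integral>\<^sup>+w. (\<Sum>k. ennreal ((norm (grad f w))\<^sup>2) * indicator (V k) w) \<partial>lborel)"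
    unfolding energy_def
  proof (intro nn_integral_mono)
    fix w
    show "ennreal ((norm (grad f w))\<^sup>2) * indicator (\<Union>k. V k) w
        \<le> (\<Sum>k. ennreal ((norm (grad f w))\<^sup>2) * indicator (V k) w)"
    proof (cases "w \<in> (\<Union>k. V k)")
      case True
      then obtain k where k: "w \<in> V k" by blast
      have "ennreal ((norm (grad f w))\<^sup>2) * indicator (V k) w
          \<le> (\<Sum>k. ennreal ((norm (grad f w))\<^sup>2) * indicator (V k) w)"
        using sum_le_suminf[of "\<lambda>k. ennreal ((norm (grad f w))\<^sup>2) * indicator (V k) w" "{k}"]
        by (simp del: sum_mult_indicator)
      then show ?thesis using True k by simp
    qed simp
  qed
  also have "\<dots> = (\<Sum>k. energy (V k) f)"
    unfolding energy_def
    by (rule nn_integral_suminf) (use grad_square_measurable[OF assms] in simp)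
  finally show ?thesis .
qed

lemma energy_Un:
  assumes "open V" "open W" "C1_on V f" "C1_on W f"
  shows "C1_on (V \<union> W) f" "energy (V \<union> W) f \<le> energy V f + energy W f"
proof -
  show "C1_on (V \<union> W) f" using C1_on_Union[of "{V, W}" id f] assms by auto
  have "energy (V \<union> W) f \<le> (\<integral>\<^sup>+w. ennreal ((norm (grad f w))\<^sup>2) * indicator V w + ennreal ((norm (grad f w))\<^sup>2) * indicator W w \<partial>lborel)"
    unfolding energy_def by (intro nn_integral_mono) (auto simp: indicator_def)
  also have "\<dots> = energy V f + energy W f"
    unfolding energy_def using assms by (intro nn_integral_add) (simp_all add: grad_square_measurable)
  finally show "energy (V \<union> W) f \<le> energy V f + energy W f" .
qed

lemma energy_UN_le_sum:
  assumes "finite I" "\<And>i. i \<in> I \<Longrightarrow> open (V i)" "\<And>i. i \<in> I \<Longrightarrow> C1_on (V i) f"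
  shows "energy (\<Union>i\<in>I. V i) f \<le> (\<Sum>i\<in>I. energy (V i) f)"
  using assms
proof (induction rule: finite_induct)
  case (insert i I)
  have "energy (V i \<union> (\<Union>i\<in>I. V i)) f \<le> energy (V i) f + energy (\<Union>i\<in>I. V i) f"
    using insert.prems by (intro energy_Un(2) C1_on_Union open_UN) auto
  also have "\<dots> \<le> energy (V i) f + (\<Sum>i\<in>I. energy (V i) f)" using insert by (intro add_left_mono) auto
  finally show ?case using insert.hyps by simp
qed (simp add: energy_def)

section \<open>Superpositions of one potential translated to finitely many points\<close>

lemma nn_integral_lborel_translate:
  fixes F :: "'a::euclidean_space \<Rightarrow> ennreal"
  assumes "F \<in> borel_measurable borel"
  shows "(\<integral>\<^sup>+w. F (w - a) \<partial>lborel) = (\<integral>\<^sup>+w. F w \<partial>lborel)"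
proof -
  have "(\<integral>\<^sup>+w. F w \<partial>lborel) = (\<integral>\<^sup>+w. F w \<partial>(distr lborel borel ((+) (- a))))" by (simp add: lborel_distr_plus)
  also have "\<dots> = (\<integral>\<^sup>+w. F (- a + w) \<partial>lborel)"
    by (subst nn_integral_distr) (use assms in auto)
  finally show ?thesis by simp
qed

lemma has_derivative_translated_sum:
  fixes k :: "real^2 \<Rightarrow> real"
  assumes "C1_on (-{0}) k" "w \<notin> p ` M"
  shows "((\<lambda>w. c + (\<Sum>a\<in>M. b a * k (w - p a))) has_derivative
     (\<lambda>v. (\<Sum>a\<in>M. b a *\<^sub>R grad k (w - p a)) \<bullet> v)) (at w)"
proof -
  have "((\<lambda>w. b a * k (w - p a)) has_derivative (\<lambda>v. b a * (grad k (w - p a) \<bullet> v))) (at w)" if "a \<in> M" for a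
  proof -
    have "w - p a \<noteq> 0" using assms(2) that by auto
    then have "(k has_derivative (\<lambda>v. grad k (w - p a) \<bullet> v)) (at (w - p a))"
      using assms(1) by (intro has_derivative_grad) (auto simp: C1_on_def)
    moreover have "((\<lambda>w. w - p a) has_derivative (\<lambda>v. v)) (at w)"
      by (auto intro!: derivative_eq_intros)
    ultimately have "((\<lambda>w. k (w - p a)) has_derivative (\<lambda>v. grad k (w - p a) \<bullet> v)) (at w)"
      using has_derivative_compose[of "\<lambda>w. w - p a" "\<lambda>v. v" w UNIV k] by simp
    then show ?thesis by (rule has_derivative_mult_right)
  qed
  then have "((\<lambda>w. c + (\<Sum>a\<in>M. b a * k (w - p a))) has_derivative
      (\<lambda>v. 0 + (\<Sum>a\<in>M. b a * (grad k (w - p a) \<bullet> v)))) (at w)"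
    by (intro has_derivative_add has_derivative_const has_derivative_sum)
  then show ?thesis by (simp add: inner_sum_left)
qed

lemma C1_on_translated_sum:
  fixes k :: "real^2 \<Rightarrow> real"
  assumes "C1_on (-{0}) k"
  shows "C1_on (- p ` M) (\<lambda>w. c + (\<Sum>a\<in>M. b a * k (w - p a)))"
proof (rule C1_onI[where G="\<lambda>w. \<Sum>a\<in>M. b a *\<^sub>R grad k (w - p a)"])
  show "((\<lambda>w. c + (\<Sum>a\<in>M. b a * k (w - p a))) has_derivative
     (\<lambda>v. (\<Sum>a\<in>M. b a *\<^sub>R grad k (w - p a)) \<bullet> v)) (at w)" if "w \<in> - p ` M" for w
    using has_derivative_translated_sum[OF assms, of w p M c b] that by simp
  show "continuous_on (- p ` M) (\<lambda>w. \<Sum>a\<in>M. b a *\<^sub>R grad k (w - p a))"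
  proof (intro continuous_on_sum continuous_on_scaleR continuous_on_const)
    fix a assume "a \<in> M"
    then show "continuous_on (- p ` M) (\<lambda>w. grad k (w - p a))"
      using assms unfolding C1_on_def
      by (intro continuous_on_compose2[of "-{0}" "grad k" _ "\<lambda>w. w - p a"])
        (auto intro: continuous_on_diff continuous_on_id continuous_on_const)
  qed
qed

text \<open>Cauchy-Schwarz for a sum of \<open>card M\<close> gradients costs one factor
  \<open>card M\<close>, and adding \<open>card M\<close> equal integrals costs the other. Such a
  crude bound suffices because the energy of \<open>k\<close> will be chosen after \<open>M\<close>
  and \<open>K\<close>.\<close>

lemma energy_translated_sum_le:
  fixes k :: "real^2 \<Rightarrow> real"
  assumes k: "C1_on (-{0}) k" and M: "finite M" and b: "\<And>a. a \<in> M \<Longrightarrow> \<bar>b a\<bar> \<le> K" and K: "K \<ge> 0"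
  shows "energy (- p ` M) (\<lambda>w. c + (\<Sum>a\<in>M. b a * k (w - p a)))
    \<le> ennreal ((real (card M))\<^sup>2 * K\<^sup>2) * energy (-{0}) k"
proof -
  define E where "E w = ennreal ((norm (grad k w))\<^sup>2) * indicator (-{0}) w" for w
  have Em: "E \<in> borel_measurable borel"
    unfolding E_def[abs_def] by (rule grad_square_measurable[OF _ k]) auto
  let ?f = "\<lambda>w. c + (\<Sum>a\<in>M. b a * k (w - p a))"
  have le: "ennreal ((norm (grad ?f w))\<^sup>2) * indicator (- p ` M) w \<le> ennreal (card M * K\<^sup>2) * (\<Sum>a\<in>M. E (w - p a))" for w
  proof (cases "w \<in> p ` M")
    case False
    have g: "grad ?f w = (\<Sum>a\<in>M. b a *\<^sub>R grad k (w - p a))"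
      by (rule grad_eqI[OF has_derivative_translated_sum[OF k False]])
    have "norm (grad ?f w) \<le> (\<Sum>a\<in>M. 1 * (K * norm (grad k (w - p a))))"
      unfolding g by (rule sum_norm_le) (use b in \<open>auto intro: mult_right_mono\<close>)
    then have "(norm (grad ?f w))\<^sup>2 \<le> (\<Sum>a\<in>M. 1 * (K * norm (grad k (w - p a))))\<^sup>2"
      by (intro power_mono) auto
    also have "\<dots> \<le> (\<Sum>a\<in>M. 1\<^sup>2) * (\<Sum>a\<in>M. (K * norm (grad k (w - p a)))\<^sup>2)"
      by (rule Cauchy_Schwarz_ineq_sum)
    also have "\<dots> = card M * K\<^sup>2 * (\<Sum>a\<in>M. (norm (grad k (w - p a)))\<^sup>2)"
      by (simp add: power_mult_distrib sum_distrib_left mult.assoc)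
    finally have "ennreal ((norm (grad ?f w))\<^sup>2) \<le> ennreal (card M * K\<^sup>2 * (\<Sum>a\<in>M. (norm (grad k (w - p a)))\<^sup>2))"
      by (rule ennreal_leI)
    also have "\<dots> = ennreal (card M * K\<^sup>2) * (\<Sum>a\<in>M. ennreal ((norm (grad k (w - p a)))\<^sup>2))"
      by (subst ennreal_mult) (auto intro: sum_nonneg)
    also have "(\<Sum>a\<in>M. ennreal ((norm (grad k (w - p a)))\<^sup>2)) = (\<Sum>a\<in>M. E (w - p a))"
      using False by (intro sum.cong) (auto simp: E_def indicator_def)
    finally show ?thesis using False by simp
  qed simp
  have "energy (- p ` M) ?f \<le> (\<integral>\<^sup>+w. ennreal (card M * K\<^sup>2) * (\<Sum>a\<in>M. E (w - p a)) \<partial>lborel)"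
    unfolding energy_def by (intro nn_integral_mono le)
  also have "\<dots> = ennreal (card M * K\<^sup>2) * (\<Sum>a\<in>M. \<integral>\<^sup>+w. E (w - p a) \<partial>lborel)"
    using Em by (subst nn_integral_cmult) (auto simp: nn_integral_sum)
  also have "(\<Sum>a\<in>M. \<integral>\<^sup>+w. E (w - p a) \<partial>lborel) = of_nat (card M) * energy (-{0}) k"
    by (simp add: nn_integral_lborel_translate[OF Em]) (simp add: energy_def E_def[abs_def])
  also have "ennreal (card M * K\<^sup>2) * (of_nat (card M) * energy (-{0}) k) =
      ennreal ((real (card M))\<^sup>2 * K\<^sup>2) * energy (-{0}) k"
  proof -
    have "ennreal ((real (card M))\<^sup>2 * K\<^sup>2) = ennreal (card M * K\<^sup>2) * ennreal (card M)"
      by (subst ennreal_mult[symmetric]) (use K in \<open>simp_all add: power2_eq_square mult_ac\<close>)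
    then show ?thesis by (simp only: mult.assoc ennreal_of_nat_eq_real_of_nat)
  qed
  finally show ?thesis .
qed

section \<open>Homeomorphisms of the plane\<close>

lemma homeomorphism_UNIV_D:
  assumes "homeomorphism UNIV UNIV h g"
  shows "g (h x) = x" "h (g y) = y" "continuous_on UNIV h" "continuous_on UNIV g" "h ` S = g -` S"
proof -
  show 1: "g (h x) = x" "h (g y) = y" for x y
    using assms by (simp_all add: homeomorphism_def)
  show "continuous_on UNIV h" "continuous_on UNIV g"
    using assms by (simp_all add: homeomorphism_def)
  show "h ` S = g -` S"
  proof
    show "h ` S \<subseteq> g -` S" using 1 by auto
    show "g -` S \<subseteq> h ` S"
    proof
      fix y assume "y \<in> g -` S"
      then have "h (g y) \<in> h ` S" by blast
      then show "y \<in> h ` S" using 1 by simp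
    qed
  qed
qed

lemma homeomorphism_UNIV_open_image:
  "homeomorphism UNIV UNIV h g \<Longrightarrow> open S \<Longrightarrow> open (h ` S)"
  using open_vimage homeomorphism_UNIV_D(4,5) by metis

lemma homeomorphism_UNIV_closed_image:
  "homeomorphism UNIV UNIV h g \<Longrightarrow> closed S \<Longrightarrow> closed (h ` S)"
  using closed_vimage homeomorphism_UNIV_D(4,5) by metis

subsection \<open>Logarithmic potentials\<close>

definition ramp_sq :: "real \<Rightarrow> real" where "ramp_sq t = (max 0 t)\<^sup>2"

lemma ramp_sq_deriv: "(ramp_sq has_real_derivative 2 * max 0 t) (at t)"
proof -
  consider "t < 0" | "t > 0" | "t = 0" by linarith
  then show ?thesis
  proof cases
    case 1
    have "((\<lambda>t. 0) has_real_derivative 0) (at t)" by simp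
    then have "(ramp_sq has_real_derivative 0) (at t)"
      by (rule has_field_derivative_transform_within_open[where S="{..<0}"]) (use 1 in \<open>auto simp: ramp_sq_def\<close>)
    then show ?thesis using 1 by simp
  next
    case 2
    have "((\<lambda>t. t\<^sup>2) has_real_derivative 2 * t) (at t)" by (auto intro!: derivative_eq_intros)
    then have "(ramp_sq has_real_derivative 2 * t) (at t)"
      by (rule has_field_derivative_transform_within_open[where S="{0<..}"]) (use 2 in \<open>auto simp: ramp_sq_def\<close>)
    then show ?thesis using 2 by simp
  next
    case 3
    have "((\<lambda>y. (ramp_sq y - ramp_sq 0) / (y - 0)) \<longlongrightarrow> 0) (at 0)"
    proof (rule Lim_null_comparison)
      show "\<forall>\<^sub>F y in at 0. norm ((ramp_sq y - ramp_sq 0) / (y - 0)) \<le> \<bar>y\<bar>"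
        by (intro always_eventually) (auto simp: ramp_sq_def max_def power2_eq_square)
      show "((\<lambda>y::real. \<bar>y\<bar>) \<longlongrightarrow> 0) (at 0)" by (auto intro!: tendsto_eq_intros)
    qed
    then show ?thesis using 3 by (simp add: has_field_derivative_iff)
  qed
qed

text \<open>A quadratic spline: its derivative is the hat function on [0, 1] with peak 2 at 1/2,
  which has integral 1. So this is a continuously differentiable step from 0 to 1.\<close>

definition step_fn :: "real \<Rightarrow> real" where
  "step_fn t = 2 * ramp_sq t - 4 * ramp_sq (t - 1/2) + 2 * ramp_sq (t - 1)"

definition step_fn' :: "real \<Rightarrow> real" where
  "step_fn' t = 4 * max 0 t - 8 * max 0 (t - 1/2) + 4 * max 0 (t - 1)"

lemma step_fn_deriv: "(step_fn has_real_derivative step_fn' t) (at t)"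
  unfolding step_fn_def[abs_def] step_fn'_def
  by (rule derivative_eq_intros ramp_sq_deriv[THEN DERIV_chain2] refl | simp)+

lemma step_fn'_continuous: "continuous_on A step_fn'"
  unfolding step_fn'_def by (intro continuous_intros)

lemma step_fn_le_0: "t \<le> 0 \<Longrightarrow> step_fn t = 0" "t \<le> 0 \<Longrightarrow> step_fn' t = 0"
  by (auto simp: step_fn_def step_fn'_def ramp_sq_def)

lemma step_fn_ge_1: "t \<ge> 1 \<Longrightarrow> step_fn t = 1" "t \<ge> 1 \<Longrightarrow> step_fn' t = 0"
  by (auto simp: step_fn_def step_fn'_def ramp_sq_def max_def power2_eq_square algebra_simps)

lemma step_fn'_bounds: "0 \<le> step_fn' t" "step_fn' t \<le> 2"
  by (auto simp: step_fn'_def max_def)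

lemma step_fn_bounds: "0 \<le> step_fn t" "step_fn t \<le> 1"
proof -
  have m: "a \<le> b \<Longrightarrow> step_fn a \<le> step_fn b" for a b
    by (rule DERIV_nonneg_imp_nondecreasing) (use step_fn_deriv step_fn'_bounds in blast)+
  show "0 \<le> step_fn t" using m[of "min t 0" t] step_fn_le_0[of "min t 0"] by simp
  show "step_fn t \<le> 1" using m[of t "max t 1"] step_fn_ge_1[of "max t 1"] by simp
qed

text \<open>The classical unbounded function with finite energy around a point of the plane. Near
  the origin \<open>loglog_weight\<close> is the squared norm of its gradient.\<close>

definition loglog :: "real^2 \<Rightarrow> real" where "loglog z = ln (- ln (norm z))"

definition loglog_weight :: "real^2 \<Rightarrow> real" where
  "loglog_weight z = (if z \<noteq> 0 \<and> norm z < 1/2 then (1 / (norm z * ln (norm z)))\<^sup>2 else 0)"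

lemma loglog_weight_nonneg: "0 \<le> loglog_weight z"
  by (simp add: loglog_weight_def)

lemma loglog_weight_measurable [measurable]: "loglog_weight \<in> borel_measurable borel"
  unfolding loglog_weight_def[abs_def] by measurable

lemma loglog_measurable [measurable]: "loglog \<in> borel_measurable borel"
  unfolding loglog_def[abs_def] by measurable

text \<open>On the dyadic annulus \<open>A j\<close> the area compensates the factor
  \<open>1 / (norm z)\<^sup>2\<close>, and the logarithm, comparable to \<open>Suc j\<close>, leaves
  a multiple of \<open>1 / (Suc j)\<^sup>2\<close>, which is summable.\<close>

lemma nn_integral_loglog_weight_finite: "(\<integral>\<^sup>+z. ennreal (loglog_weight z) \<partial>lborel) < \<infinity>"
proof -
  define A where "A j = {z::real^2. (1/2) ^ Suc (Suc j) \<le> norm z \<and> norm z \<le> (1/2) ^ Suc j}" for j :: nat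
  define c where "c j = (4 * 2 ^ j / (real (Suc j) * ln 2))\<^sup>2" for j :: nat
  have [measurable]: "A j \<in> sets borel" for j unfolding A_def by measurable
  have le: "ennreal (loglog_weight z) \<le> (\<Sum>j. ennreal (c j) * indicator (A j) z)" for z
  proof (cases "z \<noteq> 0 \<and> norm z < 1/2")
    case True
    then have r: "0 < norm z" "norm z < 1/2" by auto
    obtain n where n: "(1/2) ^ n < norm z" using real_arch_pow_inv[OF r(1), of "1/2"] by auto
    define m where "m = (LEAST n. (1/2) ^ n < norm z)"
    have m: "(1/2) ^ m < norm z" unfolding m_def by (rule LeastI[of _ n]) (rule n)
    have "m \<noteq> 0" using m r by (cases m) auto
    moreover have "m \<noteq> 1" using m r by auto
    ultimately obtain j where j: "m = Suc (Suc j)" by (metis One_nat_def not0_implies_Suc)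
    have "\<not> (1/2) ^ Suc j < norm z" using not_less_Least[of "Suc j" "\<lambda>n. (1/2) ^ n < norm z"] j unfolding m_def by simp
    then have zA: "z \<in> A j" using m j by (simp add: A_def)
    have "loglog_weight z \<le> c j"
    proof -
      have "ln (norm z) \<le> ln ((1/2) ^ Suc j)" using zA r unfolding A_def by (subst ln_le_cancel_iff) auto
      also have "\<dots> = - (real (Suc j) * ln 2)" by (simp add: ln_realpow ln_div algebra_simps)
      finally have 1: "real (Suc j) * ln 2 \<le> \<bar>ln (norm z)\<bar>" by linarith
      have "(1/2) ^ Suc (Suc j) * (real (Suc j) * ln 2) \<le> norm z * \<bar>ln (norm z)\<bar>"
        using 1 zA by (intro mult_mono) (auto simp: A_def)
      moreover have pos: "0 < (1/2::real) ^ Suc (Suc j) * (real (Suc j) * ln 2)" by simp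
      moreover have "0 < norm z * \<bar>ln (norm z)\<bar>"
        using r ln_less_zero[of "norm z"] by (intro mult_pos_pos) auto
      ultimately have "1 / (norm z * \<bar>ln (norm z)\<bar>) \<le> 1 / ((1/2) ^ Suc (Suc j) * (real (Suc j) * ln 2))"
        by (simp only: frac_le zero_le_one order_refl)
      also have "\<dots> = 4 * 2 ^ j / (real (Suc j) * ln 2)" by (simp add: field_simps power_one_over)
      finally have "\<bar>1 / (norm z * ln (norm z))\<bar> \<le> 4 * 2 ^ j / (real (Suc j) * ln 2)"
        by (simp add: abs_mult)
      then have "(1 / (norm z * ln (norm z)))\<^sup>2 \<le> c j" unfolding c_def
        by (metis abs_ge_zero power2_abs power_mono)
      then show ?thesis using True by (simp add: loglog_weight_def)
    qed
    then have "ennreal (loglog_weight z) \<le> ennreal (c j) * indicator (A j) z"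
      using zA by (simp add: ennreal_leI)
    also have "\<dots> \<le> (\<Sum>j. ennreal (c j) * indicator (A j) z)"
      using sum_le_suminf[of "\<lambda>j. ennreal (c j) * indicator (A j) z" "{j}"]
      by (simp del: sum_mult_indicator)
    finally show ?thesis .
  qed (auto simp: loglog_weight_def)
  define V where "V = unit_ball_vol 2"
  have V: "V \<ge> 0" by (simp add: V_def)
  have "(\<integral>\<^sup>+z. ennreal (loglog_weight z) \<partial>lborel) \<le> (\<integral>\<^sup>+z. (\<Sum>j. ennreal (c j) * indicator (A j) z) \<partial>lborel)"
    by (intro nn_integral_mono le)
  also have "\<dots> = (\<Sum>j. \<integral>\<^sup>+z. ennreal (c j) * indicator (A j) z \<partial>lborel)"
    by (rule nn_integral_suminf) measurable
  also have "\<dots> = (\<Sum>j. ennreal (c j) * emeasure lborel (A j))"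
    by (simp add: nn_integral_cmult_indicator)
  also have "\<dots> \<le> (\<Sum>j. ennreal (4 * V / (ln 2)\<^sup>2 * (1 / real (Suc j) ^ 2)))"
  proof (rule suminf_le)
    fix j
    have "emeasure lborel (A j) \<le> emeasure lborel (cball (0::real^2) ((1/2) ^ Suc j))"
      by (intro emeasure_mono) (auto simp: A_def)
    also have "\<dots> = ennreal (V * ((1/2) ^ Suc j) ^ 2)"
      by (subst emeasure_cball) (auto simp: V_def)
    finally have "ennreal (c j) * emeasure lborel (A j) \<le> ennreal (c j) * ennreal (V * ((1/2) ^ Suc j) ^ 2)"
      by (intro mult_left_mono) auto
    also have "\<dots> = ennreal (c j * (V * ((1/2) ^ Suc j) ^ 2))"
      using V by (intro ennreal_mult[symmetric]) (auto simp: c_def)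
    also have "c j * (V * ((1/2) ^ Suc j) ^ 2) = 4 * V / (ln 2)\<^sup>2 * (1 / real (Suc j) ^ 2)"
      by (simp add: c_def power_mult_distrib power_divide power_one_over field_simps)
        (simp add: power2_eq_square algebra_simps)
    finally show "ennreal (c j) * emeasure lborel (A j) \<le> ennreal (4 * V / (ln 2)\<^sup>2 * (1 / real (Suc j) ^ 2))" .
  qed auto
  also have "\<dots> < \<infinity>"
  proof -
    have "summable (\<lambda>j. inverse (real (Suc j) ^ 2))"
      using inverse_power_summable[of 2, where 'a=real] by (subst summable_Suc_iff) simp
    then have "summable (\<lambda>j. 4 * V / (ln 2)\<^sup>2 * (1 / real (Suc j) ^ 2))"
      by (intro summable_mult) (simp add: divide_inverse)
    then have "(\<Sum>j. ennreal (4 * V / (ln 2)\<^sup>2 * (1 / real (Suc j) ^ 2))) = ennreal (\<Sum>j. 4 * V / (ln 2)\<^sup>2 * (1 / real (Suc j) ^ 2))"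
      using V by (intro suminf_ennreal2) auto
    then show ?thesis by simp
  qed
  finally show ?thesis .
qed

text \<open>The weight is the density of a finite measure, and the sets decrease to the empty set
  because \<open>loglog\<close> takes real values only; so continuity from above applies.\<close>

lemma nn_integral_loglog_weight_tail:
  assumes "e > 0"
  shows "\<forall>\<^sub>F N in sequentially. (\<integral>\<^sup>+z\<in>{z. real N < loglog z}. ennreal (loglog_weight z) \<partial>lborel) \<le> ennreal e"
proof -
  define \<mu> where "\<mu> = density lborel (\<lambda>z. ennreal (loglog_weight z))"
  define A where "A N = {z. real N < loglog z}" for N :: nat
  have [measurable]: "A N \<in> sets borel" for N unfolding A_def by measurable
  have em: "emeasure \<mu> (A N) = (\<integral>\<^sup>+z\<in>A N. ennreal (loglog_weight z) \<partial>lborel)" for N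
    unfolding \<mu>_def by (simp add: emeasure_density)
  have "(\<lambda>N. emeasure \<mu> (A N)) \<longlonglongrightarrow> emeasure \<mu> (\<Inter>N. A N)"
  proof (rule Lim_emeasure_decseq)
    show "range A \<subseteq> sets \<mu>" by (auto simp: \<mu>_def)
    show "decseq A" by (auto simp: decseq_def A_def)
    show "emeasure \<mu> (A i) \<noteq> \<infinity>" for i
    proof -
      have "emeasure \<mu> (A i) \<le> (\<integral>\<^sup>+z. ennreal (loglog_weight z) \<partial>lborel)"
        unfolding em by (intro nn_integral_mono) (auto simp: indicator_def)
      then show ?thesis using nn_integral_loglog_weight_finite by (simp add: top_unique less_top)
    qed
  qed
  moreover have "(\<Inter>N. A N) = {}"
    using reals_Archimedean2 by (fastforce simp: A_def intro: less_asym)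
  ultimately have "(\<lambda>N. emeasure \<mu> (A N)) \<longlonglongrightarrow> 0" by simp
  then have "\<forall>\<^sub>F N in sequentially. emeasure \<mu> (A N) < ennreal e"
    using assms by (intro order_tendstoD) auto
  then show ?thesis by (rule eventually_mono) (simp add: em[unfolded A_def] A_def)
qed

text \<open>The cut at \<open>norm z < 1/2\<close> discards the junk values of the logarithm of nonpositive numbers.\<close>

definition log_potential :: "(real \<Rightarrow> real) \<Rightarrow> real \<Rightarrow> real \<Rightarrow> real^2 \<Rightarrow> real" where
  "log_potential f l N z = (if z = 0 then l else if norm z < 1/2 then f (loglog z - N) else 0)"

text \<open>The number 0.4 lies between \<open>exp (-1)\<close>, the radius where
  \<open>loglog\<close> vanishes, and the cut at 1/2. On the annulus in between both branches of
  \<open>log_potential\<close> are 0 for the profiles considered, so they glue smoothly.\<close>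

lemma loglog_neg: "0.4 < norm z \<Longrightarrow> norm z < 1 \<Longrightarrow> loglog z < 0"
proof -
  assume z: "0.4 < norm z" "norm z < 1"
  have "exp (-1::real) \<le> 0.4"
    using exp_lower_Taylor_quadratic[of "1::real"] by (simp add: exp_minus field_simps)
  then have "exp (-1) < norm z" using z by linarith
  then have "ln (exp (-1)) < ln (norm z)" by (subst ln_less_cancel_iff) (use z in auto)
  moreover have "ln (norm z) < 0" using z by (intro ln_less_zero) auto
  ultimately show ?thesis unfolding loglog_def by (subst ln_less_zero_iff) auto
qed

text \<open>By the chain rule the squared gradient is the squared slope of the profile times
  \<open>loglog_weight\<close>, and the slope vanishes where \<open>loglog\<close> is at most
  \<open>N\<close>. Continuity at 0 holds because \<open>loglog\<close> tends to infinity there and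
  \<open>l\<close> is the limit of the profile at infinity.\<close>

lemma log_potential_properties:
  fixes f f' :: "real \<Rightarrow> real"
  assumes d: "\<And>t. (f has_real_derivative f' t) (at t)" and c: "continuous_on UNIV f'"
    and z: "\<And>t. t \<le> 0 \<Longrightarrow> f t = 0" "\<And>t. t \<le> 0 \<Longrightarrow> f' t = 0"
    and B: "\<And>t. \<bar>f' t\<bar> \<le> B" and lim: "(f \<longlongrightarrow> l) at_top" and N: "N \<ge> 0"
  shows "continuous_on UNIV (log_potential f l N)" "C1_on (-{0}) (log_potential f l N)"
    "w \<noteq> 0 \<Longrightarrow> (norm (grad (log_potential f l N) w))\<^sup>2 \<le> B\<^sup>2 * (loglog_weight w * indicator {w. N < loglog w} w)"
proof -
  let ?P = "log_potential f l N"
  define G where "G w = (if w \<noteq> 0 \<and> norm w < 1/2 then (f' (loglog w - N) / ((norm w)\<^sup>2 * ln (norm w))) *\<^sub>R w else 0)" for w :: "real^2"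
  have op1: "open {w::real^2. w \<noteq> 0 \<and> norm w < 1/2}"
    by (intro open_Collect_conj open_Collect_neq open_Collect_less continuous_intros)
  have op2: "open {w::real^2. 0.4 < norm w}"
    by (intro open_Collect_less continuous_intros)
  have low: "loglog w - N \<le> 0" if "0.4 < norm w" "norm w < 1/2" for w
    using loglog_neg[of w] that N by simp
  have P0: "?P w = 0" if "0.4 < norm w" for w
    using low that z by (auto simp: log_potential_def)
  have G0: "G w = 0" if "0.4 < norm w" for w
    using low that z by (auto simp: G_def)
  have der: "(?P has_derivative (\<lambda>v. G w \<bullet> v)) (at w)" if "w \<noteq> 0" for w
  proof (cases "norm w < 1/2")
    case True
    have ln: "ln (norm w) < 0" using True that by simp
    have nd: "(norm has_derivative (\<lambda>v. v \<bullet> sgn w)) (at w)"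
      using has_derivative_norm[OF that] .
    have "((\<lambda>r. ln (- ln r) - N) has_real_derivative 1 / (norm w * ln (norm w))) (at (norm w))"
      using ln that by (auto intro!: derivative_eq_intros simp: divide_simps)
    from DERIV_chain2[OF d this]
    have "((\<lambda>r. f (ln (- ln r) - N)) has_real_derivative
        f' (ln (- ln (norm w)) - N) / (norm w * ln (norm w))) (at (norm w))" by simp
    then have "((\<lambda>r. f (ln (- ln r) - N)) has_derivative
        (\<lambda>h. f' (ln (- ln (norm w)) - N) / (norm w * ln (norm w)) * h)) (at (norm w))"
      unfolding has_field_derivative_def .
    from has_derivative_compose[OF nd this]
    have "((\<lambda>w. f (ln (- ln (norm w)) - N)) has_derivative
        (\<lambda>v. f' (ln (- ln (norm w)) - N) / (norm w * ln (norm w)) * (v \<bullet> sgn w))) (at w)" .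
    moreover have "(\<lambda>v. f' (ln (- ln (norm w)) - N) / (norm w * ln (norm w)) * (v \<bullet> sgn w)) = (\<lambda>v. G w \<bullet> v)"
      using True that
      by (auto simp: G_def loglog_def sgn_div_norm inner_commute power2_eq_square fun_eq_iff divide_simps)
    ultimately have "((\<lambda>w. f (ln (- ln (norm w)) - N)) has_derivative (\<lambda>v. G w \<bullet> v)) (at w)"
      by simp
    then show ?thesis
      by (rule has_derivative_transform_within_open[OF _ op1])
        (use True that in \<open>auto simp: log_potential_def loglog_def\<close>)
  next
    case False
    then have *: "0.4 < norm w" by simp
    have "((\<lambda>w. 0::real) has_derivative (\<lambda>v. 0)) (at w)" by simp
    then have "(?P has_derivative (\<lambda>v. 0)) (at w)"
      by (rule has_derivative_transform_within_open[OF _ op2]) (use * P0 in auto)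
    then show ?thesis using G0[OF *] by simp
  qed
  have Gc: "continuous_on (-{0}) G"
  proof -
    have "continuous_on ({w::real^2. w \<noteq> 0 \<and> norm w < 1/2} \<union> {w::real^2. 0.4 < norm w}) G"
    proof (rule continuous_on_open_Un[OF op1 op2])
      have "continuous_on {w::real^2. w \<noteq> 0 \<and> norm w < 1/2}
          (\<lambda>w. (f' (ln (- ln (norm w)) - N) / ((norm w)\<^sup>2 * ln (norm w))) *\<^sub>R w)"
        by (intro continuous_intros continuous_on_compose2[OF c]) auto
      then show "continuous_on {w::real^2. w \<noteq> 0 \<and> norm w < 1/2} G"
        by (rule continuous_on_eq) (auto simp: G_def loglog_def)
      have "continuous_on {w::real^2. 0.4 < norm w} (\<lambda>w. 0::real^2)" by simp
      then show "continuous_on {w::real^2. 0.4 < norm w} G"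
        by (rule continuous_on_eq) (auto simp: G0)
    qed
    moreover have "{w::real^2. w \<noteq> 0 \<and> norm w < 1/2} \<union> {w::real^2. 0.4 < norm w} = -{0}" by auto
    ultimately show ?thesis by simp
  qed
  show "C1_on (-{0}) ?P" by (rule C1_onI[OF der Gc]) auto
  show "(norm (grad ?P w))\<^sup>2 \<le> B\<^sup>2 * (loglog_weight w * indicator {w. N < loglog w} w)" if "w \<noteq> 0" for w
  proof -
    have "grad ?P w = G w" using grad_eqI[OF der[OF that]] .
    moreover have "(norm (G w))\<^sup>2 \<le> B\<^sup>2 * (loglog_weight w * indicator {w. N < loglog w} w)"
    proof (cases "norm w < 1/2 \<and> N < loglog w")
      case True
      have "norm (G w) = \<bar>f' (loglog w - N)\<bar> * \<bar>1 / (norm w * ln (norm w))\<bar>"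
        using True that by (simp add: G_def abs_mult power2_eq_square)
      then have "(norm (G w))\<^sup>2 = (f' (loglog w - N))\<^sup>2 * loglog_weight w"
        using True that by (simp add: loglog_weight_def power_mult_distrib power_divide)
      also have "\<dots> \<le> B\<^sup>2 * loglog_weight w"
        using B[of "loglog w - N"] loglog_weight_nonneg
        by (intro mult_right_mono) (auto simp: abs_le_square_iff[symmetric])
      finally show ?thesis using True by simp
    next
      case False
      then have "G w = 0" using z(2)[of "loglog w - N"] by (auto simp: G_def)
      then show ?thesis by (simp add: loglog_weight_nonneg)
    qed
    ultimately show ?thesis by simp
  qed
  have at0: "(?P \<longlongrightarrow> l) (at 0)"
  proof -
    have "filterlim (\<lambda>w::real^2. norm w) (at_right 0) (at 0)"
      unfolding filterlim_at by (auto intro!: tendsto_eq_intros simp: eventually_at_filter)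
    moreover have "filterlim (\<lambda>r::real. ln (- ln r) - N) at_top (at_right 0)" by real_asymp
    ultimately have "filterlim (\<lambda>w. loglog w - N) at_top (at 0)"
      unfolding loglog_def using filterlim_compose by blast
    then have "((\<lambda>w. f (loglog w - N)) \<longlongrightarrow> l) (at 0)" using filterlim_compose[OF lim] by blast
    moreover have "\<forall>\<^sub>F w in at 0. f (loglog w - N) = ?P w"
      unfolding eventually_at by (intro exI[of _ "1/2"]) (auto simp: log_potential_def)
    ultimately show ?thesis by (rule Lim_transform_eventually)
  qed
  show "continuous_on UNIV ?P"
    unfolding continuous_on_eq_continuous_at[OF open_UNIV]
  proof
    fix w :: "real^2"
    show "isCont ?P w"
    proof (cases "w = 0")
      case True
      then show ?thesis using at0 by (simp add: isCont_def log_potential_def)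
    next
      case False
      then show ?thesis using der has_derivative_continuous by blast
    qed
  qed
qed

lemma loglog_large_imp_small:
  assumes "\<rho> > 0"
  shows "\<forall>\<^sub>F N in sequentially. \<forall>z. z \<noteq> 0 \<and> norm z < 1/2 \<and> real N < loglog z \<longrightarrow> norm z < \<rho>"
proof -
  have "((\<lambda>N. exp (- exp (real N))) \<longlongrightarrow> 0) sequentially" by real_asymp
  then have "\<forall>\<^sub>F N in sequentially. exp (- exp (real N)) < \<rho>"
    using assms by (auto dest: order_tendstoD)
  then show ?thesis
  proof (rule eventually_mono, clarify)
    fix N and z :: "real^2"
    assume N: "exp (- exp (real N)) < \<rho>" and z: "z \<noteq> 0" "norm z < 1/2" "real N < loglog z"
    have "- ln (norm z) > 0" using z by simp
    then have "exp (real N) < - ln (norm z)"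
      using z(3) unfolding loglog_def by (metis exp_less_cancel_iff exp_ln)
    then have "ln (norm z) < - exp (real N)" by simp
    then have "norm z < exp (- exp (real N))"
      using z by (metis exp_less_cancel_iff exp_ln zero_less_norm_iff)
    then show "norm z < \<rho>" using N by simp
  qed
qed

lemma energy_le:
  assumes "\<And>w. w \<in> V \<Longrightarrow> (norm (grad f w))\<^sup>2 \<le> C * F w" "C \<ge> 0" "\<And>w. F w \<ge> 0" "F \<in> borel_measurable borel"
  shows "energy V f \<le> ennreal C * (\<integral>\<^sup>+w. ennreal (F w) \<partial>lborel)"
proof -
  have "energy V f \<le> (\<integral>\<^sup>+w. ennreal C * ennreal (F w) \<partial>lborel)"
    unfolding energy_def using assms(1-3)
    by (intro nn_integral_mono) (auto simp: indicator_def ennreal_mult[symmetric] intro!: ennreal_leI)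
  also have "\<dots> = ennreal C * (\<integral>\<^sup>+w. ennreal (F w) \<partial>lborel)"
    by (rule nn_integral_cmult) (use assms in measurable)
  finally show ?thesis .
qed

text \<open>Raising \<open>N\<close> shrinks the support and, by the tail estimate, the energy as
  well. The slope bound 3 serves both profiles used below, the step and the damped step of the cusp;
  its square is the 9 in the proof.\<close>

lemma log_potential_exists:
  fixes f f' :: "real \<Rightarrow> real"
  assumes "\<And>t. (f has_real_derivative f' t) (at t)" "continuous_on UNIV f'"
    and z: "\<And>t. t \<le> 0 \<Longrightarrow> f t = 0" "\<And>t. t \<le> 0 \<Longrightarrow> f' t = 0"
    and "\<And>t. \<bar>f' t\<bar> \<le> 3" "(f \<longlongrightarrow> l) at_top" and \<rho>: "\<rho> > 0" and e: "e > 0"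
  obtains N :: nat where "continuous_on UNIV (log_potential f l N)" "C1_on (-{0}) (log_potential f l N)"
    "\<And>z. \<rho> \<le> norm z \<Longrightarrow> log_potential f l N z = 0" "energy (-{0}) (log_potential f l N) \<le> ennreal e"
proof -
  have "\<forall>\<^sub>F N in sequentially. (\<forall>z. z \<noteq> 0 \<and> norm z < 1/2 \<and> real N < loglog z \<longrightarrow> norm z < \<rho>) \<and>
      (\<integral>\<^sup>+z\<in>{z. real N < loglog z}. ennreal (loglog_weight z) \<partial>lborel) \<le> ennreal (e / 9)"
    using \<rho> e by (intro eventually_conj loglog_large_imp_small nn_integral_loglog_weight_tail) auto
  then obtain N :: nat where N: "\<And>z. z \<noteq> 0 \<Longrightarrow> norm z < 1/2 \<Longrightarrow> real N < loglog z \<Longrightarrow> norm z < \<rho>"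
      "(\<integral>\<^sup>+z\<in>{z. real N < loglog z}. ennreal (loglog_weight z) \<partial>lborel) \<le> ennreal (e / 9)"
    unfolding eventually_sequentially by blast
  let ?P = "log_potential f l (real N)"
  note P = log_potential_properties[OF assms(1-6), of "real N"]
  show ?thesis
  proof (rule that[of N])
    show "continuous_on UNIV ?P" "C1_on (-{0}) ?P" using P(1,2) by auto
    show "?P z = 0" if "\<rho> \<le> norm z" for z
    proof -
      have "z \<noteq> 0" using that \<rho> by auto
      then show ?thesis using N(1)[of z] that z(1)[of "loglog z - real N"]
        by (auto simp: log_potential_def not_less[symmetric])
    qed
    have "energy (-{0}) ?P \<le> ennreal (3\<^sup>2) * (\<integral>\<^sup>+w. ennreal (loglog_weight w * indicator {w. real N < loglog w} w) \<partial>lborel)"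
      by (rule energy_le) (use P(3) loglog_weight_nonneg in auto)
    also have "(\<integral>\<^sup>+w. ennreal (loglog_weight w * indicator {w. real N < loglog w} w) \<partial>lborel)
        = (\<integral>\<^sup>+z\<in>{z. real N < loglog z}. ennreal (loglog_weight z) \<partial>lborel)"
      by (intro nn_integral_cong) (auto simp: indicator_def)
    also have "ennreal (3\<^sup>2) * \<dots> \<le> ennreal (3\<^sup>2) * ennreal (e / 9)"
      by (intro mult_left_mono N) auto
    also have "\<dots> = ennreal e" using e by (subst ennreal_mult[symmetric]) auto
    finally show "energy (-{0}) ?P \<le> ennreal e" .
  qed
qed

text \<open>This is the zero capacity of a point: the energy can be prescribed independently of the
  radius of the support.\<close>

lemma point_cutoff_exists:
  assumes "\<rho> > 0" "e > 0"
  obtains k :: "real^2 \<Rightarrow> real" where "continuous_on UNIV k" "k 0 = 1" "\<And>z. 0 \<le> k z \<and> k z \<le> 1"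
    "\<And>z. \<rho> \<le> norm z \<Longrightarrow> k z = 0" "C1_on (-{0}) k" "energy (-{0}) k \<le> ennreal e"
proof -
  have "(step_fn \<longlongrightarrow> 1) at_top"
    by (intro tendsto_eventually eventually_mono[OF eventually_ge_at_top[of 1]]) (rule step_fn_ge_1(1))
  moreover have "\<bar>step_fn' t\<bar> \<le> 3" for t using step_fn'_bounds[of t] by simp
  ultimately obtain N :: nat where "continuous_on UNIV (log_potential step_fn 1 N)"
    "C1_on (-{0}) (log_potential step_fn 1 N)" "\<And>z. \<rho> \<le> norm z \<Longrightarrow> log_potential step_fn 1 N z = 0"
    "energy (-{0}) (log_potential step_fn 1 N) \<le> ennreal e"
    using log_potential_exists[OF step_fn_deriv step_fn'_continuous step_fn_le_0 _ _ assms] by blast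
  then show ?thesis
    using step_fn_bounds by (intro that[of "log_potential step_fn 1 N"]) (auto simp: log_potential_def)
qed

lemma log_cusp_exists:
  assumes "\<rho> > 0"
  obtains G :: "real^2 \<Rightarrow> real" and c r where "continuous_on UNIV G" "G 0 = 0" "\<And>z. 0 \<le> G z \<and> G z \<le> 1"
    "\<And>z. \<rho> \<le> norm z \<Longrightarrow> G z = 0" "C1_on (-{0}) G" "energy (-{0}) G < \<infinity>" "c > 0" "0 < r" "r < 1"
    "\<And>z. 0 < norm z \<Longrightarrow> norm z < r \<Longrightarrow> G z \<ge> c / sqrt (- ln (norm z))"
proof -
  \<comment> \<open>In the variable \<open>t = loglog z\<close> the function
    \<open>1 / sqrt (- ln (norm z))\<close> is \<open>exp (- t / 2)\<close>; the factor
    \<open>step_fn\<close> switches it on smoothly at \<open>t = 0\<close>.\<close>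
  define f where "f t = step_fn t * exp (- t / 2)" for t
  define f' where "f' t = step_fn' t * exp (- t / 2) - step_fn t * exp (- t / 2) / 2" for t
  have d: "(f has_real_derivative f' t) (at t)" for t
    unfolding f_def[abs_def] f'_def
    by (rule derivative_eq_intros step_fn_deriv refl | simp)+
  have sc: "continuous_on UNIV step_fn"
    using step_fn_deriv DERIV_isCont continuous_at_imp_continuous_on by blast
  have c: "continuous_on UNIV f'"
    unfolding f'_def[abs_def] using sc step_fn'_continuous by (intro continuous_intros) auto
  have z: "f t = 0" "f' t = 0" if "t \<le> 0" for t
    using step_fn_le_0 that by (auto simp: f_def f'_def)
  have B: "\<bar>f' t\<bar> \<le> 3" for t
  proof (cases "t \<le> 0")
    case False
    then have e: "exp (- t / 2) \<le> 1" by simp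
    have "step_fn' t * exp (- t / 2) \<le> 2 * 1"
      using step_fn'_bounds e by (intro mult_mono) auto
    moreover have "step_fn t * exp (- t / 2) \<le> 1 * 1"
      using step_fn_bounds e by (intro mult_mono) auto
    moreover have "0 \<le> step_fn' t * exp (- t / 2)" "0 \<le> step_fn t * exp (- t / 2)"
      using step_fn'_bounds step_fn_bounds by auto
    ultimately show ?thesis unfolding f'_def by linarith
  qed (use z in auto)
  have b: "0 \<le> f t" "f t \<le> 1" for t
  proof -
    show "0 \<le> f t" using step_fn_bounds by (simp add: f_def)
    show "f t \<le> 1"
    proof (cases "t \<le> 0")
      case False
      then have e: "exp (- t / 2) \<le> 1" by simp
      have "step_fn t * exp (- t / 2) \<le> 1 * 1"
        using step_fn_bounds e by (intro mult_mono) auto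
      then show ?thesis by (simp add: f_def)
    qed (use z in auto)
  qed
  have lim: "(f \<longlongrightarrow> 0) at_top"
  proof (rule Lim_null_comparison)
    show "\<forall>\<^sub>F t in at_top. norm (f t) \<le> exp (- t / 2)"
      using step_fn_bounds by (intro always_eventually) (auto simp: f_def abs_mult mult_left_le_one_le)
    show "((\<lambda>t::real. exp (- t / 2)) \<longlongrightarrow> 0) at_top" by real_asymp
  qed
  obtain N :: nat where N: "continuous_on UNIV (log_potential f 0 N)" "C1_on (-{0}) (log_potential f 0 N)"
    "\<And>z. \<rho> \<le> norm z \<Longrightarrow> log_potential f 0 N z = 0" "energy (-{0}) (log_potential f 0 N) \<le> ennreal 1"
    using log_potential_exists[OF d c z B lim assms zero_less_one] by blast
  let ?G = "log_potential f 0 (real N)"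
  show ?thesis
  \<comment> \<open>The shift by \<open>N\<close> multiplies the cusp by \<open>exp (N / 2)\<close>.
    The radius is where \<open>loglog z - N\<close> reaches 1; further inside,
    \<open>step_fn\<close> equals 1.\<close>
  proof (rule that[of ?G "exp (real N / 2)" "exp (- exp (real N + 1))"])
    show "continuous_on UNIV ?G" "C1_on (-{0}) ?G" "\<And>z. \<rho> \<le> norm z \<Longrightarrow> ?G z = 0" using N(1-3) by auto
    show "energy (-{0}) ?G < \<infinity>" using le_less_trans[OF N(4)] by simp
    show "?G 0 = 0" by (simp add: log_potential_def)
    show "0 \<le> ?G z \<and> ?G z \<le> 1" for z
      using b by (auto simp: log_potential_def)
    show "exp (real N / 2) > 0" "0 < exp (- exp (real N + 1))" "exp (- exp (real N + 1)) < 1" by auto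
    show "exp (real N / 2) / sqrt (- ln (norm z)) \<le> ?G z" if z: "0 < norm z" "norm z < exp (- exp (real N + 1))" for z
    proof -
      have "ln (norm z) < - exp (real N + 1)" using z by (metis exp_less_cancel_iff exp_ln)
      then have l: "exp (real N + 1) < - ln (norm z)" by simp
      then have l0: "0 < - ln (norm z)" using exp_gt_zero[of "real N + 1"] by linarith
      have l1: "real N + 1 < loglog z" unfolding loglog_def using l l0 by (subst exp_less_cancel_iff[symmetric]) simp
      have "1 < exp (real N + 1)" by simp
      then have "1 < - ln (norm z)" using l by linarith
      have "exp (-1::real) \<le> 1 / 2" using exp_ge_add_one_self[of 1] by (simp add: exp_minus field_simps)
      moreover have "norm z < exp (- 1)"
      proof -
        have "exp (ln (norm z)) < exp (- 1)" using \<open>1 < - ln (norm z)\<close> by (subst exp_less_cancel_iff) simp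
        moreover have "exp (ln (norm z)) = norm z" using z by (intro exp_ln)
        ultimately show ?thesis by simp
      qed
      ultimately have nz: "norm z < 1 / 2" by linarith
      have "?G z = exp (- (loglog z - real N) / 2)"
        using l1 nz z by (auto simp: log_potential_def f_def step_fn_ge_1)
      also have "\<dots> = exp (real N / 2) * exp (- (loglog z / 2))"
        by (simp add: exp_add[symmetric] field_simps)
      also have "exp (- (loglog z / 2)) = 1 / sqrt (- ln (norm z))"
      proof -
        have "exp (loglog z / 2) = sqrt (- ln (norm z))"
          using l0 by (simp add: loglog_def ln_sqrt[symmetric])
        then show ?thesis by (simp add: exp_minus inverse_eq_divide)
      qed
      finally show ?thesis by simp
    qed
  qed
qed

subsection \<open>Cells and holes\<close>

text \<open>
  In affine coordinates the gasket lives in the triangle \<open>x \<ge> 0\<close>, \<open>y \<ge> 0\<close>, \<open>x + y \<le> 1\<close>; an element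
  of \<open>cells n\<close> is the right-angled corner of a triangle of side \<open>(1/2) ^ n\<close>.
\<close>

primrec cells :: "nat \<Rightarrow> (real \<times> real) set" where
  "cells 0 = {(0, 0)}"
| "cells (Suc n) = (\<Union>q\<in>cells n. {q, (fst q + (1/2) ^ Suc n, snd q), (fst q, snd q + (1/2) ^ Suc n)})"

definition cell :: "nat \<Rightarrow> real \<times> real \<Rightarrow> (real^2) set" where
  "cell n q = {z. fst q \<le> z $ 1 \<and> snd q \<le> z $ 2 \<and> z $ 1 + z $ 2 \<le> fst q + snd q + (1/2) ^ n}"

definition cell_int :: "nat \<Rightarrow> real \<times> real \<Rightarrow> (real^2) set" where
  "cell_int n q = {z. fst q < z $ 1 \<and> snd q < z $ 2 \<and> z $ 1 + z $ 2 < fst q + snd q + (1/2) ^ n}"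

definition hole :: "nat \<Rightarrow> real \<times> real \<Rightarrow> (real^2) set" where
  "hole n q = {z. z $ 1 < fst q + (1/2) ^ Suc n \<and> z $ 2 < snd q + (1/2) ^ Suc n \<and>
    fst q + snd q + (1/2) ^ Suc n < z $ 1 + z $ 2}"

definition hole_cl :: "nat \<Rightarrow> real \<times> real \<Rightarrow> (real^2) set" where
  "hole_cl n q = {z. z $ 1 \<le> fst q + (1/2) ^ Suc n \<and> z $ 2 \<le> snd q + (1/2) ^ Suc n \<and>
    fst q + snd q + (1/2) ^ Suc n \<le> z $ 1 + z $ 2}"

text \<open>The region where the staircase keeps its values from level \<open>n\<close> on: the
  outside, the sides of the cells of level \<open>n\<close> and the closed holes of earlier
  levels.\<close>

definition settled :: "nat \<Rightarrow> (real^2) set" where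
  "settled n = - (\<Union>q\<in>cells n. cell_int n q)"

definition holes :: "nat \<Rightarrow> nat \<Rightarrow> (real^2) set" where
  "holes n m = (\<Union>j\<in>{n..<m}. \<Union>q\<in>cells j. hole j q)"

section \<open>Combinatorics of cells and holes\<close>

lemma finite_cells: "finite (cells n)"
  by (induction n) auto

lemma cells_dyadic: "q \<in> cells n \<Longrightarrow> \<exists>i j :: int. q = (of_int i * (1/2) ^ n, of_int j * (1/2) ^ n)"
proof (induction n arbitrary: q)
  case 0
  then show ?case by (auto intro: exI[of _ 0])
next
  case (Suc n)
  then obtain p where p: "p \<in> cells n"
    and q: "q = p \<or> q = (fst p + (1/2) ^ Suc n, snd p) \<or> q = (fst p, snd p + (1/2) ^ Suc n)" by auto
  obtain i j :: int where ij: "p = (of_int i * (1/2) ^ n, of_int j * (1/2) ^ n)" using Suc.IH[OF p] by blast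
  have "q = (of_int (2 * i) * (1/2) ^ Suc n, of_int (2 * j) * (1/2) ^ Suc n) \<or>
      q = (of_int (2 * i + 1) * (1/2) ^ Suc n, of_int (2 * j) * (1/2) ^ Suc n) \<or>
      q = (of_int (2 * i) * (1/2) ^ Suc n, of_int (2 * j + 1) * (1/2) ^ Suc n)"
    using q by (auto simp: ij algebra_simps)
  then show ?case by blast
qed

lemma closed_cell: "closed (cell n q)"
  unfolding cell_def by (intro closed_Collect_conj closed_Collect_le continuous_intros)

lemma open_cell_int: "open (cell_int n q)"
  unfolding cell_int_def by (intro open_Collect_conj open_Collect_less continuous_intros)

lemma open_hole: "open (hole n q)"
  unfolding hole_def by (intro open_Collect_conj open_Collect_less continuous_intros)

lemma closed_hole_cl: "closed (hole_cl n q)"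
  unfolding hole_cl_def by (intro closed_Collect_conj closed_Collect_le continuous_intros)

lemma open_holes: "open (holes n m)"
  unfolding holes_def using open_hole by blast

lemma closed_settled: "closed (settled n)"
  unfolding settled_def using open_cell_int by (auto simp: closed_def)

lemma cell_int_subset_cell: "cell_int n q \<subseteq> cell n q"
  by (auto simp: cell_int_def cell_def)

lemma hole_subset_hole_cl: "hole n q \<subseteq> hole_cl n q"
  by (auto simp: hole_def hole_cl_def)

lemma hole_subset_cell_int: "hole n q \<subseteq> cell_int n q"
  by (auto simp: hole_def cell_int_def)

lemma hole_cl_subset_cell: "hole_cl n q \<subseteq> cell n q"
  by (auto simp: hole_cl_def cell_def)

lemma cell_nonempty: "vector [fst q, snd q] \<in> cell n q"
  by (simp add: cell_def)

text \<open>In units of \<open>(1/2) ^ n\<close> the corners have integer coordinates. The three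
  sides give the integer inequalities \<open>i \<le> i'\<close>, \<open>j \<le> j'\<close> and
  \<open>i' + j' \<le> i + j\<close>, which force equality.\<close>

lemma cell_disjoint_cell_int:
  assumes "q \<in> cells n" "q' \<in> cells n" "z \<in> cell n q" "z \<in> cell_int n q'"
  shows "q = q'"
proof -
  define s :: real where "s = (1/2) ^ n"
  have s: "s > 0" by (simp add: s_def)
  obtain i j i' j' :: int where ij: "q = (of_int i * s, of_int j * s)" "q' = (of_int i' * s, of_int j' * s)"
    using cells_dyadic assms(1,2) unfolding s_def by meson
  have z: "of_int i * s \<le> z $ 1" "of_int j * s \<le> z $ 2" "z $ 1 + z $ 2 \<le> (of_int i + of_int j + 1) * s"
    "of_int i' * s < z $ 1" "of_int j' * s < z $ 2" "z $ 1 + z $ 2 < (of_int i' + of_int j' + 1) * s"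
    using assms(3,4) by (auto simp: cell_def cell_int_def ij s_def[symmetric] algebra_simps)
  have "of_int i * s < (of_int i' + 1) * s" "of_int j * s < (of_int j' + 1) * s"
    "(of_int i' + of_int j') * s < (of_int i + of_int j + 1) * s"
    using z by (simp_all add: algebra_simps)
  then have "(of_int i :: real) < of_int i' + 1" "(of_int j :: real) < of_int j' + 1"
    "(of_int i' + of_int j' :: real) < of_int i + of_int j + 1"
    using s by (simp_all only: mult_less_cancel_right_pos)
  then have "i < i' + 1" "j < j' + 1" "i' + j' < i + j + 1" by linarith+
  then have "i = i'" "j = j'" by auto
  then show ?thesis by (simp add: ij)
qed

lemma cells_parent:
  assumes "q \<in> cells (Suc n)"
  obtains p where "p \<in> cells n" "cell (Suc n) q \<subseteq> cell n p" "cell_int (Suc n) q \<subseteq> cell_int n p"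
    "hole_cl n p \<inter> cell_int (Suc n) q = {}"
proof -
  obtain p where p: "p \<in> cells n"
    and q: "q = p \<or> q = (fst p + (1/2) ^ Suc n, snd p) \<or> q = (fst p, snd p + (1/2) ^ Suc n)"
    using assms by auto
  have s: "(1/2::real) ^ n > 0" by simp
  show ?thesis
  proof (rule that[OF p])
    show "cell (Suc n) q \<subseteq> cell n p" using q s by (auto simp: cell_def)
    show "cell_int (Suc n) q \<subseteq> cell_int n p" using q s by (auto simp: cell_int_def)
    show "hole_cl n p \<inter> cell_int (Suc n) q = {}" using q by (auto simp: cell_int_def hole_cl_def)
  qed
qed

lemma cells_ancestor:
  assumes "n \<le> m" "q \<in> cells m"
  obtains p where "p \<in> cells n" "cell m q \<subseteq> cell n p" "cell_int m q \<subseteq> cell_int n p"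
proof -
  have "\<exists>p\<in>cells n. cell m q \<subseteq> cell n p \<and> cell_int m q \<subseteq> cell_int n p"
    using assms
  proof (induction arbitrary: q rule: dec_induct)
    case base
    then show ?case by blast
  next
    case (step m)
    from cells_parent[OF step.prems] obtain p where
      "p \<in> cells m" "cell (Suc m) q \<subseteq> cell m p" "cell_int (Suc m) q \<subseteq> cell_int m p" .
    with step.IH[of p] show ?case by blast
  qed
  then show ?thesis using that by blast
qed

lemma settled_mono:
  assumes "n \<le> m"
  shows "settled n \<subseteq> settled m"
proof -
  have "cell_int m q \<subseteq> (\<Union>p\<in>cells n. cell_int n p)" if "q \<in> cells m" for q
  proof -
    from cells_ancestor[OF assms that] obtain p where "p \<in> cells n" "cell_int m q \<subseteq> cell_int n p" .
    then show ?thesis by blast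
  qed
  then show ?thesis unfolding settled_def by blast
qed

text \<open>The corner cells of the surrounding cell avoid its hole, and cells with another parent
  are excluded by disjointness; later levels follow by monotonicity.\<close>

lemma hole_cl_subset_settled:
  assumes "q \<in> cells n" "n < m"
  shows "hole_cl n q \<subseteq> settled m"
proof -
  have "hole_cl n q \<subseteq> settled (Suc n)"
  proof
    fix z assume z: "z \<in> hole_cl n q"
    have False if r: "r \<in> cells (Suc n)" "z \<in> cell_int (Suc n) r" for r
    proof -
      from cells_parent[OF r(1)] obtain p where p: "p \<in> cells n" "cell_int (Suc n) r \<subseteq> cell_int n p"
        "hole_cl n p \<inter> cell_int (Suc n) r = {}" by metis
      have "q = p"
        using cell_disjoint_cell_int[OF assms(1) p(1)] z hole_cl_subset_cell p(2) r(2) by blast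
      then show False using z p(3) r(2) by blast
    qed
    then show "z \<in> settled (Suc n)" by (auto simp: settled_def)
  qed
  then show ?thesis using settled_mono[of "Suc n" m] assms by auto
qed

lemma holes_subset_settled: "holes n m \<subseteq> settled m"
  unfolding holes_def using hole_cl_subset_settled hole_subset_hole_cl by fastforce

text \<open>A closed hole leaves the open cell around it at its three vertices only. This finiteness
  is the property of the gasket on which the use of zero capacity rests.\<close>

lemma finite_hole_cl_settled:
  assumes "q \<in> cells n" "m \<le> n"
  shows "finite (hole_cl n q \<inter> settled m)"
proof (rule finite_subset)
  define s :: real where "s = (1/2) ^ Suc n"
  show "hole_cl n q \<inter> settled m \<subseteq>
      {vector [fst q, snd q + s], vector [fst q + s, snd q], vector [fst q + s, snd q + s]}"
  proof
    fix z assume "z \<in> hole_cl n q \<inter> settled m"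
    then have z: "z \<in> hole_cl n q" "z \<notin> cell_int n q"
      using settled_mono[OF assms(2)] assms(1) by (auto simp: settled_def)
    have s2: "(1/2) ^ n = 2 * s" by (simp add: s_def)
    show "z \<in> {vector [fst q, snd q + s], vector [fst q + s, snd q], vector [fst q + s, snd q + s]}"
      using z unfolding hole_cl_def cell_int_def mem_Collect_eq s_def[symmetric] s2 insert_iff
      by (auto simp: vec_eq_iff forall_2)
  qed
qed auto

text \<open>A point of the open cell outside the closed hole satisfies one of the three reversed
  strict inequalities, and each of them selects a corner cell.\<close>

lemma cell_int_refine:
  assumes "q \<in> cells n" "z \<in> cell_int n q"
  shows "z \<in> hole_cl n q \<or> (\<exists>r\<in>cells (Suc n). z \<in> cell_int (Suc n) r)"
proof -
  define s :: real where "s = (1/2) ^ Suc n"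
  have s2: "(1/2) ^ n = 2 * s" by (simp add: s_def)
  have c: "q \<in> cells (Suc n)" "(fst q + s, snd q) \<in> cells (Suc n)" "(fst q, snd q + s) \<in> cells (Suc n)"
    using assms(1) by (auto simp: s_def)
  have "z \<in> hole_cl n q \<or> z \<in> cell_int (Suc n) q \<or> z \<in> cell_int (Suc n) (fst q + s, snd q)
      \<or> z \<in> cell_int (Suc n) (fst q, snd q + s)"
    using assms(2) unfolding hole_cl_def cell_int_def mem_Collect_eq s_def[symmetric] s2 by auto
  then show ?thesis using c by blast
qed

lemma settled_refine:
  assumes "n \<le> m" "z \<in> settled m"
  shows "z \<in> settled n \<or> (\<exists>j\<in>{n..<m}. \<exists>q\<in>cells j. z \<in> hole_cl j q)"
  using assms
proof (induction rule: dec_induct)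
  case (step m)
  show ?case
  proof (cases "z \<in> settled m")
    case True
    then show ?thesis using step.IH by fastforce
  next
    case False
    then obtain q where q: "q \<in> cells m" "z \<in> cell_int m q" by (auto simp: settled_def)
    have "\<not> (\<exists>r\<in>cells (Suc m). z \<in> cell_int (Suc m) r)" using step.prems by (auto simp: settled_def)
    then have "z \<in> hole_cl m q" using cell_int_refine[OF q] by blast
    then show ?thesis using q step.hyps by fastforce
  qed
qed auto

lemma cell_dist_le:
  assumes "z \<in> cell n q" "z' \<in> cell n q"
  shows "dist z z' \<le> 2 * (1/2) ^ n"
proof -
  have "\<bar>(z - z') $ 1\<bar> \<le> (1/2) ^ n" "\<bar>(z - z') $ 2\<bar> \<le> (1/2) ^ n"
    using assms by (auto simp: cell_def)
  then have "norm (z - z') \<le> (1/2) ^ n + (1/2) ^ n"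
    using norm_le_l1_cart[of "z - z'"] by (simp add: sum_2)
  then show ?thesis by (simp add: dist_norm)
qed

lemma cell_subset_unit: "q \<in> cells n \<Longrightarrow> cell n q \<subseteq> cell 0 (0, 0)"
  using cells_ancestor[of 0 n q] by auto

lemma compact_cell: "compact (cell n q)"
proof -
  have "bounded (cell n q)"
    unfolding bounded_def using cell_dist_le cell_nonempty by blast
  then show ?thesis using closed_cell compact_eq_bounded_closed by blast
qed

lemma small_oscillation_level:
  fixes u :: "real^2 \<Rightarrow> real"
  assumes "continuous_on UNIV u" "e > 0"
  obtains m where "n < m" "\<And>q z z'. q \<in> cells m \<Longrightarrow> z \<in> cell m q \<Longrightarrow> z' \<in> cell m q \<Longrightarrow> \<bar>u z - u z'\<bar> \<le> e"
proof -
  have "uniformly_continuous_on (cell 0 (0, 0)) u"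
    using compact_uniformly_continuous continuous_on_subset[OF assms(1)] compact_cell by blast
  then obtain d where d: "d > 0"
    "\<And>z z'. z \<in> cell 0 (0, 0) \<Longrightarrow> z' \<in> cell 0 (0, 0) \<Longrightarrow> dist z' z < d \<Longrightarrow> dist (u z') (u z) < e"
    unfolding uniformly_continuous_on_def using assms(2) by blast
  obtain k where k: "(1/2) ^ k < d / 2" using real_arch_pow_inv[of "d / 2" "1/2"] d by auto
  define m where "m = max k (Suc n)"
  have "(1/2::real) ^ m \<le> (1/2) ^ k" by (intro power_decreasing) (auto simp: m_def)
  then have m: "2 * (1/2) ^ m < d" using k by linarith
  show ?thesis
  proof (rule that[of m])
    show "n < m" by (simp add: m_def)
    fix q z z' assume q: "q \<in> cells m" and z: "z \<in> cell m q" "z' \<in> cell m q"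
    have "dist z z' < d" using cell_dist_le[OF z] m by linarith
    then have "dist (u z) (u z') < e" using d(2) cell_subset_unit[OF q] z by blast
    then show "\<bar>u z - u z'\<bar> \<le> e" by (simp add: dist_real_def)
  qed
qed

text \<open>Two pieces overlap only inside \<open>A\<close>, so off \<open>A\<close> the definite
  description finds the unique piece, and on \<open>A\<close> every piece agrees with
  \<open>u\<close>. The staircase pastes twice in this way, over the cells of level \<open>n\<close>
  and then over those of level \<open>m\<close>.\<close>

lemma pasting_pieces:
  fixes u :: "'a::topological_space \<Rightarrow> 'b::topological_space"
  assumes A: "closed A" "continuous_on A u" and Q: "finite Q"
    and C: "\<And>q. q \<in> Q \<Longrightarrow> closed (C q)" "\<And>q. q \<in> Q \<Longrightarrow> continuous_on (C q) (V q)"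
    and agree: "\<And>q x. q \<in> Q \<Longrightarrow> x \<in> A \<Longrightarrow> x \<in> C q \<Longrightarrow> V q x = u x"
    and meet: "\<And>q q' x. q \<in> Q \<Longrightarrow> q' \<in> Q \<Longrightarrow> q \<noteq> q' \<Longrightarrow> x \<in> C q \<Longrightarrow> x \<in> C q' \<Longrightarrow> x \<in> A"
  obtains g where "continuous_on (A \<union> (\<Union>q\<in>Q. C q)) g" "\<And>x. x \<in> A \<Longrightarrow> g x = u x"
    "\<And>q x. q \<in> Q \<Longrightarrow> x \<in> C q \<Longrightarrow> g x = V q x"
proof -
  define g where "g x = (if x \<in> A then u x else V (THE q. q \<in> Q \<and> x \<in> C q) x)" for x
  have gA: "g x = u x" if "x \<in> A" for x using that by (simp add: g_def)
  have gC: "g x = V q x" if "q \<in> Q" "x \<in> C q" for q x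
  proof (cases "x \<in> A")
    case False
    then have "(THE q. q \<in> Q \<and> x \<in> C q) = q" using that meet by (intro the_equality) auto
    then show ?thesis using False by (simp add: g_def)
  qed (use that agree gA in simp)
  have "continuous_on A g" by (rule continuous_on_eq[OF A(2)]) (simp add: gA)
  moreover have "continuous_on (\<Union>q\<in>Q. C q) g"
    by (rule continuous_on_closed_Union[OF Q C(1) continuous_on_eq[OF C(2)]]) (simp_all add: gC)
  ultimately have "continuous_on (A \<union> (\<Union>q\<in>Q. C q)) g"
    using A(1) C(1) Q by (intro continuous_on_closed_Un closed_UN) auto
  then show ?thesis using gA gC that by blast
qed

text \<open>The midpoint of infimum and supremum; the factor 1/2 gained by each staircase step
  originates here.\<close>

lemma half_oscillation_centre:
  fixes S :: "real set"
  assumes "S \<noteq> {}" "\<And>a b. a \<in> S \<Longrightarrow> b \<in> S \<Longrightarrow> \<bar>a - b\<bar> \<le> \<omega>"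
  obtains c where "\<And>a. a \<in> S \<Longrightarrow> \<bar>a - c\<bar> \<le> \<omega> / 2"
proof -
  obtain s where s: "s \<in> S" using assms by blast
  have bd: "a \<le> s + \<omega> \<and> s - \<omega> \<le> a" if "a \<in> S" for a using assms(2)[OF that s] by linarith
  have bb: "bdd_below S" "bdd_above S"
    using bd by (auto intro!: bdd_belowI[of _ "s - \<omega>"] bdd_aboveI[of _ "s + \<omega>"])
  have "a - \<omega> \<le> Inf S" if "a \<in> S" for a
  proof (rule cInf_greatest[OF assms(1)])
    fix b assume "b \<in> S"
    then show "a - \<omega> \<le> b" using assms(2)[OF that, of b] by (simp add: abs_le_iff)
  qed
  then have "Sup S \<le> Inf S + \<omega>" by (intro cSup_least[OF assms(1)]) (simp add: algebra_simps)
  then have "\<bar>a - (Inf S + Sup S) / 2\<bar> \<le> \<omega> / 2" if "a \<in> S" for a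
    using cInf_lower[OF that bb(1)] cSup_upper[OF that bb(2)] by (auto simp: abs_le_iff field_simps)
  then show ?thesis using that by blast
qed

text \<open>Finitely many positive distances have a positive lower bound. It supplies the radius of
  the cutoffs.\<close>

lemma uniform_separation:
  fixes F :: "('a::euclidean_space \<times> 'a set) set"
  assumes "finite F" "\<And>a S. (a, S) \<in> F \<Longrightarrow> closed S \<and> a \<notin> S"
  obtains \<rho> where "\<rho> > 0" "\<And>a S z. (a, S) \<in> F \<Longrightarrow> z \<in> S \<Longrightarrow> \<rho> \<le> dist a z"
proof -
  have "\<exists>\<rho>>0. \<forall>(a, S)\<in>F. \<forall>z\<in>S. \<rho> \<le> dist a z"
    using assms
  proof (induction rule: finite_induct)
    case empty
    then show ?case by (auto intro: exI[of _ 1])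
  next
    case (insert x F)
    obtain a S where x: "x = (a, S)" by (cases x)
    obtain \<rho> where \<rho>: "\<rho> > 0" "\<forall>(a, S)\<in>F. \<forall>z\<in>S. \<rho> \<le> dist a z" using insert by blast
    have "closed S \<and> a \<notin> S" using insert.prems x by blast
    then obtain d where "d > 0" "\<forall>z\<in>S. d \<le> dist a z"
      using separate_point_closed[of S a] by auto
    then show ?case using \<rho> by (intro exI[of _ "min \<rho> d"]) (auto simp: x min_le_iff_disj)
  qed
  then show ?thesis using that by blast
qed

subsection \<open>The staircase construction\<close>

text \<open>
  All holes between the levels \<open>n\<close> and \<open>m\<close> inside a given cell of level \<open>n\<close> get the same plateau value,
  the middle of the range of \<open>u\<close>; it is adapted to \<open>u\<close> only near the finitely many points where
  a hole touches the settled part. With \<open>m\<close> so large that \<open>u\<close> is almost constant on the cells of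
  level \<open>m\<close>, the values on each of these are spread between \<open>u\<close> and the plateau, which halves the
  oscillation.
\<close>

lemma staircase_step:
  fixes h g :: "real^2 \<Rightarrow> real^2" and u :: "real^2 \<Rightarrow> real"
  assumes hom: "homeomorphism UNIV UNIV h g" and uc: "continuous_on UNIV u" and \<omega>: "\<omega> \<ge> 0"
    and osc: "\<And>q z z'. q \<in> cells n \<Longrightarrow> z \<in> cell n q \<Longrightarrow> z' \<in> cell n q \<Longrightarrow> \<bar>u z - u z'\<bar> \<le> \<omega>"
    and e: "e > 0"
  obtains m v where "n < m" "continuous_on UNIV v"
    "\<And>q z z'. q \<in> cells m \<Longrightarrow> z \<in> cell m q \<Longrightarrow> z' \<in> cell m q \<Longrightarrow> \<bar>v z - v z'\<bar> \<le> \<omega> / 2 + 2 * e"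
    "\<And>z. z \<in> settled n \<Longrightarrow> v z = u z" "\<And>z. \<bar>v z - u z\<bar> \<le> \<omega> + 2 * e"
    "C1_on (h ` holes n m) (v \<circ> g)" "energy (h ` holes n m) (v \<circ> g) \<le> ennreal e"
proof -
  note hg = homeomorphism_UNIV_D[OF hom]
  obtain m where nm: "n < m"
    and small: "\<And>q z z'. q \<in> cells m \<Longrightarrow> z \<in> cell m q \<Longrightarrow> z' \<in> cell m q \<Longrightarrow> \<bar>u z - u z'\<bar> \<le> e"
    using small_oscillation_level[OF uc e, of n] by metis
  have "\<exists>c. \<forall>z\<in>cell n q. \<bar>u z - c\<bar> \<le> \<omega> / 2" if q: "q \<in> cells n" for q
  proof -
    have "u ` cell n q \<noteq> {}" using cell_nonempty by blast
    then obtain c where "\<And>a. a \<in> u ` cell n q \<Longrightarrow> \<bar>a - c\<bar> \<le> \<omega> / 2"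
      using half_oscillation_centre[of "u ` cell n q" \<omega>] osc[OF q] by (metis imageE)
    then show ?thesis by blast
  qed
  then obtain c where c: "\<And>q z. q \<in> cells n \<Longrightarrow> z \<in> cell n q \<Longrightarrow> \<bar>u z - c q\<bar> \<le> \<omega> / 2" by metis
  define D where "D = (\<Union>j\<in>{n..<m}. \<Union>q\<in>cells j. hole_cl j q)"
  have Dclosed: "closed D"
    unfolding D_def using finite_cells closed_hole_cl by (intro closed_UN) auto
  have Dcell: "D \<subseteq> (\<Union>q\<in>cells n. cell n q)"
  proof
    fix z assume "z \<in> D"
    then obtain j q where j: "n \<le> j" "q \<in> cells j" "z \<in> hole_cl j q" by (auto simp: D_def)
    obtain p where "p \<in> cells n" "cell j q \<subseteq> cell n p" using cells_ancestor[OF j(1,2)] by metis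
    then show "z \<in> (\<Union>q\<in>cells n. cell n q)" using j(3) hole_cl_subset_cell by blast
  qed
  \<comment> \<open>The touching points: only here does the plateau meet prescribed values of
    \<open>u\<close>.\<close>
  define M where "M = D \<inter> settled n"
  have Mfin: "finite M"
  proof -
    have "M = (\<Union>j\<in>{n..<m}. \<Union>q\<in>cells j. hole_cl j q \<inter> settled n)" by (auto simp: M_def D_def)
    moreover have "finite \<dots>" using finite_cells finite_hole_cl_settled by (intro finite_UN_I) auto
    ultimately show ?thesis by simp
  qed
  \<comment> \<open>The sets that a cutoff has to respect: it may act only in cells that contain its
    centre, at both levels, and must vanish at the other centres.\<close>
  define S where "S = cell n ` cells n \<union> cell m ` cells m \<union> (\<lambda>a. {a}) ` M"
  have Sfin: "finite S" using finite_cells Mfin by (simp add: S_def)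
  have Sclosed: "closed C" if "C \<in> S" for C using that closed_cell by (auto simp: S_def)
  \<comment> \<open>The separation is measured in the image plane, because the cutoffs are radial
    there.\<close>
  define F where "F = {(h a, h ` C) | a C. a \<in> M \<and> C \<in> S \<and> a \<notin> C}"
  have Ffin: "finite F"
    by (rule finite_subset[of _ "(\<lambda>(a, C). (h a, h ` C)) ` (M \<times> S)"]) (use Mfin Sfin in \<open>auto simp: F_def\<close>)
  have "closed C' \<and> a' \<notin> C'" if aC: "(a', C') \<in> F" for a' C'
  proof -
    obtain a C where a: "a' = h a" "C' = h ` C" "C \<in> S" "a \<notin> C" using aC by (auto simp: F_def)
    have "closed C'" using a Sclosed homeomorphism_UNIV_closed_image[OF hom] by simp
    moreover have "a' \<notin> C'" using a hg(1) by (metis imageE)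
    ultimately show ?thesis by simp
  qed
  then obtain \<rho> where \<rho>: "\<rho> > 0" "\<And>a' C' z. (a', C') \<in> F \<Longrightarrow> z \<in> C' \<Longrightarrow> \<rho> \<le> dist a' z"
    using uniform_separation[OF Ffin] by metis
  have sep: "\<rho> \<le> norm (h z - h a)" if "a \<in> M" "C \<in> S" "a \<notin> C" "z \<in> C" for a C z
    using \<rho>(2)[of "h a" "h ` C" "h z"] that by (auto simp: F_def dist_norm norm_minus_commute)
  \<comment> \<open>A crude bound on all jumps is enough, since the energy of the cutoff is chosen
    after it.\<close>
  define K where "K = (\<Sum>q\<in>cells n. \<Sum>a\<in>M. \<bar>u a - c q\<bar>)"
  have K: "\<bar>u a - c q\<bar> \<le> K" if "a \<in> M" "q \<in> cells n" for a q
  proof -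
    have "\<bar>u a - c q\<bar> \<le> (\<Sum>a\<in>M. \<bar>u a - c q\<bar>)" using that Mfin by (intro member_le_sum) auto
    also have "\<dots> \<le> K" unfolding K_def
      using that finite_cells by (intro member_le_sum[of q _ "\<lambda>q. \<Sum>a\<in>M. \<bar>u a - c q\<bar>"]) (auto intro: sum_nonneg)
    finally show ?thesis .
  qed
  have K0: "K \<ge> 0" unfolding K_def by (intro sum_nonneg) auto
  define L where "L = real (card (cells n)) * ((real (card M))\<^sup>2 * K\<^sup>2)"
  have L0: "L \<ge> 0" by (simp add: L_def)
  \<comment> \<open>The radius \<open>\<rho> / 2\<close> makes the supports around different centres
    disjoint. The energy compensates the total factor \<open>L\<close>; adding 1 avoids a division
    by zero.\<close>
  obtain k :: "real^2 \<Rightarrow> real" where k: "continuous_on UNIV k" "k 0 = 1" "\<And>z. 0 \<le> k z \<and> k z \<le> 1"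
    "\<And>z. \<rho> / 2 \<le> norm z \<Longrightarrow> k z = 0" "C1_on (-{0}) k" "energy (-{0}) k \<le> ennreal (e / (L + 1))"
    using point_cutoff_exists[of "\<rho> / 2" "e / (L + 1)"] \<rho>(1) e L0 by (metis add_pos_nonneg add.commute divide_pos_pos half_gt_zero zero_less_one)
  \<comment> \<open>\<open>W q\<close> lives in the image plane and is continuously differentiable
    off the images of the touching points, however irregular \<open>h\<close> is; \<open>V q\<close>
    is its pullback to the coordinates of the gasket.\<close>
  define W where "W q w = c q + (\<Sum>a\<in>M. (u a - c q) * k (w - h a))" for q w
  define V where "V q z = W q (h z)" for q z
  have Vform: "V q z = c q \<or> (\<exists>a\<in>M. V q z = c q + (u a - c q) * k (h z - h a) \<and> norm (h z - h a) < \<rho>)" for q z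
  proof (cases "\<exists>a\<in>M. norm (h z - h a) < \<rho> / 2")
    case True
    then obtain a where a: "a \<in> M" "norm (h z - h a) < \<rho> / 2" by blast
    have "k (h z - h a') = 0" if a': "a' \<in> M - {a}" for a'
    proof (rule k(4))
      have "\<rho> \<le> norm (h a - h a')" using sep[of a' "{a}" a] a' a(1) by (auto simp: S_def)
      also have "\<dots> \<le> norm (h z - h a) + norm (h z - h a')"
        using norm_triangle_ineq4[of "h z - h a'" "h z - h a"] by simp
      finally show "\<rho> / 2 \<le> norm (h z - h a')" using a(2) by linarith
    qed
    then have "(\<Sum>a\<in>M. (u a - c q) * k (h z - h a)) = (u a - c q) * k (h z - h a)"
      using a(1) Mfin by (subst sum.remove[of _ a]) auto
    then show ?thesis using a \<rho>(1) by (intro disjI2 bexI[of _ a]) (auto simp: V_def W_def)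
  next
    case False
    then have "(\<Sum>a\<in>M. (u a - c q) * k (h z - h a)) = 0" by (intro sum.neutral) (auto simp: k(4))
    then show ?thesis by (simp add: V_def W_def)
  qed
  \<comment> \<open>Each value interpolates between the plateau and \<open>u a\<close>, where the
    touching point \<open>a\<close> shares all cells of both levels with \<open>z\<close>. Hence it
    can be compared with \<open>u\<close> on these cells.\<close>
  have Vform': "V q z = c q \<or> (\<exists>a\<in>M. \<exists>t. 0 \<le> t \<and> t \<le> 1 \<and> V q z = c q + (u a - c q) * t \<and> (\<forall>C\<in>S. z \<in> C \<longrightarrow> a \<in> C))" for q z
    using Vform[of q z] k(3) sep by (metis not_less)
  have VM: "V q a = u a" if "a \<in> M" for q a
  proof -
    have "k (h a - h a') = 0" if a': "a' \<in> M - {a}" for a'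
    proof (rule k(4))
      show "\<rho> / 2 \<le> norm (h a - h a')" using sep[of a' "{a}" a] a' \<open>a \<in> M\<close> \<rho>(1) by (auto simp: S_def)
    qed
    then have "(\<Sum>a'\<in>M. (u a' - c q) * k (h a - h a')) = (u a - c q) * k (h a - h a)"
      using that Mfin by (subst sum.remove[of _ a]) auto
    then show ?thesis by (simp add: V_def W_def k(2))
  qed
  have Wc: "continuous_on UNIV (W q)" for q
    unfolding W_def[abs_def]
    by (intro continuous_on_add continuous_on_sum continuous_on_mult continuous_on_const
        continuous_on_compose2[OF k(1)] continuous_on_diff continuous_on_id) auto
  have Vc: "continuous_on A (V q)" for A q
    unfolding V_def[abs_def] using continuous_on_compose2[OF Wc continuous_on_subset[OF hg(3)]] by auto
  have settled2: "z \<in> settled k" if "q \<in> cells k" "q' \<in> cells k" "q \<noteq> q'" "z \<in> cell k q" "z \<in> cell k q'" for k z q q'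
    using that cell_disjoint_cell_int unfolding settled_def by (metis ComplI UN_E)
  \<comment> \<open>On \<open>A\<close> the new function is prescribed; the remaining parts of the
    cells of level \<open>m\<close> are filled by Tietze extension.\<close>
  define A where "A = settled n \<union> D"
  obtain g1 where g1: "continuous_on (settled n \<union> (\<Union>q\<in>cells n. D \<inter> cell n q)) g1"
    and g1u: "\<And>z. z \<in> settled n \<Longrightarrow> g1 z = u z"
    and g1V: "\<And>q z. q \<in> cells n \<Longrightarrow> z \<in> D \<inter> cell n q \<Longrightarrow> g1 z = V q z"
  proof (rule pasting_pieces[of "settled n" u "cells n" "\<lambda>q. D \<inter> cell n q" V])
    show "continuous_on (settled n) u" using continuous_on_subset[OF uc] by simp
    show "V q x = u x" if "x \<in> settled n" "x \<in> D \<inter> cell n q" for q x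
      using that VM by (simp add: M_def)
    show "x \<in> settled n" if "q \<in> cells n" "q' \<in> cells n" "q \<noteq> q'" "x \<in> D \<inter> cell n q" "x \<in> D \<inter> cell n q'" for q q' x
      using settled2[OF that(1-3)] that(4,5) by blast
  qed (use closed_settled Dclosed closed_cell finite_cells Vc in auto)
  have "(\<Union>q\<in>cells n. D \<inter> cell n q) = D" using Dcell by blast
  then have g1c: "continuous_on A g1" using g1 by (simp add: A_def)
  have Aclosed: "closed A" unfolding A_def by (intro closed_Un closed_settled Dclosed)
  have settled_A: "settled m \<subseteq> A"
  proof
    fix z assume "z \<in> settled m"
    with settled_refine[OF less_imp_le[OF nm] this] show "z \<in> A" by (auto simp: A_def D_def)
  qed
  have fill: "\<exists>w. continuous_on UNIV w \<and> (\<forall>z\<in>A \<inter> cell m r. w z = g1 z) \<and>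
      (\<forall>z z'. \<bar>w z - w z'\<bar> \<le> \<omega> / 2 + 2 * e) \<and> (\<forall>z\<in>cell m r. \<bar>w z - u z\<bar> \<le> \<omega> + 2 * e)"
    if r: "r \<in> cells m" for r
  proof -
    obtain q where q: "q \<in> cells n" "cell m r \<subseteq> cell n q"
      using cells_ancestor[OF less_imp_le[OF nm] r] by metis
    obtain z0 where z0: "z0 \<in> cell m r" using cell_nonempty by blast
    \<comment> \<open>This interval contains the plateau value and all values of \<open>u\<close> on
      the small cell, where \<open>u\<close> varies by at most \<open>e\<close>. As
      \<open>c q\<close> is within \<open>\<omega> / 2\<close> of \<open>u z0\<close>, its length is
      at most \<open>\<omega> / 2 + 2 * e\<close>, and Tietze extension keeps the new values inside
      it.\<close>
    define lo hi where "lo = min (c q) (u z0) - e" and "hi = max (c q) (u z0) + e"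
    have cz: "\<bar>u z0 - c q\<bar> \<le> \<omega> / 2" using c[OF q(1)] z0 q(2) by blast
    have lohi: "lo \<le> hi" "hi - lo \<le> \<omega> / 2 + 2 * e" using cz e by (auto simp: lo_def hi_def min_def max_def abs_if split: if_splits)
    have us: "u z \<in> {lo..hi}" if "z \<in> cell m r" for z
      using small[OF r that z0] by (auto simp: lo_def hi_def)
    have ran: "g1 z \<in> {lo..hi}" if z: "z \<in> A \<inter> cell m r" for z
    proof (cases "z \<in> settled n")
      case True
      then show ?thesis using us z by (simp add: g1u)
    next
      case False
      then have zD: "z \<in> D" "z \<in> cell n q" using z q(2) by (auto simp: A_def)
      then have g: "g1 z = V q z" using g1V[OF q(1)] by blast
      have cS: "cell m r \<in> S" using r by (simp add: S_def)
      show ?thesis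
      proof (cases "V q z = c q")
        case True
        then show ?thesis using g e by (auto simp: lo_def hi_def)
      next
        case False
        then obtain a t where a: "a \<in> M" "0 \<le> t" "t \<le> 1" "V q z = c q + (u a - c q) * t" "a \<in> cell m r"
          using Vform'[of q z] cS z by blast
        have "u a \<in> {lo..hi}" using us a by blast
        moreover have "c q \<in> {lo..hi}" using e by (auto simp: lo_def hi_def)
        moreover have "V q z = (1 - t) *\<^sub>R c q + t *\<^sub>R u a" using a(4) by (simp add: algebra_simps)
        ultimately show ?thesis
          using g convexD_alt[OF convex_real_interval(5)[of lo hi], of "c q" "u a" t] a by simp
      qed
    qed
    obtain w where w: "continuous_on UNIV w" "\<And>z. z \<in> A \<inter> cell m r \<Longrightarrow> w z = g1 z" "\<And>z. w z \<in> cbox lo hi"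
    proof (rule Tietze_closed_interval_1[of "A \<inter> cell m r" g1 UNIV lo hi])
      show "continuous_on (A \<inter> cell m r) g1" using g1c continuous_on_subset by blast
      show "closedin (top_of_set UNIV) (A \<inter> cell m r)" using Aclosed closed_cell[of m r] by auto
    qed (use ran lohi in auto)
    have "\<bar>w z - w z'\<bar> \<le> \<omega> / 2 + 2 * e" for z z' using w(3)[of z] w(3)[of z'] lohi by auto
    moreover have "\<bar>w z - u z\<bar> \<le> \<omega> + 2 * e" if "z \<in> cell m r" for z
      using w(3)[of z] us[OF that] lohi \<omega> by auto
    ultimately show ?thesis using w by blast
  qed
  then obtain w where w: "\<And>r. r \<in> cells m \<Longrightarrow> continuous_on UNIV (w r)"
    "\<And>r z. r \<in> cells m \<Longrightarrow> z \<in> A \<inter> cell m r \<Longrightarrow> w r z = g1 z"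
    "\<And>r z z'. r \<in> cells m \<Longrightarrow> \<bar>w r z - w r z'\<bar> \<le> \<omega> / 2 + 2 * e"
    "\<And>r z. r \<in> cells m \<Longrightarrow> z \<in> cell m r \<Longrightarrow> \<bar>w r z - u z\<bar> \<le> \<omega> + 2 * e" by metis
  obtain v where v: "continuous_on (A \<union> (\<Union>r\<in>cells m. cell m r)) v"
    and vA: "\<And>z. z \<in> A \<Longrightarrow> v z = g1 z" and vw: "\<And>r z. r \<in> cells m \<Longrightarrow> z \<in> cell m r \<Longrightarrow> v z = w r z"
  proof (rule pasting_pieces[OF Aclosed g1c finite_cells[of m], of "cell m" w])
    show "continuous_on (cell m r) (w r)" if "r \<in> cells m" for r
      using continuous_on_subset[OF w(1)[OF that]] by simp
    show "x \<in> A" if "q \<in> cells m" "q' \<in> cells m" "q \<noteq> q'" "x \<in> cell m q" "x \<in> cell m q'" for q q' x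
      using settled2[OF that] settled_A by blast
  qed (use closed_cell w(2) in auto)
  have "A \<union> (\<Union>r\<in>cells m. cell m r) = UNIV"
    using settled_A cell_int_subset_cell unfolding settled_def by blast
  then have vc: "continuous_on UNIV v" using v by simp
  have vu: "v z = u z" if "z \<in> settled n" for z using that by (simp add: vA g1u A_def)
  have vV: "v z = V q z" if "z \<in> D" "q \<in> cells n" "z \<in> cell n q" for z q
    using that g1V[of q z] by (simp add: vA A_def)
  have close: "\<bar>v z - u z\<bar> \<le> \<omega> + 2 * e" for z
  proof -
    consider "z \<in> settled n" | r where "r \<in> cells m" "z \<in> cell m r" | q where "z \<in> D" "q \<in> cells n" "z \<in> cell n q"
      using settled_A cell_int_subset_cell Dcell unfolding settled_def A_def by blast
    then show ?thesis
    proof cases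
      case 1
      then show ?thesis using vu \<omega> e by simp
    next
      case 2
      then show ?thesis using vw w(4) by simp
    next
      case 3
      have "\<bar>V q z - c q\<bar> \<le> \<omega> / 2"
      proof (cases "V q z = c q")
        case False
        have "cell n q \<in> S" using 3 by (simp add: S_def)
        then obtain a t where a: "0 \<le> t" "t \<le> 1" "V q z = c q + (u a - c q) * t" "a \<in> cell n q"
          using Vform'[of q z] False 3 by blast
        have "\<bar>u a - c q\<bar> * t \<le> \<omega> / 2 * 1" using c[OF 3(2) a(4)] a \<omega> by (intro mult_mono) auto
        then show ?thesis using a by (simp add: abs_mult)
      qed (use \<omega> in simp)
      moreover have "\<bar>u z - c q\<bar> \<le> \<omega> / 2" using c 3 by blast
      ultimately show ?thesis using vV[OF 3] e by linarith
    qed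
  qed
  \<comment> \<open>The plateau depends on the cell of level \<open>n\<close>; on each of these open
    pieces the single formula \<open>W q\<close> is valid.\<close>
  define O' where "O' q = holes n m \<inter> cell_int n q" for q
  have holesD: "holes n m \<subseteq> D"
    unfolding holes_def D_def using hole_subset_hole_cl by blast
  have Ocover: "holes n m = (\<Union>q\<in>cells n. O' q)"
  proof -
    have "z \<in> (\<Union>q\<in>cells n. cell_int n q)" if z: "z \<in> holes n m" for z
    proof -
      obtain j q where j: "n \<le> j" "q \<in> cells j" "z \<in> hole j q"
        using z unfolding holes_def by fastforce
      obtain p where "p \<in> cells n" "cell_int j q \<subseteq> cell_int n p" using cells_ancestor[OF j(1,2)] by metis
      then show ?thesis using j(3) hole_subset_cell_int by blast
    qed
    then show ?thesis by (auto simp: O'_def)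
  qed
  have Oopen: "open (h ` O' q)" for q
    unfolding O'_def by (intro homeomorphism_UNIV_open_image[OF hom] open_Int open_holes open_cell_int)
  have OM: "h ` O' q \<subseteq> - h ` M" if "q \<in> cells n" for q
  proof -
    have "O' q \<inter> M = {}" using that by (auto simp: O'_def M_def settled_def)
    moreover have "inj h" using hg(1) by (metis injI)
    ultimately show ?thesis by (auto dest: injD)
  qed
  have Weq: "W q x = (v \<circ> g) x" if "q \<in> cells n" "x \<in> h ` O' q" for q x
  proof -
    have "g x \<in> O' q" using that(2) hg(1) by auto
    then have "g x \<in> D" "g x \<in> cell n q" using holesD cell_int_subset_cell[of n q] by (auto simp: O'_def)
    then show ?thesis using vV[OF _ that(1)] by (simp add: V_def hg(2))
  qed
  have WC: "C1_on (h ` O' q) (W q)" if "q \<in> cells n" for q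
    unfolding W_def[abs_def] by (rule C1_on_subset[OF C1_on_translated_sum[OF k(5)] OM[OF that]])
  have vC: "C1_on (h ` O' q) (v \<circ> g)" if "q \<in> cells n" for q
    using C1_on_cong[OF Oopen Weq WC] that by blast
  have hO: "h ` holes n m = (\<Union>q\<in>cells n. h ` O' q)" using Ocover by (simp add: image_UN)
  have En: "energy (h ` O' q) (v \<circ> g) \<le> ennreal ((real (card M))\<^sup>2 * K\<^sup>2) * energy (-{0}) k" if q: "q \<in> cells n" for q
  proof -
    have "energy (h ` O' q) (v \<circ> g) = energy (h ` O' q) (W q)"
      by (rule energy_cong[OF Oopen]) (use Weq[OF q] in simp)
    also have "\<dots> \<le> energy (- h ` M) (W q)" by (rule energy_mono[OF OM[OF q]])
    also have "\<dots> \<le> ennreal ((real (card M))\<^sup>2 * K\<^sup>2) * energy (-{0}) k"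
      unfolding W_def[abs_def] by (rule energy_translated_sum_le[OF k(5) Mfin]) (use K[OF _ q] K0 in auto)
    finally show ?thesis .
  qed
  have "energy (h ` holes n m) (v \<circ> g) \<le> (\<Sum>q\<in>cells n. energy (h ` O' q) (v \<circ> g))"
    unfolding hO by (rule energy_UN_le_sum[OF finite_cells Oopen vC])
  also have "\<dots> \<le> (\<Sum>q\<in>cells n. ennreal ((real (card M))\<^sup>2 * K\<^sup>2) * energy (-{0}) k)"
    by (intro sum_mono En)
  also have "\<dots> = ennreal L * energy (-{0}) k"
    by (simp add: L_def ennreal_of_nat_eq_real_of_nat ennreal_mult mult.assoc)
  also have "\<dots> \<le> ennreal L * ennreal (e / (L + 1))" by (intro mult_left_mono k(6)) auto
  also have "\<dots> = ennreal (L * (e / (L + 1)))" using L0 e by (subst ennreal_mult) auto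
  also have "\<dots> \<le> ennreal e" using L0 e by (intro ennreal_leI) (simp add: field_simps)
  finally have E: "energy (h ` holes n m) (v \<circ> g) \<le> ennreal e" .
  have C: "C1_on (h ` holes n m) (v \<circ> g)"
    unfolding hO by (rule C1_on_Union) (use Oopen vC in auto)
  show ?thesis
  proof (rule that[OF nm vc])
    show "\<bar>v z - v z'\<bar> \<le> \<omega> / 2 + 2 * e" if "q \<in> cells m" "z \<in> cell m q" "z' \<in> cell m q" for q z z'
      using w(3) vw that by simp
  qed (use vu close C E in auto)
qed

lemma holes_split:
  assumes "n \<le> k" "k \<le> m"
  shows "holes n m = holes n k \<union> holes k m"
proof -
  have "{n..<m} = {n..<k} \<union> {k..<m}" using assms by auto
  then show ?thesis by (simp add: holes_def UN_Un)
qed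

text \<open>With \<open>e = \<omega> / 8\<close> a step reduces the oscillation from
  \<open>\<omega>\<close> to \<open>3/4 * \<omega>\<close> and moves the function by at most
  \<open>5/4 * \<omega>\<close>, so the steps converge uniformly and their energies are dominated by
  a geometric series. Every hole is settled after finitely many steps; there the limit coincides
  with a finite stage, so no limit of gradients has to be taken.\<close>

lemma staircase_limit:
  fixes h g :: "real^2 \<Rightarrow> real^2" and u :: "real^2 \<Rightarrow> real"
  assumes hom: "homeomorphism UNIV UNIV h g" and uc: "continuous_on UNIV u"
    and osc: "\<And>q z z'. q \<in> cells n \<Longrightarrow> z \<in> cell n q \<Longrightarrow> z' \<in> cell n q \<Longrightarrow> \<bar>u z - u z'\<bar> \<le> 1"
  obtains v where "continuous_on UNIV v" "\<And>z. z \<in> settled n \<Longrightarrow> v z = u z"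
    "C1_on (h ` (\<Union>m. holes n m)) (v \<circ> g)" "energy (h ` (\<Union>m. holes n m)) (v \<circ> g) < \<infinity>"
proof -
  \<comment> \<open>The clause for \<open>k = 0\<close> pins the starting pair, which dependent
    choice would otherwise leave open.\<close>
  define P where "P k x \<longleftrightarrow> continuous_on UNIV (snd x) \<and> (k = 0 \<longrightarrow> x = (n, u)) \<and>
      (\<forall>q\<in>cells (fst x). \<forall>z\<in>cell (fst x) q. \<forall>z'\<in>cell (fst x) q. \<bar>snd x z - snd x z'\<bar> \<le> (3/4) ^ k)"
    for k and x :: "nat \<times> (real^2 \<Rightarrow> real)"
  define Q where "Q k x y \<longleftrightarrow> fst x < fst y \<and> (\<forall>z\<in>settled (fst x). snd y z = snd x z) \<and>
      (\<forall>z. \<bar>snd y z - snd x z\<bar> \<le> 2 * (3/4) ^ k) \<and>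
      C1_on (h ` holes (fst x) (fst y)) (snd y \<circ> g) \<and>
      energy (h ` holes (fst x) (fst y)) (snd y \<circ> g) \<le> ennreal ((3/4) ^ k)"
    for k and x y :: "nat \<times> (real^2 \<Rightarrow> real)"
  have "\<exists>F. \<forall>k. P k (F k) \<and> Q k (F k) (F (Suc k))"
  proof (rule dependent_nat_choice)
    show "\<exists>x. P 0 x" using uc osc by (intro exI[of _ "(n, u)"]) (auto simp: P_def)
    fix x k assume x: "P k x"
    obtain n' u' where xe: "x = (n', u')" by (cases x)
    have p: "(3/4::real) ^ k > 0" by simp
    obtain m v where v: "n' < m" "continuous_on UNIV v"
      "\<And>q z z'. q \<in> cells m \<Longrightarrow> z \<in> cell m q \<Longrightarrow> z' \<in> cell m q \<Longrightarrow> \<bar>v z - v z'\<bar> \<le> (3/4) ^ k / 2 + 2 * ((3/4) ^ k / 8)"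
      "\<And>z. z \<in> settled n' \<Longrightarrow> v z = u' z" "\<And>z. \<bar>v z - u' z\<bar> \<le> (3/4) ^ k + 2 * ((3/4) ^ k / 8)"
      "C1_on (h ` holes n' m) (v \<circ> g)" "energy (h ` holes n' m) (v \<circ> g) \<le> ennreal ((3/4) ^ k / 8)"
    proof (rule staircase_step[OF hom, of u' "(3/4) ^ k" n' "(3/4) ^ k / 8"])
      show "continuous_on UNIV u'" using x by (simp add: P_def xe)
      show "\<bar>u' z - u' z'\<bar> \<le> (3/4) ^ k" if "q \<in> cells n'" "z \<in> cell n' q" "z' \<in> cell n' q" for q z z'
        using x that unfolding P_def xe fst_conv snd_conv by blast
    qed (use p in auto)
    have "P (Suc k) (m, v)" unfolding P_def using v(2,3) by auto
    moreover have "Q k x (m, v)"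
      unfolding Q_def xe fst_conv snd_conv
    proof (intro conjI ballI allI)
      show "\<bar>v z - u' z\<bar> \<le> 2 * (3/4) ^ k" for z using v(5)[of z] p by linarith
      show "energy (h ` holes n' m) (v \<circ> g) \<le> ennreal ((3/4) ^ k)"
        by (rule order_trans[OF v(7)]) (intro ennreal_leI, use p in linarith)
    qed (use v in auto)
    ultimately show "\<exists>y. P (Suc k) y \<and> Q k x y" by blast
  qed
  then obtain F where F: "\<And>k. P k (F k)" "\<And>k. Q k (F k) (F (Suc k))" by blast
  define N where "N k = fst (F k)" for k
  define U where "U k = snd (F k)" for k
  have N0: "N 0 = n" and U0: "U 0 = u" using F(1)[of 0] by (auto simp: P_def N_def U_def)
  have Uc: "continuous_on UNIV (U k)" for k using F(1)[of k] by (simp add: P_def U_def)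
  have N: "N k < N (Suc k)" for k using F(2)[of k] by (simp add: Q_def N_def)
  have Ueq1: "U (Suc k) z = U k z" if "z \<in> settled (N k)" for k z
    using F(2)[of k] that by (simp add: Q_def N_def U_def)
  have Ud: "\<bar>U (Suc k) z - U k z\<bar> \<le> 2 * (3/4) ^ k" for k z
    using F(2)[of k] by (simp add: Q_def U_def)
  have UC: "C1_on (h ` holes (N k) (N (Suc k))) (U (Suc k) \<circ> g)" for k
    using F(2)[of k] by (simp add: Q_def N_def U_def)
  have UE: "energy (h ` holes (N k) (N (Suc k))) (U (Suc k) \<circ> g) \<le> ennreal ((3/4) ^ k)" for k
    using F(2)[of k] by (simp add: Q_def N_def U_def)
  have Nmono: "mono N" using N by (intro incseq_SucI less_imp_le)
  have Nge: "k \<le> N k" for k using N by (intro strict_mono_imp_increasing) (simp add: strict_mono_Suc_iff)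
  have Ueq: "U l z = U k z" if "k \<le> l" "z \<in> settled (N k)" for k l z
    using that(1)
  proof (induction rule: dec_induct)
    case (step l)
    have "z \<in> settled (N l)" using settled_mono[OF monoD[OF Nmono step.hyps(1)]] that(2) by blast
    then show ?case using Ueq1 step by simp
  qed simp
  define s where "s z = (\<Sum>i. U (Suc i) z - U i z)" for z
  have "uniform_limit UNIV (\<lambda>k z. \<Sum>i<k. U (Suc i) z - U i z) s sequentially"
    unfolding s_def
  proof (rule Weierstrass_m_test)
    show "norm (U (Suc k) z - U k z) \<le> 2 * (3/4) ^ k" for k z using Ud by simp
    show "summable (\<lambda>k. 2 * (3/4::real) ^ k)" by (intro summable_mult summable_geometric) simp
  qed
  then have lim: "uniform_limit UNIV (\<lambda>k z. U k z - U 0 z) s sequentially"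
    by (simp only: sum_lessThan_telescope[of "\<lambda>i. U i z" for z])
  define v where "v z = U 0 z + s z" for z
  have "continuous_on UNIV s"
    by (rule uniform_limit_theorem[OF _ lim])
      (auto intro!: always_eventually continuous_on_diff Uc)
  then have vc: "continuous_on UNIV v" unfolding v_def[abs_def] using Uc by (intro continuous_on_add)
  have vU: "v z = U k z" if "z \<in> settled (N k)" for k z
  proof -
    have "(\<lambda>l. U l z - U 0 z) \<longlonglongrightarrow> s z" using tendsto_uniform_limitI[OF lim] by simp
    moreover have "(\<lambda>l. U l z - U 0 z) \<longlonglongrightarrow> U k z - U 0 z"
    proof (rule tendsto_eventually)
      show "\<forall>\<^sub>F l in sequentially. U l z - U 0 z = U k z - U 0 z"
        using eventually_ge_at_top[of k]
      proof eventually_elim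
        case (elim l)
        have "U l z = U k z" by (rule Ueq[OF elim that])
        then show ?case by (simp only:)
      qed
    qed
    ultimately have "s z = U k z - U 0 z" by (rule LIMSEQ_unique)
    then show ?thesis by (simp add: v_def)
  qed
  define H where "H k = h ` holes (N k) (N (Suc k))" for k
  have Hopen: "open (H k)" for k unfolding H_def by (rule homeomorphism_UNIV_open_image[OF hom open_holes])
  have eq: "(U (Suc k) \<circ> g) x = (v \<circ> g) x" if "x \<in> H k" for k x
  proof -
    have "g x \<in> settled (N (Suc k))"
      using that holes_subset_settled homeomorphism_UNIV_D(1)[OF hom] by (force simp: H_def)
    then show ?thesis using vU by simp
  qed
  have HC: "C1_on (H k) (v \<circ> g)" for k
    by (rule C1_on_cong[of "H k" "U (Suc k) \<circ> g"]) (use UC[of k] eq Hopen in \<open>auto simp: H_def[symmetric]\<close>)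
  have HE: "energy (H k) (v \<circ> g) \<le> ennreal ((3/4) ^ k)" for k
  proof -
    have "energy (H k) (U (Suc k) \<circ> g) = energy (H k) (v \<circ> g)"
      by (rule energy_cong[OF Hopen eq])
    then show ?thesis using UE[of k] by (simp add: H_def[symmetric])
  qed
  have cover: "h ` (\<Union>m. holes n m) = (\<Union>k. H k)"
  proof -
    have 1: "holes n (N k) \<subseteq> (\<Union>k. holes (N k) (N (Suc k)))" for k
    proof (induction k)
      case 0
      then show ?case by (simp add: N0 holes_def)
    next
      case (Suc k)
      have "holes n (N (Suc k)) = holes n (N k) \<union> holes (N k) (N (Suc k))"
        using monoD[OF Nmono, of 0 k] N[of k] by (intro holes_split) (auto simp: N0)
      then show ?case using Suc by blast
    qed
    have "holes n m \<subseteq> holes n (N m)" for m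
      using Nge[of m] by (fastforce simp: holes_def)
    then have "(\<Union>m. holes n m) \<subseteq> (\<Union>k. holes (N k) (N (Suc k)))" using 1 by blast
    moreover have "holes (N k) (N (Suc k)) \<subseteq> holes n (N (Suc k))" for k
      using monoD[OF Nmono, of 0 k] N[of k] holes_split[of n "N k" "N (Suc k)"] by (simp add: N0)
    ultimately have "(\<Union>m. holes n m) = (\<Union>k. holes (N k) (N (Suc k)))" by blast
    then show ?thesis by (simp add: H_def image_UN)
  qed
  show ?thesis
  proof (rule that[OF vc])
    show "v z = u z" if "z \<in> settled n" for z using vU[of z 0] that by (simp add: N0 U0)
    show "C1_on (h ` (\<Union>m. holes n m)) (v \<circ> g)" unfolding cover by (rule C1_on_Union) (use Hopen HC in auto)
    have "energy (h ` (\<Union>m. holes n m)) (v \<circ> g) \<le> (\<Sum>k. energy (H k) (v \<circ> g))"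
      unfolding cover by (rule energy_UN_le_suminf[OF Hopen HC])
    also have "\<dots> \<le> (\<Sum>k. ennreal ((3/4) ^ k))" by (intro suminf_le HE) auto
    also have "\<dots> = ennreal (\<Sum>k. (3/4) ^ k)" by (intro suminf_ennreal2) auto
    also have "\<dots> < \<infinity>" by simp
    finally show "energy (h ` (\<Union>m. holes n m)) (v \<circ> g) < \<infinity>" .
  qed
qed

subsection \<open>Smooth kernels and mollification\<close>

text \<open>Polynomials in \<open>1 / t\<close> times \<open>exp (- 1 / t)\<close> form a family
  closed under differentiation, so a statement about first derivatives yields all orders.\<close>

definition exp_tail :: "real poly \<Rightarrow> real \<Rightarrow> real" where
  "exp_tail p t = (if 0 < t then poly p (1 / t) * exp (- 1 / t) else 0)"

lemma power_poly_exp_tendsto_0: "((\<lambda>x::real. x ^ k * poly p x * exp (- x)) \<longlongrightarrow> 0) at_top"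
proof (induction p arbitrary: k)
  case 0
  then show ?case by simp
next
  case (pCons a p)
  have "((\<lambda>x. a * (x ^ k / exp x) + x ^ Suc k * poly p x * exp (- x)) \<longlongrightarrow> a * 0 + 0) at_top"
    by (intro tendsto_add tendsto_mult tendsto_const tendsto_power_div_exp_0 pCons.IH)
  then show ?case by (simp add: algebra_simps exp_minus divide_inverse)
qed

text \<open>The factor \<open>[:0, 0, 1:]\<close> is the \<open>1 / t\<^sup>2\<close> of the inner
  derivative. At 0 the difference quotient from the right is again a polynomial in
  \<open>1 / t\<close> times \<open>exp (- 1 / t)\<close>, which tends to 0.\<close>

lemma exp_tail_deriv:
  "(exp_tail p has_real_derivative exp_tail ([:0, 0, 1:] * (p - pderiv p)) t) (at t)"
proof -
  consider "t < 0" | "t > 0" | "t = 0" by linarith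
  then show ?thesis
  proof cases
    case 1
    have "((\<lambda>t. 0) has_real_derivative 0) (at t)" by simp
    then have "(exp_tail p has_real_derivative 0) (at t)"
      by (rule has_field_derivative_transform_within_open[where S="{..<0}"]) (use 1 in \<open>auto simp: exp_tail_def\<close>)
    then show ?thesis using 1 by (simp add: exp_tail_def)
  next
    case 2
    have "((\<lambda>t. poly p (1 / t) * exp (- 1 / t)) has_real_derivative
        exp_tail ([:0, 0, 1:] * (p - pderiv p)) t) (at t)"
      using 2 by (auto intro!: derivative_eq_intros poly_DERIV[THEN DERIV_chain2]
          simp: exp_tail_def field_simps power2_eq_square)
    then show ?thesis
      by (rule has_field_derivative_transform_within_open[where S="{0<..}"]) (use 2 in \<open>auto simp: exp_tail_def\<close>)
  next
    case 3
    have "((\<lambda>y. exp_tail p y / y) \<longlongrightarrow> 0) (at 0)"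
      unfolding filterlim_at_split
    proof
      show "((\<lambda>y. exp_tail p y / y) \<longlongrightarrow> 0) (at_left 0)"
        by (rule tendsto_eventually) (auto simp: exp_tail_def eventually_at_filter)
      have "((\<lambda>y::real. (1 / y) ^ 1 * poly p (1 / y) * exp (- (1 / y))) \<longlongrightarrow> 0) (at_right 0)"
        by (rule filterlim_compose[OF power_poly_exp_tendsto_0[of 1 p]])
          (use filterlim_inverse_at_top_right in \<open>simp add: inverse_eq_divide\<close>)
      moreover have "\<forall>\<^sub>F y in at_right 0. (1 / y) ^ 1 * poly p (1 / y) * exp (- (1 / y)) = exp_tail p y / y"
        using eventually_at_right_less[of "0::real"] by (rule eventually_mono) (simp add: exp_tail_def)
      ultimately show "((\<lambda>y. exp_tail p y / y) \<longlongrightarrow> 0) (at_right 0)"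
        by (rule Lim_transform_eventually)
    qed
    then show ?thesis using 3 by (simp add: has_field_derivative_iff exp_tail_def)
  qed
qed

text \<open>A syntactic class whose members have partial derivatives in the class again;
  \<open>C_times k\<close> then follows by induction on \<open>k\<close>, without formulas for
  higher derivatives.\<close>

inductive smooth_class :: "('a::euclidean_space \<Rightarrow> real) \<Rightarrow> bool" where
  exp_tail: "smooth_class (\<lambda>w. exp_tail p (c + w \<bullet> v))"
| const: "smooth_class (\<lambda>w. c)"
| add: "smooth_class f \<Longrightarrow> smooth_class g \<Longrightarrow> smooth_class (\<lambda>w. f w + g w)"
| mult: "smooth_class f \<Longrightarrow> smooth_class g \<Longrightarrow> smooth_class (\<lambda>w. f w * g w)"

lemma smooth_class_derivative:
  "smooth_class f \<Longrightarrow> \<exists>F. (\<forall>b. smooth_class (F b)) \<and> (\<forall>x. (f has_derivative (\<lambda>b. F b x)) (at x))"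
proof (induction rule: smooth_class.induct)
  case (exp_tail p c v)
  let ?q = "[:0, 0, 1:] * (p - pderiv p)"
  have "((\<lambda>w. exp_tail p (c + w \<bullet> v)) has_derivative (\<lambda>b. exp_tail ?q (c + x \<bullet> v) * (b \<bullet> v))) (at x)" for x
  proof -
    have "(exp_tail p has_derivative (\<lambda>h. exp_tail ?q (c + x \<bullet> v) * h)) (at (c + x \<bullet> v))"
      using exp_tail_deriv unfolding has_field_derivative_def by blast
    moreover have "((\<lambda>w. c + w \<bullet> v) has_derivative (\<lambda>b. b \<bullet> v)) (at x)"
      by (auto intro!: derivative_eq_intros)
    ultimately show ?thesis using has_derivative_compose[of "\<lambda>w. c + w \<bullet> v"] by blast
  qed
  moreover have "smooth_class (\<lambda>x. exp_tail ?q (c + x \<bullet> v) * (b \<bullet> v))" for b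
    by (intro smooth_class.intros)
  ultimately show ?case by (intro exI[of _ "\<lambda>b x. exp_tail ?q (c + x \<bullet> v) * (b \<bullet> v)"]) simp
next
  case (const c)
  then show ?case by (intro exI[of _ "\<lambda>b x. 0"]) (auto intro: smooth_class.const)
next
  case (add f g)
  then obtain F G where FG: "\<And>b. smooth_class (F b)" "\<And>x. (f has_derivative (\<lambda>b. F b x)) (at x)"
    "\<And>b. smooth_class (G b)" "\<And>x. (g has_derivative (\<lambda>b. G b x)) (at x)" by metis
  show ?case
    by (rule exI[of _ "\<lambda>b x. F b x + G b x"]) (intro conjI allI smooth_class.add has_derivative_add FG)
next
  case (mult f g)
  then obtain F G where FG: "\<And>b. smooth_class (F b)" "\<And>x. (f has_derivative (\<lambda>b. F b x)) (at x)"
    "\<And>b. smooth_class (G b)" "\<And>x. (g has_derivative (\<lambda>b. G b x)) (at x)" by metis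
  show ?case
    by (rule exI[of _ "\<lambda>b x. f x * G b x + F b x * g x"])
      (intro conjI allI smooth_class.add smooth_class.mult has_derivative_mult FG mult.hyps)
qed

lemma smooth_class_partial_deriv:
  assumes "smooth_class f"
  shows "smooth_class (partial_deriv b f)" "f differentiable (at x)"
proof -
  obtain F where F: "\<And>b. smooth_class (F b)" "\<And>x. (f has_derivative (\<lambda>b. F b x)) (at x)"
    using smooth_class_derivative[OF assms] by blast
  have "partial_deriv b f = F b"
    unfolding partial_deriv_def using frechet_derivative_at[OF F(2)] by (simp add: fun_eq_iff)
  then show "smooth_class (partial_deriv b f)" using F(1) by simp
  show "f differentiable (at x)" using F(2) differentiable_def by blast
qed

lemma smooth_class_continuous: "smooth_class f \<Longrightarrow> continuous_on A f"
  by (auto simp: continuous_on_eq_continuous_within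
      intro!: differentiable_imp_continuous_within differentiable_at_withinI smooth_class_partial_deriv(2))

lemma smooth_class_C_times: "smooth_class f \<Longrightarrow> C_times k f"
  by (induction k arbitrary: f) (simp_all add: smooth_class_continuous smooth_class_partial_deriv)

section \<open>A smooth kernel supported in a square\<close>

definition bump :: "real \<Rightarrow> real^2 \<Rightarrow> real" where
  "bump r x = exp_tail 1 (r + x $ 1) * exp_tail 1 (r - x $ 1) * (exp_tail 1 (r + x $ 2) * exp_tail 1 (r - x $ 2))"

lemma exp_tail_1: "exp_tail 1 t = (if 0 < t then exp (- 1 / t) else 0)"
  by (simp add: exp_tail_def)

lemma bump_nonneg: "0 \<le> bump r x"
  by (simp add: bump_def exp_tail_1)

lemma bump_eq_0: "bump r x = 0" if "r \<le> \<bar>x $ 1\<bar> \<or> r \<le> \<bar>x $ 2\<bar>"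
  using that by (auto simp: bump_def exp_tail_1)

lemma bump_pos: "\<bar>x $ 1\<bar> < r \<Longrightarrow> \<bar>x $ 2\<bar> < r \<Longrightarrow> 0 < bump r x"
  by (auto simp: bump_def exp_tail_1)

lemma bump_minus: "bump r (- x) = bump r x"
  by (simp add: bump_def mult_ac)

lemma smooth_class_bump: "smooth_class (bump r)"
proof -
  have "smooth_class (\<lambda>x. exp_tail 1 (r + x \<bullet> axis 1 1) * exp_tail 1 (r + x \<bullet> axis 1 (-1)) *
      (exp_tail 1 (r + x \<bullet> axis 2 1) * exp_tail 1 (r + x \<bullet> (axis 2 (-1) :: real^2))))"
    by (intro smooth_class.intros)
  then show ?thesis by (simp add: bump_def[abs_def] inner_axis)
qed

lemma continuous_on_bump [continuous_intros]:
  "continuous_on A f \<Longrightarrow> continuous_on A (\<lambda>x. bump r (f x))"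
  "continuous_on A f \<Longrightarrow> continuous_on A (\<lambda>x. partial_deriv b (bump r) (f x))"
  by (rule continuous_on_compose2[OF smooth_class_continuous[of _ UNIV]],
      auto intro: smooth_class_bump smooth_class_partial_deriv)+

lemma smooth_class_bump_reflected: "smooth_class (\<lambda>w. bump r (z - w))"
proof -
  have "smooth_class (\<lambda>w. exp_tail 1 ((r + z $ 1) + w \<bullet> axis 1 (-1)) * exp_tail 1 ((r - z $ 1) + w \<bullet> axis 1 1) *
      (exp_tail 1 ((r + z $ 2) + w \<bullet> axis 2 (-1)) * exp_tail 1 ((r - z $ 2) + w \<bullet> (axis 2 1 :: real^2))))"
    by (intro smooth_class.intros)
  then show ?thesis by (simp add: bump_def inner_axis algebra_simps)
qed

lemma partial_deriv_bump_reflected: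
  "partial_deriv b (\<lambda>w. bump r (z - w)) w = - partial_deriv b (bump r) (z - w)"
proof -
  have 1: "(bump r has_derivative (\<lambda>v. grad (bump r) (z - w) \<bullet> v)) (at (z - w))"
    by (intro has_derivative_grad smooth_class_partial_deriv(2) smooth_class_bump)
  have 2: "((\<lambda>w. z - w) has_derivative (\<lambda>v. - v)) (at w)"
    by (auto intro!: derivative_eq_intros)
  have "((\<lambda>w. bump r (z - w)) has_derivative (\<lambda>v. grad (bump r) (z - w) \<bullet> (- v))) (at w)"
    by (rule has_derivative_compose[OF 2 1])
  then have "((\<lambda>w. bump r (z - w)) has_derivative (\<lambda>v. (- grad (bump r) (z - w)) \<bullet> v)) (at w)" by simp
  then have "grad (\<lambda>w. bump r (z - w)) w = - grad (bump r) (z - w)" by (rule grad_eqI)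
  then show ?thesis
    by (simp add: partial_deriv_eq_grad smooth_class_partial_deriv(2) smooth_class_bump smooth_class_bump_reflected)
qed

lemma bump_support: "{w. bump r (z - w) \<noteq> 0} \<subseteq> cbox (\<chi> i. z $ i - r) (\<chi> i. z $ i + r)"
proof
  fix w assume "w \<in> {w. bump r (z - w) \<noteq> 0}"
  then have "\<bar>(z - w) $ 1\<bar> < r" "\<bar>(z - w) $ 2\<bar> < r" using bump_eq_0[of r "z - w"] by force+
  then show "w \<in> cbox (\<chi> i. z $ i - r) (\<chi> i. z $ i + r)"
    by (auto simp: mem_box_cart forall_2)
qed

lemma test_function_bump: "test_function_on UNIV (\<lambda>w. bump r (z - w))"
proof -
  have "bounded {w. bump r (z - w) \<noteq> 0}" using bump_support bounded_cbox bounded_subset by blast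
  then show ?thesis
    unfolding test_function_on_def using smooth_class_C_times[OF smooth_class_bump_reflected] by simp
qed

lemma
  shows integrable_bump: "integrable lborel (bump r)"
    and integral_bump_pos: "r > 0 \<Longrightarrow> (\<integral>x. bump r x \<partial>lborel) > 0"
proof -
  define lo hi :: "real^2" where "lo = (\<chi> i. - r)" and "hi = (\<chi> i. r)"
  have bc: "continuous_on A (bump r)" for A by (rule smooth_class_continuous[OF smooth_class_bump])
  have "bump r x = 0" if "x \<notin> cbox lo hi" for x
    using subsetD[OF bump_support[of r 0], of x] that bump_minus[of r x] by (auto simp: lo_def hi_def)
  note I = integral_cbox_eq_lborel[OF bc this]
  show "integrable lborel (bump r)" by (rule I(1))
  show "(\<integral>x. bump r x \<partial>lborel) > 0" if "r > 0"
  proof -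
    have "0 \<in> box lo hi" using that by (simp add: lo_def hi_def mem_box_cart)
    then have "integral (cbox lo hi) (bump r) \<noteq> 0"
      using integral_cbox_eq_0_iff[OF bc, of lo hi] bump_nonneg bump_pos[of 0 r] that box_subset_cbox[of lo hi] by force
    moreover have "0 \<le> integral (cbox lo hi) (bump r)"
      by (intro Henstock_Kurzweil_Integration.integral_nonneg integrable_continuous bc bump_nonneg)
    ultimately show ?thesis using I(2) by simp
  qed
qed

text \<open>Jensen's inequality for the probability density \<open>K\<close>: the variance of
  \<open>g\<close> is nonnegative, and expanding its square gives the claim. The bound
  \<open>C\<close> on the density makes the weighted integrals finite.\<close>

lemma jensen_square:
  fixes g K :: "real^2 \<Rightarrow> real"
  assumes [measurable]: "g \<in> borel_measurable borel" "K \<in> borel_measurable borel"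
    and g: "integrable lborel (\<lambda>w. (g w)\<^sup>2)" and K: "integrable lborel K" "(\<integral>w. K w \<partial>lborel) = 1"
    "\<And>w. 0 \<le> K w" "\<And>w. K w \<le> C"
  shows "integrable lborel (\<lambda>w. g w * K w)" "integrable lborel (\<lambda>w. (g w)\<^sup>2 * K w)"
    "(\<integral>w. g w * K w \<partial>lborel)\<^sup>2 \<le> (\<integral>w. (g w)\<^sup>2 * K w \<partial>lborel)"
proof -
  show i2: "integrable lborel (\<lambda>w. (g w)\<^sup>2 * K w)"
  proof (rule Bochner_Integration.integrable_bound)
    show "integrable lborel (\<lambda>w. C * (g w)\<^sup>2)" using g by simp
    have "(g w)\<^sup>2 * K w \<le> (g w)\<^sup>2 * C" for w by (intro mult_left_mono K) auto
    moreover have "0 \<le> (g w)\<^sup>2 * K w" for w by (intro mult_nonneg_nonneg K) auto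
    ultimately show "AE w in lborel. norm ((g w)\<^sup>2 * K w) \<le> norm (C * (g w)\<^sup>2)"
      by (intro always_eventually allI) (smt (verit) mult.commute real_norm_def)
  qed measurable
  show i1: "integrable lborel (\<lambda>w. g w * K w)"
  proof (rule Bochner_Integration.integrable_bound)
    show "integrable lborel (\<lambda>w. K w + (g w)\<^sup>2 * K w)" using K i2 by simp
    have "\<bar>g w\<bar> * K w \<le> (1 + (g w)\<^sup>2) * K w" for w
    proof (rule mult_right_mono)
      have "0 \<le> (\<bar>g w\<bar> - 1)\<^sup>2" by simp
      then have "2 * \<bar>g w\<bar> \<le> 1 + (g w)\<^sup>2" by (simp add: power2_diff)
      then show "\<bar>g w\<bar> \<le> 1 + (g w)\<^sup>2" by linarith
    qed (rule K)
    moreover have "0 \<le> K w + (g w)\<^sup>2 * K w" for w using K(3)[of w] by simp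
    ultimately show "AE w in lborel. norm (g w * K w) \<le> norm (K w + (g w)\<^sup>2 * K w)"
      using K(3) by (intro always_eventually allI) (simp add: abs_mult algebra_simps)
  qed measurable
  let ?a = "\<integral>w. g w * K w \<partial>lborel"
  have "0 \<le> (\<integral>w. (g w - ?a)\<^sup>2 * K w \<partial>lborel)" using K(3) by (intro Bochner_Integration.integral_nonneg) auto
  also have "(\<lambda>w. (g w - ?a)\<^sup>2 * K w) = (\<lambda>w. (g w)\<^sup>2 * K w - 2 * ?a * (g w * K w) + ?a\<^sup>2 * K w)"
    by (simp add: power2_diff algebra_simps fun_eq_iff)
  also have "(\<integral>w. (g w)\<^sup>2 * K w - 2 * ?a * (g w * K w) + ?a\<^sup>2 * K w \<partial>lborel) =
      (\<integral>w. (g w)\<^sup>2 * K w \<partial>lborel) - 2 * ?a * ?a + ?a\<^sup>2 * 1"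
    using i1 i2 K by simp
  finally show "?a\<^sup>2 \<le> (\<integral>w. (g w)\<^sup>2 * K w \<partial>lborel)" by (simp add: power2_eq_square)
qed

lemma partial_deriv_bump_eq_0:
  assumes "r < \<bar>x $ 1\<bar> \<or> r < \<bar>x $ 2\<bar>"
  shows "partial_deriv b (bump r) x = 0"
proof -
  let ?V = "{x::real^2. r < \<bar>x $ 1\<bar>} \<union> {x. r < \<bar>x $ 2\<bar>}"
  have "open ?V" by (intro open_Un open_Collect_less continuous_intros)
  then have "grad (bump r) x = grad (\<lambda>x. 0) x"
    by (rule grad_cong_open(1)) (use assms bump_eq_0 in auto)
  also have "\<dots> = 0" by (rule grad_eqI) simp
  finally show ?thesis by (simp add: partial_deriv_eq_grad smooth_class_partial_deriv(2)[OF smooth_class_bump])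
qed

lemma lborel_integral_reflect:
  fixes F :: "'a::euclidean_space \<Rightarrow> real"
  assumes "F \<in> borel_measurable borel"
  shows "(\<integral>w. F (z - w) \<partial>lborel) = (\<integral>w. F w \<partial>lborel)" "integrable lborel (\<lambda>w. F (z - w)) \<longleftrightarrow> integrable lborel F"
proof -
  have eq: "lborel = distr lborel borel (\<lambda>w::'a. z - w)"
    using lborel_affine[of "-1" z] by (simp add: density_1 one_ennreal_def[symmetric])
  show "(\<integral>w. F (z - w) \<partial>lborel) = (\<integral>w. F w \<partial>lborel)"
    by (subst (2) eq, subst integral_distr) (use assms in auto)
  show "integrable lborel (\<lambda>w. F (z - w)) \<longleftrightarrow> integrable lborel F"
    by (subst (2) eq, subst integrable_distr_eq) (use assms in auto)
qed

text \<open>The unit is half the side, so this square contains all concentric ones of half-side at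
  most 1.\<close>

definition unit_square :: "real^2 \<Rightarrow> (real^2) set" where
  "unit_square p = {z. \<forall>i. \<bar>z $ i - p $ i\<bar> \<le> 1}"

text \<open>Convolution with the normalized bump. Testing the weak derivative against the reflected
  kernel shows that the derivative of the convolution is the convolution of \<open>G b\<close>,
  whose energy is bounded by Jensen and Fubini. Integrating over a fixed box makes \<open>u\<close>
  differentiable everywhere; on the square it is the full convolution, since the box has half-side 2
  and the kernel radius is at most 1.\<close>

lemma mollification:
  fixes f :: "real^2 \<Rightarrow> real" and G :: "real^2 \<Rightarrow> real^2 \<Rightarrow> real"
  assumes fc: "continuous_on UNIV f"
    and G: "\<And>b. b \<in> Basis \<Longrightarrow> G b \<in> L2_on UNIV" "\<And>b. b \<in> Basis \<Longrightarrow> weak_partial_deriv_on UNIV b f (G b)"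
    and e: "e > 0"
  obtains U :: "real^2 \<Rightarrow> real^2 \<Rightarrow> real" and u :: "real^2 \<Rightarrow> real" where
    "\<forall>b. continuous_on UNIV (U b)"
    "\<forall>b z s. ((\<lambda>s. u (z + s *\<^sub>R b)) has_real_derivative U b (z + s *\<^sub>R b)) (at s)"
    "\<forall>z\<in>unit_square p. \<bar>u z - f z\<bar> \<le> e"
    "\<forall>b\<in>Basis. (\<integral>\<^sup>+z\<in>unit_square p. ennreal ((U b z)\<^sup>2) \<partial>lborel) \<le> ennreal (\<integral>x. (G b x)\<^sup>2 \<partial>lebesgue)"
proof -
  define lo hi :: "real^2" where "lo = (\<chi> i. p $ i - 2)" and "hi = (\<chi> i. p $ i + 2)"
  define Q where "Q = unit_square p"
  have "uniformly_continuous_on (cbox lo hi) f"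
    using compact_uniformly_continuous continuous_on_subset[OF fc] compact_cbox by blast
  then obtain d where d: "d > 0"
    "\<And>z w. z \<in> cbox lo hi \<Longrightarrow> w \<in> cbox lo hi \<Longrightarrow> dist w z < d \<Longrightarrow> dist (f w) (f z) < e"
    unfolding uniformly_continuous_on_def using e by blast
  \<comment> \<open>The bound 1 keeps the kernel inside the box. The bound \<open>d / 2\<close> is
    used because distances in the support of the kernel are estimated by the sum of two coordinates,
    hence by \<open>2 * r\<close>.\<close>
  define r where "r = min 1 (d / 2)"
  have r: "r > 0" "r \<le> 1" "2 * r \<le> d" using d by (auto simp: r_def)
  define c where "c = (\<integral>x. bump r x \<partial>lborel)"
  have c: "c > 0" unfolding c_def by (rule integral_bump_pos[OF r(1)])
  define u where "u z = integral (cbox lo hi) (\<lambda>w. f w * bump r (z - w)) / c" for z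
  define U where "U b z = integral (cbox lo hi) (\<lambda>w. f w * partial_deriv b (bump r) (z - w)) / c" for b z
  have Uc: "continuous_on UNIV (U b)" for b
  proof -
    have "continuous_on (UNIV \<times> cbox lo hi) (\<lambda>(z, w). f w * partial_deriv b (bump r) (z - w))"
      unfolding split_beta
      by (intro continuous_intros continuous_on_compose2[OF fc]) auto
    then have "continuous_on UNIV (\<lambda>z. integral (cbox lo hi) (\<lambda>w. f w * partial_deriv b (bump r) (z - w)))"
      by (rule integral_continuous_on_param)
    then show ?thesis unfolding U_def[abs_def] by (intro continuous_on_divide continuous_on_const) (use c in auto)
  qed
  have ud: "((\<lambda>s. u (z + s *\<^sub>R b)) has_real_derivative U b (z + s *\<^sub>R b)) (at s)" for b z s
  proof -
    have "((\<lambda>s. integral (cbox lo hi) (\<lambda>w. f w * bump r (z + s *\<^sub>R b - w))) has_vector_derivative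
        integral (cbox lo hi) (\<lambda>w. f w * partial_deriv b (bump r) (z + s *\<^sub>R b - w))) (at s within UNIV)"
    proof (rule leibniz_rule_vector_derivative)
      fix s w
      have 1: "((\<lambda>s. z + s *\<^sub>R b - w) has_derivative (\<lambda>h. h *\<^sub>R b)) (at s)"
        by (auto intro!: derivative_eq_intros)
      have 2: "(bump r has_derivative (\<lambda>v. grad (bump r) (z + s *\<^sub>R b - w) \<bullet> v)) (at (z + s *\<^sub>R b - w))"
        by (intro has_derivative_grad smooth_class_partial_deriv(2) smooth_class_bump)
      have "((\<lambda>s. bump r (z + s *\<^sub>R b - w)) has_vector_derivative (grad (bump r) (z + s *\<^sub>R b - w) \<bullet> b)) (at s)"
        unfolding has_vector_derivative_def using has_derivative_compose[OF 1 2] by simp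
      then have "((\<lambda>s. bump r (z + s *\<^sub>R b - w)) has_vector_derivative partial_deriv b (bump r) (z + s *\<^sub>R b - w)) (at s)"
        by (simp add: partial_deriv_eq_grad smooth_class_partial_deriv(2)[OF smooth_class_bump])
      then show "((\<lambda>s. f w * bump r (z + s *\<^sub>R b - w)) has_vector_derivative
          f w * partial_deriv b (bump r) (z + s *\<^sub>R b - w)) (at s within UNIV)"
        by (rule has_vector_derivative_mult_right)
    next
      fix s
      show "(\<lambda>w. f w * bump r (z + s *\<^sub>R b - w)) integrable_on cbox lo hi"
        by (intro integrable_continuous continuous_intros continuous_on_subset[OF fc]) auto
    next
      show "continuous_on (UNIV \<times> cbox lo hi) (\<lambda>(s, w). f w * partial_deriv b (bump r) (z + s *\<^sub>R b - w))"
        unfolding split_beta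
        by (intro continuous_intros continuous_on_compose2[OF fc]) auto
    qed auto
    then have "((\<lambda>s. integral (cbox lo hi) (\<lambda>w. f w * bump r (z + s *\<^sub>R b - w))) has_real_derivative
        integral (cbox lo hi) (\<lambda>w. f w * partial_deriv b (bump r) (z + s *\<^sub>R b - w))) (at s)"
      by (simp add: has_real_derivative_iff_has_vector_derivative)
    then show ?thesis unfolding u_def U_def by (rule DERIV_cdivide)
  qed
  have inbox: "w \<in> cbox lo hi" if "z \<in> Q" "\<bar>(z - w) $ 1\<bar> \<le> r" "\<bar>(z - w) $ 2\<bar> \<le> r" for z w
  proof -
    have "\<bar>z $ 1 - p $ 1\<bar> \<le> 1" "\<bar>z $ 2 - p $ 2\<bar> \<le> 1" using that(1) by (auto simp: Q_def unit_square_def)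
    then show ?thesis using that(2,3) r(2) by (auto simp: mem_box_cart lo_def hi_def forall_2)
  qed
  define K where "K w = bump r w / c" for w
  have Kc: "continuous_on UNIV K" unfolding K_def[abs_def] by (intro continuous_intros) (use c in auto)
  have Km [measurable]: "K \<in> borel_measurable borel" using Kc by (rule borel_measurable_continuous_onI)
  have Ki: "integrable lborel K" unfolding K_def[abs_def] using integrable_bump by simp
  have K1: "(\<integral>w. K w \<partial>lborel) = 1" unfolding K_def using c by (simp add: c_def[symmetric])
  have K0: "0 \<le> K w" for w using c bump_nonneg by (simp add: K_def)
  have Kz: "K w = 0" if "r \<le> \<bar>w $ 1\<bar> \<or> r \<le> \<bar>w $ 2\<bar>" for w using bump_eq_0[OF that] by (simp add: K_def)
  have Kb: "K w \<le> 1 / c" for w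
  proof -
    have e: "exp_tail 1 t \<le> 1" "0 \<le> exp_tail 1 t" for t by (auto simp: exp_tail_1)
    have "bump r w \<le> 1 * 1 * (1 * 1)" unfolding bump_def by (intro mult_mono e mult_nonneg_nonneg) auto
    then show ?thesis using c by (simp add: K_def divide_right_mono)
  qed
  have uK: "integrable lborel (\<lambda>w. f w * K (z - w))" "u z = (\<integral>w. f w * K (z - w) \<partial>lborel)" if z: "z \<in> Q" for z
  proof -
    have cont: "continuous_on UNIV (\<lambda>w. f w * bump r (z - w))"
      by (intro continuous_intros fc)
    have zero: "f w * bump r (z - w) = 0" if "w \<notin> cbox lo hi" for w
      using inbox[OF z, of w] that bump_eq_0[of r "z - w"] by fastforce
    note I = integral_cbox_eq_lborel[OF cont zero]
    show "integrable lborel (\<lambda>w. f w * K (z - w))" using I(1) by (simp add: K_def)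
    show "u z = (\<integral>w. f w * K (z - w) \<partial>lborel)" using I(2) by (simp add: u_def K_def)
  qed
  have close: "\<bar>u z - f z\<bar> \<le> e" if zQ: "z \<in> Q" for z
  proof -
    have zB: "z \<in> cbox lo hi" by (rule inbox[OF zQ]) (use r in auto)
    have Kzi: "integrable lborel (\<lambda>w. K (z - w))" "(\<integral>w. K (z - w) \<partial>lborel) = 1"
      using lborel_integral_reflect[OF Km] Ki K1 by auto
    have "u z - f z = (\<integral>w. f w * K (z - w) - f z * K (z - w) \<partial>lborel)"
      using uK[OF zQ] Kzi by simp
    also have "\<bar>\<dots>\<bar> \<le> (\<integral>w. e * K (z - w) \<partial>lborel)"
    proof (rule order_trans[OF integral_abs_bound integral_mono])
      show "integrable lborel (\<lambda>w. \<bar>f w * K (z - w) - f z * K (z - w)\<bar>)" using uK[OF zQ] Kzi by simp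
      show "integrable lborel (\<lambda>w. e * K (z - w))" using Kzi by simp
      show "\<bar>f w * K (z - w) - f z * K (z - w)\<bar> \<le> e * K (z - w)" for w
      proof (cases "\<bar>(z - w) $ 1\<bar> < r \<and> \<bar>(z - w) $ 2\<bar> < r")
        case True
        have "norm (w - z) \<le> \<bar>(w - z) $ 1\<bar> + \<bar>(w - z) $ 2\<bar>"
          using norm_le_l1_cart[of "w - z"] by (simp add: sum_2)
        also have "\<dots> < d" using True r by (simp add: abs_minus_commute[of "w $ _"])
        finally have "dist w z < d" by (simp add: dist_norm)
        then have "\<bar>f w - f z\<bar> \<le> e"
          using d(2)[OF zB inbox[OF zQ, of w]] True by (simp add: dist_real_def)
        then have "\<bar>f w - f z\<bar> * K (z - w) \<le> e * K (z - w)" by (intro mult_right_mono K0)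
        then show ?thesis using K0[of "z - w"] by (simp add: left_diff_distrib[symmetric] abs_mult)
      next
        case False
        then have "K (z - w) = 0" by (intro Kz) auto
        then show ?thesis by simp
      qed
    qed
    also have "\<dots> = e" using Kzi by simp
    finally show ?thesis .
  qed
  have en: "(\<integral>\<^sup>+z\<in>Q. ennreal ((U b z)\<^sup>2) \<partial>lborel) \<le> ennreal (\<integral>x. (G b x)\<^sup>2 \<partial>lebesgue)" if b: "b \<in> Basis" for b
  proof -
    have Gm: "G b \<in> borel_measurable lebesgue" and Gi: "integrable lebesgue (\<lambda>x. (G b x)\<^sup>2)"
      using G(1)[OF b] by (auto simp: L2_on_def lebesgue_on_UNIV_eq)
    \<comment> \<open>A Borel representative of the Lebesgue measurable \<open>G b\<close>, so that
      Jensen and Fubini can be applied over \<open>lborel\<close>.\<close>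
    obtain g where g [measurable]: "g \<in> borel_measurable borel" and gG: "AE x in lborel. G b x = g x"
      using completion_ex_borel_measurable_real[OF Gm] by auto
    have gG': "AE x in lebesgue. G b x = g x" using gG by (rule AE_completion)
    have gi': "integrable lebesgue (\<lambda>x. (g x)\<^sup>2)"
      using Gi by (rule integrable_cong_AE_imp) (use gG' in \<open>auto intro: measurable_completion\<close>)
    then have gi: "integrable lborel (\<lambda>x. (g x)\<^sup>2)" by (simp add: integrable_completion)
    have gint: "(\<integral>x. (G b x)\<^sup>2 \<partial>lebesgue) = (\<integral>x. (g x)\<^sup>2 \<partial>lborel)"
    proof -
      have "(\<integral>x. (G b x)\<^sup>2 \<partial>lebesgue) = (\<integral>x. (g x)\<^sup>2 \<partial>lebesgue)"
        using gG' Gm by (intro integral_cong_AE) (auto intro: measurable_completion)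
      then show ?thesis by (simp add: integral_completion)
    qed
    have pt: "ennreal ((U b z)\<^sup>2) \<le> (\<integral>\<^sup>+w. ennreal ((g w)\<^sup>2 * K (z - w)) \<partial>lborel)" if z: "z \<in> Q" for z
    proof -
      have cont: "continuous_on UNIV (\<lambda>w. f w * partial_deriv b (bump r) (z - w))"
        by (intro continuous_intros fc)
      have zero: "f w * partial_deriv b (bump r) (z - w) = 0" if "w \<notin> cbox lo hi" for w
        using inbox[OF z, of w] that partial_deriv_bump_eq_0[of r "z - w" b] by fastforce
      note I = integral_cbox_eq_lborel[OF cont zero]
      have bm: "(\<lambda>w. bump r (z - w)) \<in> borel_measurable borel"
        by (rule borel_measurable_continuous_onI[OF smooth_class_continuous[OF smooth_class_bump_reflected]])
      have "U b z = (\<integral>w. f w * partial_deriv b (bump r) (z - w) \<partial>lborel) / c" using I(2) by (simp add: U_def)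
      also have "(\<integral>w. f w * partial_deriv b (bump r) (z - w) \<partial>lborel) = (\<integral>w. f w * partial_deriv b (bump r) (z - w) \<partial>lebesgue)"
        using I(1) by (intro integral_completion[symmetric]) auto
      \<comment> \<open>The sign from differentiating \<open>z - w\<close> cancels the sign in the
        definition of the weak derivative.\<close>
      also have "\<dots> = - (\<integral>w. f w * partial_deriv b (\<lambda>w. bump r (z - w)) w \<partial>lebesgue)"
        by (simp add: partial_deriv_bump_reflected)
      also have "\<dots> = (\<integral>w. G b w * bump r (z - w) \<partial>lebesgue)"
        using G(2)[OF b] test_function_bump unfolding weak_partial_deriv_on_def lebesgue_on_UNIV_eq by simp
      also have "\<dots> = (\<integral>w. g w * bump r (z - w) \<partial>lebesgue)"
      proof (intro integral_cong_AE)
        show "(\<lambda>w. G b w * bump r (z - w)) \<in> borel_measurable lebesgue"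
        proof (rule borel_measurable_times[OF Gm])
          show "(\<lambda>w. bump r (z - w)) \<in> borel_measurable lebesgue"
            using bm by (intro measurable_completion) auto
        qed
        show "(\<lambda>w. g w * bump r (z - w)) \<in> borel_measurable lebesgue"
          using bm by (intro measurable_completion) auto
        show "AE w in lebesgue. G b w * bump r (z - w) = g w * bump r (z - w)"
          using gG' by (auto elim: eventually_mono)
      qed
      also have "\<dots> = (\<integral>w. g w * bump r (z - w) \<partial>lborel)"
        using bm by (intro integral_completion) auto
      finally have Ueq: "U b z = (\<integral>w. g w * K (z - w) \<partial>lborel)" by (simp add: K_def)
      have "integrable lborel (\<lambda>w. K (z - w))" "(\<integral>w. K (z - w) \<partial>lborel) = 1"
        using lborel_integral_reflect[OF Km] Ki K1 by auto
      note J = jensen_square[OF g _ gi this K0 Kb]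
      have "(U b z)\<^sup>2 \<le> (\<integral>w. (g w)\<^sup>2 * K (z - w) \<partial>lborel)" unfolding Ueq by (rule J(3)) measurable
      moreover have "(\<integral>\<^sup>+w. ennreal ((g w)\<^sup>2 * K (z - w)) \<partial>lborel) = ennreal (\<integral>w. (g w)\<^sup>2 * K (z - w) \<partial>lborel)"
        using K0 by (intro nn_integral_eq_integral J(2)) auto
      ultimately show ?thesis by (simp add: ennreal_leI)
    qed
    have "(\<integral>\<^sup>+z\<in>Q. ennreal ((U b z)\<^sup>2) \<partial>lborel) \<le> (\<integral>\<^sup>+z. (\<integral>\<^sup>+w. ennreal ((g w)\<^sup>2 * K (z - w)) \<partial>lborel) \<partial>lborel)"
      by (intro nn_integral_mono) (auto simp: indicator_def pt)
    also have "\<dots> = (\<integral>\<^sup>+w. (\<integral>\<^sup>+z. ennreal ((g w)\<^sup>2 * K (z - w)) \<partial>lborel) \<partial>lborel)"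
      by (rule lborel_pair.Fubini') measurable
    also have "\<dots> = (\<integral>\<^sup>+w. ennreal ((g w)\<^sup>2) \<partial>lborel)"
    proof (rule nn_integral_cong)
      fix w
      have "(\<integral>\<^sup>+z. ennreal ((g w)\<^sup>2 * K (z - w)) \<partial>lborel) = (\<integral>\<^sup>+z. ennreal ((g w)\<^sup>2) * ennreal (K (z - w)) \<partial>lborel)"
        using K0 by (intro nn_integral_cong) (auto simp: ennreal_mult)
      also have "\<dots> = ennreal ((g w)\<^sup>2) * (\<integral>\<^sup>+z. ennreal (K (z - w)) \<partial>lborel)"
        by (rule nn_integral_cmult) measurable
      also have "(\<integral>\<^sup>+z. ennreal (K (z - w)) \<partial>lborel) = (\<integral>\<^sup>+z. ennreal (K (w - z)) \<partial>lborel)"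
      proof -
        have "K (z - w) = K (w - z)" for z using bump_minus[of r "w - z"] by (simp add: K_def)
        then show ?thesis by simp
      qed
      also have "\<dots> = ennreal 1"
        using lborel_integral_reflect[OF Km, of w] Ki K1 K0 by (subst nn_integral_eq_integral) auto
      finally show "(\<integral>\<^sup>+z. ennreal ((g w)\<^sup>2 * K (z - w)) \<partial>lborel) = ennreal ((g w)\<^sup>2)" by simp
    qed
    also have "\<dots> = ennreal (\<integral>x. (G b x)\<^sup>2 \<partial>lebesgue)"
      unfolding gint by (rule nn_integral_eq_integral[OF gi]) auto
    finally show ?thesis .
  qed
  show ?thesis
    by (rule that[of U u]) (use Uc ud close en in \<open>auto simp: Q_def\<close>)
qed

subsection \<open>Forced oscillation on squares\<close>

lemma Basis_real2: "(Basis :: (real^2) set) = {axis 1 1, axis 2 1}"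
  by (auto simp: Basis_vec_def UNIV_2)

section \<open>Iterated integrals in the plane\<close>

definition pt :: "real \<Rightarrow> real \<Rightarrow> real^2" where "pt x y = x *\<^sub>R axis 1 1 + y *\<^sub>R axis 2 1"

lemma pt_nth [simp]: "pt x y $ 1 = x" "pt x y $ 2 = y"
  by (simp_all add: pt_def axis_def)

lemma continuous_on_pt [continuous_intros]:
  "continuous_on A f \<Longrightarrow> continuous_on A g \<Longrightarrow> continuous_on A (\<lambda>x. pt (f x) (g x))"
  unfolding pt_def by (intro continuous_intros)

lemma measurable_pt [measurable]:
  "f \<in> borel_measurable M \<Longrightarrow> g \<in> borel_measurable M \<Longrightarrow> (\<lambda>x. pt (f x) (g x)) \<in> borel_measurable M"
  unfolding pt_def by (intro borel_measurable_add borel_measurable_scaleR borel_measurable_const)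

lemma lborel_real2: "(lborel :: (real^2) measure) = distr (lborel \<Otimes>\<^sub>M lborel) borel (\<lambda>(x, y). pt x y)"
proof (rule lborel_eqI)
  fix l u :: "real^2"
  assume le: "\<And>b. b \<in> Basis \<Longrightarrow> l \<bullet> b \<le> u \<bullet> b"
  have le': "l $ 1 \<le> u $ 1" "l $ 2 \<le> u $ 2"
    using le[of "axis 1 1"] le[of "axis 2 1"] by (simp_all add: Basis_real2 inner_axis)
  have "emeasure (distr (lborel \<Otimes>\<^sub>M lborel) borel (\<lambda>(x, y). pt x y)) (box l u) =
      emeasure (lborel \<Otimes>\<^sub>M lborel) ((\<lambda>(x, y). pt x y) -` box l u \<inter> space (lborel \<Otimes>\<^sub>M lborel))"
    by (rule emeasure_distr) measurable
  also have "(\<lambda>(x, y). pt x y) -` box l u \<inter> space (lborel \<Otimes>\<^sub>M lborel) = {l $ 1<..<u $ 1} \<times> {l $ 2<..<u $ 2}"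
    by (auto simp: mem_box_cart forall_2 space_pair_measure)
  also have "emeasure (lborel \<Otimes>\<^sub>M lborel) \<dots> = emeasure lborel {l $ 1<..<u $ 1} * emeasure lborel {l $ 2<..<u $ 2}"
    by (rule lborel.emeasure_pair_measure_Times) auto
  also have "\<dots> = ennreal ((u $ 1 - l $ 1) * (u $ 2 - l $ 2))"
    using le' by (simp add: ennreal_mult)
  also have "(u $ 1 - l $ 1) * (u $ 2 - l $ 2) = (\<Prod>b\<in>Basis. (u - l) \<bullet> b)"
    by (simp add: Basis_real2 axis_eq_axis inner_axis)
  finally show "emeasure (distr (lborel \<Otimes>\<^sub>M lborel) borel (\<lambda>(x, y). pt x y)) (box l u) = (\<Prod>b\<in>Basis. (u - l) \<bullet> b)" .
qed simp

lemma nn_integral_real2: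
  fixes F :: "real^2 \<Rightarrow> ennreal"
  assumes [measurable]: "F \<in> borel_measurable borel"
  shows "(\<integral>\<^sup>+z. F z \<partial>lborel) = (\<integral>\<^sup>+x. \<integral>\<^sup>+y. F (pt x y) \<partial>lborel \<partial>lborel)"
    "(\<integral>\<^sup>+z. F z \<partial>lborel) = (\<integral>\<^sup>+y. \<integral>\<^sup>+x. F (pt x y) \<partial>lborel \<partial>lborel)"
proof -
  have m: "(\<lambda>(x, y). F (pt x y)) \<in> borel_measurable (lborel \<Otimes>\<^sub>M lborel)" by measurable
  have "(\<integral>\<^sup>+z. F z \<partial>lborel) = (\<integral>\<^sup>+q. F (case q of (x, y) \<Rightarrow> pt x y) \<partial>(lborel \<Otimes>\<^sub>M lborel))"
    by (subst lborel_real2, subst nn_integral_distr) auto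
  also have "\<dots> = (\<integral>\<^sup>+q. (case q of (x, y) \<Rightarrow> F (pt x y)) \<partial>(lborel \<Otimes>\<^sub>M lborel))"
    by (simp add: split_beta)
  also have "\<dots> = (\<integral>\<^sup>+x. \<integral>\<^sup>+y. F (pt x y) \<partial>lborel \<partial>lborel)"
    using lborel.nn_integral_fst[OF m] by simp
  finally show 1: "(\<integral>\<^sup>+z. F z \<partial>lborel) = (\<integral>\<^sup>+x. \<integral>\<^sup>+y. F (pt x y) \<partial>lborel \<partial>lborel)" .
  show "(\<integral>\<^sup>+z. F z \<partial>lborel) = (\<integral>\<^sup>+y. \<integral>\<^sup>+x. F (pt x y) \<partial>lborel \<partial>lborel)"
    unfolding 1 using lborel_pair.Fubini'[of "\<lambda>x y. F (pt x y)"] m by simp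
qed

section \<open>Energy along the sides of a square\<close>

lemma segment_variation:
  fixes k k' :: "real \<Rightarrow> real"
  assumes d: "\<And>t. (k has_real_derivative k' t) (at t)" and c: "continuous_on UNIV k'"
    and a: "a \<in> {-s..s}" and b: "b \<in> {-s..s}"
  shows "\<bar>k b - k a\<bar> \<le> integral {-s..s} (\<lambda>t. \<bar>k' t\<bar>)"
proof -
  have int: "(\<lambda>t. \<bar>k' t\<bar>) integrable_on {x..y}" "k' integrable_on {x..y}" for x y
    by (intro integrable_continuous_interval continuous_on_rabs continuous_on_subset[OF c], simp)+
  have main: "\<bar>k y - k x\<bar> \<le> integral {-s..s} (\<lambda>t. \<bar>k' t\<bar>)" if "x \<le> y" "x \<in> {-s..s}" "y \<in> {-s..s}" for x y
  proof -
    have "(k' has_integral (k y - k x)) {x..y}"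
      by (rule fundamental_theorem_of_calculus[OF that(1)])
        (use d in \<open>auto simp: has_real_derivative_iff_has_vector_derivative[symmetric] intro: has_field_derivative_at_within\<close>)
    then have "k y - k x = integral {x..y} k'" by (simp add: integral_unique)
    then have "\<bar>k y - k x\<bar> \<le> integral {x..y} (\<lambda>t. \<bar>k' t\<bar>)"
      using integral_norm_bound_integral[OF int(2) int(1), of x y] by simp
    also have "\<dots> \<le> integral {-s..s} (\<lambda>t. \<bar>k' t\<bar>)"
      by (rule integral_subset_le) (use that int in auto)
    finally show ?thesis .
  qed
  show ?thesis
    using main[of a b] main[of b a] a b by (cases "a \<le> b") (auto simp: abs_minus_commute)
qed

text \<open>Young's inequality with weight \<open>8 * s / H\<close> replaces Cauchy-Schwarz on the four sides.\<close>

lemma square_energy_lower_bound: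
  fixes h :: "nat \<Rightarrow> real \<Rightarrow> real"
  assumes c: "\<And>j. continuous_on UNIV (h j)" and s: "0 < s" and H: "0 < H"
    and le: "H \<le> 2 * (\<Sum>j<4. integral {-s..s} (\<lambda>t. \<bar>h j t\<bar>))"
  shows "H\<^sup>2 / (32 * s) \<le> (\<Sum>j<4. integral {-s..s} (\<lambda>t. (h j t)\<^sup>2))"
proof -
  \<comment> \<open>With this weight the constant terms of Young's inequality account for exactly
    half of \<open>H\<close>, and the other half is left for the energy.\<close>
  define k where "k = 8 * s / H"
  have k: "k > 0" using s H by (simp add: k_def)
  have "integral {-s..s} (\<lambda>t. \<bar>h j t\<bar>) \<le> k * integral {-s..s} (\<lambda>t. (h j t)\<^sup>2) + 2 * s / (4 * k)" for j
  proof -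
    have int: "(\<lambda>t. \<bar>h j t\<bar>) integrable_on {-s..s}" "(\<lambda>t. (h j t)\<^sup>2) integrable_on {-s..s}"
      by (intro integrable_continuous_interval continuous_on_rabs continuous_on_power continuous_on_subset[OF c], simp)+
    have "integral {-s..s} (\<lambda>t. \<bar>h j t\<bar>) \<le> integral {-s..s} (\<lambda>t. k * (h j t)\<^sup>2 + 1 / (4 * k))"
    proof (rule integral_le[OF int(1)])
      show "(\<lambda>t. k * (h j t)\<^sup>2 + 1 / (4 * k)) integrable_on {-s..s}"
        by (intro integrable_add integrable_on_mult_right int) auto
      fix t
      have "0 \<le> (2 * k * \<bar>h j t\<bar> - 1)\<^sup>2" by simp
      then have "4 * k * \<bar>h j t\<bar> \<le> 4 * k\<^sup>2 * (h j t)\<^sup>2 + 1"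
        by (simp add: power2_diff power_mult_distrib)
      then show "\<bar>h j t\<bar> \<le> k * (h j t)\<^sup>2 + 1 / (4 * k)"
        using k by (simp add: field_simps power2_eq_square)
    qed
    also have "\<dots> = k * integral {-s..s} (\<lambda>t. (h j t)\<^sup>2) + 2 * s / (4 * k)"
      using s int by (subst Henstock_Kurzweil_Integration.integral_add) (auto intro: integrable_on_mult_right)
    finally show ?thesis .
  qed
  then have "(\<Sum>j<4. integral {-s..s} (\<lambda>t. \<bar>h j t\<bar>)) \<le> (\<Sum>j<(4::nat). k * integral {-s..s} (\<lambda>t. (h j t)\<^sup>2) + 2 * s / (4 * k))"
    by (intro sum_mono) auto
  also have "\<dots> = k * (\<Sum>j<4. integral {-s..s} (\<lambda>t. (h j t)\<^sup>2)) + 2 * s / k"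
    by (simp add: sum.distrib sum_distrib_left)
  finally have bound: "(\<Sum>j<4. integral {-s..s} (\<lambda>t. \<bar>h j t\<bar>)) \<le>
    k * (\<Sum>j<4. integral {-s..s} (\<lambda>t. (h j t)\<^sup>2)) + 2 * s / k" .
  have "H \<le> 2 * (k * (\<Sum>j<4. integral {-s..s} (\<lambda>t. (h j t)\<^sup>2)) + 2 * s / k)"
    by (rule order_trans[OF le mult_left_mono[OF bound]]) simp
  moreover have "2 * (2 * s / k) = H / 2" using s H by (simp add: k_def)
  moreover have "H / 4 \<le> x" if "H \<le> 2 * (x + y)" "2 * y = H / 2" for x y :: real using that by argo
  ultimately have "H / 4 \<le> k * (\<Sum>j<4. integral {-s..s} (\<lambda>t. (h j t)\<^sup>2))" by blast
  then show ?thesis using s H by (simp add: k_def field_simps power2_eq_square)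
qed

definition square_boundary :: "real^2 \<Rightarrow> real \<Rightarrow> (real^2) set" where
  "square_boundary p s = {z. max \<bar>z $ 1 - p $ 1\<bar> \<bar>z $ 2 - p $ 2\<bar> = s}"

text \<open>Every boundary point is joined to the corner \<open>p + pt s s\<close> along sides of
  the square, each used at most once. Hence two boundary values differ by at most twice the total
  variation over the four sides.\<close>

lemma square_boundary_variation:
  fixes u :: "real^2 \<Rightarrow> real" and U :: "real^2 \<Rightarrow> real^2 \<Rightarrow> real"
  assumes Uc: "\<And>b. continuous_on UNIV (U b)"
    and ud: "\<And>b z s. ((\<lambda>s. u (z + s *\<^sub>R b)) has_real_derivative U b (z + s *\<^sub>R b)) (at s)"
    and s: "s > 0" and a: "a \<in> square_boundary p s" and b: "b \<in> square_boundary p s"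
    and H: "0 < H" "H \<le> \<bar>u a - u b\<bar>"
  shows "H\<^sup>2 / (32 * s) \<le> integral {-s..s} (\<lambda>t. (U (axis 1 1) (p + pt t s))\<^sup>2) + integral {-s..s} (\<lambda>t. (U (axis 1 1) (p + pt t (-s)))\<^sup>2)
      + integral {-s..s} (\<lambda>t. (U (axis 2 1) (p + pt s t))\<^sup>2) + integral {-s..s} (\<lambda>t. (U (axis 2 1) (p + pt (-s) t))\<^sup>2)"
proof -
  define h where "h j t = (if j = 0 then U (axis 1 1) (p + pt t s) else if j = 1 then U (axis 1 1) (p + pt t (-s))
    else if j = 2 then U (axis 2 1) (p + pt s t) else U (axis 2 1) (p + pt (-s) t))" for j :: nat and t
  define V where "V j = integral {-s..s} (\<lambda>t. \<bar>h j t\<bar>)" for j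
  have hc: "continuous_on UNIV (h j)" for j
  proof -
    have "continuous_on UNIV (\<lambda>t. U b (p + pt t y))" "continuous_on UNIV (\<lambda>t. U b (p + pt y t))" for b y
      by (intro continuous_on_compose2[OF Uc] continuous_intros subset_UNIV)+
    then show ?thesis
      unfolding h_def[abs_def] by (cases "j = 0"; cases "j = 1"; cases "j = 2") simp_all
  qed
  have V0: "0 \<le> V j" for j unfolding V_def
    by (intro Henstock_Kurzweil_Integration.integral_nonneg integrable_continuous_interval continuous_on_rabs continuous_on_subset[OF hc]) auto
  have hor: "((\<lambda>t. u (p + pt t y)) has_real_derivative U (axis 1 1) (p + pt t y)) (at t)" for t y
    using ud[of "p + pt 0 y" "axis 1 1" t] by (simp add: pt_def algebra_simps)
  have ver: "((\<lambda>t. u (p + pt x t)) has_real_derivative U (axis 2 1) (p + pt x t)) (at t)" for t x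
    using ud[of "p + pt x 0" "axis 2 1" t] by (simp add: pt_def algebra_simps)
  have N: "\<bar>u (p + pt x s) - u (p + pt x' s)\<bar> \<le> V 0" if "x \<in> {-s..s}" "x' \<in> {-s..s}" for x x'
    using segment_variation[OF hor[of s] _ that(2,1)] hc[of 0] by (simp add: V_def h_def[abs_def])
  have S: "\<bar>u (p + pt x (-s)) - u (p + pt x' (-s))\<bar> \<le> V 1" if "x \<in> {-s..s}" "x' \<in> {-s..s}" for x x'
    using segment_variation[OF hor[of "-s"] _ that(2,1)] hc[of 1] by (simp add: V_def h_def[abs_def])
  have E: "\<bar>u (p + pt s y) - u (p + pt s y')\<bar> \<le> V 2" if "y \<in> {-s..s}" "y' \<in> {-s..s}" for y y'
    using segment_variation[OF ver[of s] _ that(2,1)] hc[of 2] by (simp add: V_def h_def[abs_def])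
  have W: "\<bar>u (p + pt (-s) y) - u (p + pt (-s) y')\<bar> \<le> V 3" if "y \<in> {-s..s}" "y' \<in> {-s..s}" for y y'
    using segment_variation[OF ver[of "-s"] _ that(2,1)] hc[of 3] by (simp add: V_def h_def[abs_def])
  have corner: "\<bar>u z - u (p + pt s s)\<bar> \<le> V 0 + V 1 + V 2 + V 3" if "z \<in> square_boundary p s" for z
  proof -
    define x y where "x = z $ 1 - p $ 1" and "y = z $ 2 - p $ 2"
    have z: "z = p + pt x y" by (simp add: x_def y_def vec_eq_iff forall_2)
    have m: "max \<bar>x\<bar> \<bar>y\<bar> = s" using that by (simp add: square_boundary_def x_def y_def)
    then have xy: "x \<in> {-s..s}" "y \<in> {-s..s}" by auto
    consider "y = s" | "y = -s" | "x = s" | "x = -s" using m by (auto simp: max_def abs_if split: if_splits)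
    then show ?thesis
    proof cases
      case 1
      then show ?thesis using N[of x s] xy s V0[of 1] V0[of 2] V0[of 3] z by auto
    next
      case 2
      then show ?thesis using S[of x s] E[of "-s" s] xy s V0[of 0] V0[of 3] z by auto
    next
      case 3
      then show ?thesis using E[of y s] xy s V0[of 0] V0[of 1] V0[of 3] z by auto
    next
      case 4
      then show ?thesis using W[of y s] N[of "-s" s] xy s V0[of 1] V0[of 2] z by auto
    qed
  qed
  have s4: "(\<Sum>j<(4::nat). k j) = k 0 + k 1 + k 2 + k 3" for k :: "nat \<Rightarrow> real"
    by (simp add: numeral_eq_Suc)
  have "\<bar>u a - u b\<bar> \<le> \<bar>u a - u (p + pt s s)\<bar> + \<bar>u b - u (p + pt s s)\<bar>" by argo
  also have "\<dots> \<le> 2 * (\<Sum>j<4. V j)" unfolding s4 using add_mono[OF corner[OF a] corner[OF b]] by simp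
  finally have "H \<le> 2 * (\<Sum>j<4. V j)" using H(2) by simp
  from square_energy_lower_bound[OF hc s H(1) this[unfolded V_def]]
  show ?thesis unfolding s4 by (simp add: h_def)
qed

lemma nn_integral_reflect:
  fixes k :: "real \<Rightarrow> ennreal"
  assumes "k \<in> borel_measurable borel"
  shows "(\<integral>\<^sup>+s. k (- s) \<partial>lborel) = (\<integral>\<^sup>+s. k s \<partial>lborel)"
  using nn_integral_real_affine[of k "-1" 0] assms by simp

lemma nn_integral_side:
  fixes k :: "real \<Rightarrow> real" and s :: real
  assumes c: "continuous_on UNIV k" and s: "0 < s" "s \<le> 1"
  shows "ennreal (integral {-s..s} (\<lambda>t. (k t)\<^sup>2)) \<le> (\<integral>\<^sup>+t. ennreal ((k t)\<^sup>2) * indicator {-1..1} t \<partial>lborel)"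
proof -
  have "((\<lambda>t. (k t)\<^sup>2) has_integral integral {-s..s} (\<lambda>t. (k t)\<^sup>2)) {-s..s}"
  proof -
    have "continuous_on {-s..s} (\<lambda>t. (k t)\<^sup>2)" by (intro continuous_on_power continuous_on_subset[OF c]) auto
    then show ?thesis using integrable_continuous_interval integrable_integral by blast
  qed
  from nn_integral_has_integral_lebesgue[OF _ this]
  have "ennreal (integral {-s..s} (\<lambda>t. (k t)\<^sup>2)) = (\<integral>\<^sup>+t. ennreal (indicator {-s..s} t * (k t)\<^sup>2) \<partial>lborel)" by simp
  also have "\<dots> \<le> (\<integral>\<^sup>+t. ennreal ((k t)\<^sup>2) * indicator {-1..1} t \<partial>lborel)"
  proof (rule nn_integral_mono)
    fix t
    show "ennreal (indicator {-s..s} t * (k t)\<^sup>2) \<le> ennreal ((k t)\<^sup>2) * indicator {-1..1} t"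
    proof (cases "t \<in> {-s..s}")
      case True
      then have "t \<in> {-1..1}" using s by auto
      then show ?thesis using True by simp
    qed simp
  qed
  finally show ?thesis .
qed

lemma log_log_integral:
  fixes \<sigma> r C :: real
  assumes "0 < \<sigma>" "\<sigma> \<le> r" "r < 1" "0 \<le> C"
  shows "(\<integral>\<^sup>+s. ennreal (C / (s * (- ln s))) * indicator {\<sigma>..r} s \<partial>lborel) = ennreal (C * ln (- ln \<sigma>) - C * ln (- ln r))"
proof -
  have "(\<integral>\<^sup>+s. ennreal (C / (s * (- ln s))) * indicator {\<sigma>..r} s \<partial>lborel) =
      ennreal (- C * ln (- ln r) - (- C * ln (- ln \<sigma>)))"
  proof (rule nn_integral_FTC_Icc)
    fix s assume "s \<in> {\<sigma>..r}"
    then have s: "\<sigma> \<le> s" "s \<le> r" by auto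
    have l: "ln s < 0" using s assms by (intro ln_less_zero) auto
    show "((\<lambda>s. - C * ln (- ln s)) has_real_derivative C / (s * (- ln s))) (at s)"
      using l s assms by (auto intro!: derivative_eq_intros simp: divide_simps)
    show "0 \<le> C / (s * (- ln s))" using l s assms by (intro divide_nonneg_nonneg mult_nonneg_nonneg) auto
  qed (use assms in auto)
  then show ?thesis by simp
qed

text \<open>The four sides of the square of half-side \<open>s\<close> carry energy at least
  \<open>C / (s * (- ln s))\<close>. As \<open>s\<close> varies, the sides sweep out coordinate
  lines, so by Fubini the integral of these energies is at most twice the squared norms of the two
  weak derivatives, uniformly in the lower limit \<open>\<sigma>\<close>. The forced energy grows
  like \<open>ln (- ln \<sigma>)\<close>, a contradiction.\<close>

lemma forced_oscillation_not_W12: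
  fixes f :: "real^2 \<Rightarrow> real"
  assumes fc: "continuous_on UNIV f" and c: "c > 0" and r: "0 < r" "r < 1"
    and osc: "\<And>s. 0 < s \<Longrightarrow> s \<le> r \<Longrightarrow>
      \<exists>a\<in>square_boundary p s. \<exists>b\<in>square_boundary p s. c / sqrt (- ln s) \<le> \<bar>f a - f b\<bar>"
  shows "f \<notin> sobolev_W12 UNIV"
proof
  assume "f \<in> sobolev_W12 UNIV"
  then have "\<forall>b\<in>Basis. \<exists>g. g \<in> L2_on UNIV \<and> weak_partial_deriv_on UNIV b f g" unfolding sobolev_W12_def by blast
  then obtain G where G: "\<And>b. b \<in> Basis \<Longrightarrow> G b \<in> L2_on UNIV" "\<And>b. b \<in> Basis \<Longrightarrow> weak_partial_deriv_on UNIV b f (G b)"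
    by metis
  define B where "B b = (\<integral>x. (G b x)\<^sup>2 \<partial>lebesgue)" for b
  have B0: "B b \<ge> 0" for b unfolding B_def by (intro Bochner_Integration.integral_nonneg) auto
  \<comment> \<open>The factor 128 is 4 * 32: mollification leaves half of the oscillation, which
    enters squared, and 32 comes from the estimate on the four sides.\<close>
  define C where "C = c\<^sup>2 / 128"
  have C: "C > 0" using c by (simp add: C_def)
  have bound: "C * ln (- ln \<sigma>) - C * ln (- ln r) \<le> 2 * B (axis 1 1) + 2 * B (axis 2 1)" if \<sigma>: "0 < \<sigma>" "\<sigma> \<le> r" for \<sigma>
  proof -
    \<comment> \<open>A quarter of the smallest oscillation forced for \<open>s\<close> in
      [\<open>\<sigma>\<close>, \<open>r\<close>]: the errors at two points then use up at most half
      of the oscillation of every such square.\<close>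
    define e where "e = c / sqrt (- ln \<sigma>) / 4"
    have lns: "0 < - ln s" if "0 < s" "s \<le> r" for s using that r ln_less_zero[of s] by simp
    have e: "e > 0" using c lns[OF \<sigma>] by (simp add: e_def)
    define Q where "Q = unit_square p"
    obtain U u where m: "\<forall>b. continuous_on UNIV (U b)"
      "\<forall>b z s. ((\<lambda>s. u (z + s *\<^sub>R b)) has_real_derivative U b (z + s *\<^sub>R b)) (at s)"
      "\<forall>z\<in>Q. \<bar>u z - f z\<bar> \<le> e" "\<forall>b\<in>Basis. (\<integral>\<^sup>+z\<in>Q. ennreal ((U b z)\<^sup>2) \<partial>lborel) \<le> ennreal (B b)"
      unfolding B_def Q_def by (rule mollification[OF fc G e, of p])
    note u = m[rule_format]
    define F where "F b z = ennreal ((U b (p + z))\<^sup>2) * indicator Q (p + z)" for b z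
    have "closed Q" unfolding Q_def unit_square_def by (intro closed_Collect_all closed_Collect_le continuous_intros)
    then have Qm [measurable]: "Q \<in> sets borel" by simp
    have Um [measurable]: "U b \<in> borel_measurable borel" for b by (rule borel_measurable_continuous_onI[OF u(1)])
    have Fm [measurable]: "F b \<in> borel_measurable borel" for b unfolding F_def[abs_def] by measurable
    have FB: "(\<integral>\<^sup>+z. F b z \<partial>lborel) \<le> ennreal (B b)" if "b \<in> Basis" for b
    proof -
      have "(\<integral>\<^sup>+z. F b z \<partial>lborel) = (\<integral>\<^sup>+z\<in>Q. ennreal ((U b z)\<^sup>2) \<partial>lborel)"
        using nn_integral_lborel_translate[of "\<lambda>z. ennreal ((U b z)\<^sup>2) * indicator Q z" "- p"] by (simp add: F_def add.commute)
      then show ?thesis using u(4)[OF that] by simp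
    qed
    have Qpt: "p + pt x y \<in> Q \<longleftrightarrow> \<bar>x\<bar> \<le> 1 \<and> \<bar>y\<bar> \<le> 1" for x y by (auto simp: Q_def unit_square_def forall_2)
    define A1 where "A1 y = (\<integral>\<^sup>+x. F (axis 1 1) (pt x y) \<partial>lborel)" for y
    define A2 where "A2 x = (\<integral>\<^sup>+y. F (axis 2 1) (pt x y) \<partial>lborel)" for x
    have [measurable]: "A1 \<in> borel_measurable borel" "A2 \<in> borel_measurable borel"
      unfolding A1_def[abs_def] A2_def[abs_def] by measurable
    have low: "ennreal (C / (s * (- ln s))) \<le> A1 s + A1 (- s) + A2 s + A2 (- s)" if s: "\<sigma> \<le> s" "s \<le> r" for s
    proof -
      have s0: "0 < s" "s \<le> 1" using s \<sigma> r by auto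
      obtain a b where ab: "a \<in> square_boundary p s" "b \<in> square_boundary p s" "c / sqrt (- ln s) \<le> \<bar>f a - f b\<bar>"
        using osc[OF s0(1) s(2)] by blast
      define H where "H = c / sqrt (- ln s) / 2"
      have H0: "H > 0" using c lns[OF s0(1) s(2)] by (simp add: H_def)
      have "- ln s \<le> - ln \<sigma>" using s \<sigma> by simp
      then have "c / sqrt (- ln \<sigma>) \<le> c / sqrt (- ln s)"
        using c lns[OF s0(1) s(2)] by (intro divide_left_mono) auto
      then have eH: "2 * e \<le> H" by (simp add: e_def H_def)
      have "\<bar>u z - f z\<bar> \<le> e" if "z \<in> square_boundary p s" for z
        using that s0(2) by (intro u(3)) (auto simp: Q_def unit_square_def square_boundary_def forall_2)
      from this[OF ab(1)] this[OF ab(2)] have "H \<le> \<bar>u a - u b\<bar>"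
        using ab(3) eH unfolding H_def by argo
      note V = square_boundary_variation[OF u(1,2) s0(1) ab(1,2) H0 this]
      have uc: "continuous_on UNIV (\<lambda>t. U b (p + pt t y))" "continuous_on UNIV (\<lambda>t. U b (p + pt y t))" for b y
        by (intro continuous_on_compose2[OF u(1)] continuous_intros subset_UNIV)+
      have Heq: "H\<^sup>2 / (32 * s) = C / (s * (- ln s))"
        using lns[OF s0(1) s(2)] by (simp add: H_def C_def power_divide)
      define I1 where "I1 y = integral {-s..s} (\<lambda>t. (U (axis 1 1) (p + pt t y))\<^sup>2)" for y
      define I2 where "I2 x = integral {-s..s} (\<lambda>t. (U (axis 2 1) (p + pt x t))\<^sup>2)" for x
      have nn: "0 \<le> I1 y" "0 \<le> I2 y" for y
        unfolding I1_def I2_def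
        by (intro Henstock_Kurzweil_Integration.integral_nonneg integrable_continuous_interval continuous_on_power continuous_on_subset[OF uc(1)] continuous_on_subset[OF uc(2)]; simp)+
      have I: "ennreal (I1 y) \<le> A1 y" "ennreal (I2 y) \<le> A2 y" if "\<bar>y\<bar> \<le> 1" for y
      proof -
        have "indicator Q (p + pt t y) = (indicator {-1..1} t :: ennreal)" "indicator Q (p + pt y t) = (indicator {-1..1} t :: ennreal)"
          for t using that by (auto simp: indicator_def Qpt)
        then show "ennreal (I1 y) \<le> A1 y" "ennreal (I2 y) \<le> A2 y"
          using nn_integral_side[OF uc(1) s0] nn_integral_side[OF uc(2) s0] by (simp_all add: I1_def I2_def A1_def A2_def F_def)
      qed
      have "ennreal (C / (s * (- ln s))) \<le> ennreal (I1 s) + ennreal (I1 (- s)) + ennreal (I2 s) + ennreal (I2 (- s))"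
        using ennreal_leI[OF V[folded I1_def I2_def]] by (simp add: Heq ennreal_plus nn add_nonneg_nonneg)
      also have "\<dots> \<le> A1 s + A1 (- s) + A2 s + A2 (- s)" by (intro add_mono I) (use s0 in auto)
      finally show ?thesis .
    qed
    have "ennreal (C * ln (- ln \<sigma>) - C * ln (- ln r)) = (\<integral>\<^sup>+s. ennreal (C / (s * (- ln s))) * indicator {\<sigma>..r} s \<partial>lborel)"
      using \<sigma> r C by (intro log_log_integral[symmetric]) auto
    also have "\<dots> \<le> (\<integral>\<^sup>+s. A1 s + A1 (- s) + A2 s + A2 (- s) \<partial>lborel)"
    proof (rule nn_integral_mono)
      fix s
      show "ennreal (C / (s * (- ln s))) * indicator {\<sigma>..r} s \<le> A1 s + A1 (- s) + A2 s + A2 (- s)"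
      proof (cases "s \<in> {\<sigma>..r}")
        case True
        then have "ennreal (C / (s * (- ln s))) * indicator {\<sigma>..r} s = ennreal (C / (s * (- ln s)))" by simp
        then show ?thesis using low[of s] True by (simp only: atLeastAtMost_iff)
      qed simp
    qed
    also have "\<dots> = (\<integral>\<^sup>+s. A1 s \<partial>lborel) + (\<integral>\<^sup>+s. A1 (- s) \<partial>lborel) + (\<integral>\<^sup>+s. A2 s \<partial>lborel) + (\<integral>\<^sup>+s. A2 (- s) \<partial>lborel)"
      by (simp add: nn_integral_add)
    also have "\<dots> = (\<integral>\<^sup>+s. A1 s \<partial>lborel) + (\<integral>\<^sup>+s. A1 s \<partial>lborel) + (\<integral>\<^sup>+s. A2 s \<partial>lborel) + (\<integral>\<^sup>+s. A2 s \<partial>lborel)"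
      by (simp add: nn_integral_reflect)
    also have "\<dots> \<le> ennreal (B (axis 1 1)) + ennreal (B (axis 1 1)) + ennreal (B (axis 2 1)) + ennreal (B (axis 2 1))"
    proof (intro add_mono)
      have "(\<integral>\<^sup>+s. A1 s \<partial>lborel) = (\<integral>\<^sup>+z. F (axis 1 1) z \<partial>lborel)"
        unfolding A1_def by (rule nn_integral_real2(2)[symmetric]) measurable
      then show "(\<integral>\<^sup>+s. A1 s \<partial>lborel) \<le> ennreal (B (axis 1 1))" using FB[of "axis 1 1"] by (simp add: Basis_real2)
      then show "(\<integral>\<^sup>+s. A1 s \<partial>lborel) \<le> ennreal (B (axis 1 1))" .
      have "(\<integral>\<^sup>+s. A2 s \<partial>lborel) = (\<integral>\<^sup>+z. F (axis 2 1) z \<partial>lborel)"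
        unfolding A2_def by (rule nn_integral_real2(1)[symmetric]) measurable
      then show "(\<integral>\<^sup>+s. A2 s \<partial>lborel) \<le> ennreal (B (axis 2 1))" using FB[of "axis 2 1"] by (simp add: Basis_real2)
      then show "(\<integral>\<^sup>+s. A2 s \<partial>lborel) \<le> ennreal (B (axis 2 1))" .
    qed
    also have "\<dots> = ennreal (2 * B (axis 1 1) + 2 * B (axis 2 1))"
      using B0 by (simp add: ennreal_plus[symmetric] del: ennreal_plus)
    finally show ?thesis using B0 by (simp add: ennreal_le_iff del: ennreal_plus)
  qed
  define M where "M = (2 * B (axis 1 1) + 2 * B (axis 2 1)) / C"
  have M0: "M \<ge> 0" using B0 C by (simp add: M_def)
  \<comment> \<open>Chosen so that \<open>ln (- ln \<sigma>)\<close> exceeds by 1 the largest value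
    that the energy bound permits.\<close>
  define X where "X = ln (- ln r) + M + 1"
  define \<sigma> where "\<sigma> = exp (- exp X)"
  have lr: "0 < - ln r" using r by simp
  have "- ln r = exp (ln (- ln r))" using lr by simp
  also have "\<dots> \<le> exp X" using M0 by (simp add: X_def)
  finally have "- exp X \<le> ln r" by simp
  then have "exp (- exp X) \<le> exp (ln r)" by (subst exp_le_cancel_iff)
  then have \<sigma>: "0 < \<sigma>" "\<sigma> \<le> r" using r by (auto simp: \<sigma>_def)
  have "C * (X - ln (- ln r)) \<le> 2 * B (axis 1 1) + 2 * B (axis 2 1)"
    using bound[OF \<sigma>] by (simp add: \<sigma>_def right_diff_distrib)
  then have "X - ln (- ln r) \<le> M" using C by (simp add: M_def field_simps)
  then show False by (simp add: X_def)
qed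

subsection \<open>The exceptional function\<close>

text \<open>The central hole is listed apart because it carries the cusp; the staircase takes over
  from level 1.\<close>

definition gasket_gaps :: "(real^2) set" where
  "gasket_gaps = - cell 0 (0, 0) \<union> hole 0 (0, 0) \<union> (\<Union>m. holes 1 m)"

lemma hole_subset_gasket_gaps: "(\<Union>q\<in>cells n. hole n q) \<subseteq> gasket_gaps"
proof (cases n)
  case (Suc k)
  then have "(\<Union>q\<in>cells n. hole n q) \<subseteq> holes 1 (Suc n)" unfolding holes_def by (intro UN_upper) auto
  then show ?thesis unfolding gasket_gaps_def by blast
qed (auto simp: gasket_gaps_def)

text \<open>The intermediate value theorem for the distance to \<open>h p\<close> in the maximum
  norm along the image of the segment.\<close>

lemma image_segment_meets_squares:
  fixes h :: "real^2 \<Rightarrow> real^2"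
  assumes c: "continuous_on UNIV h" and ne: "h p \<noteq> h q"
  obtains \<mu> where "\<mu> > 0" "\<And>s. 0 \<le> s \<Longrightarrow> s \<le> \<mu> \<Longrightarrow> \<exists>z\<in>closed_segment p q. h z \<in> square_boundary (h p) s"
proof -
  define m where "m z = max \<bar>h z $ 1 - h p $ 1\<bar> \<bar>h z $ 2 - h p $ 2\<bar>" for z
  have mc: "continuous_on (closed_segment p q) m"
    unfolding m_def[abs_def]
    by (intro continuous_on_max continuous_on_rabs continuous_on_diff continuous_on_const continuous_on_component continuous_on_subset[OF c]) auto
  have conn: "connected (m ` closed_segment p q)"
    by (rule connected_continuous_image[OF mc connected_segment(1)])
  have m0: "m p = 0" by (simp add: m_def)
  have "m q \<noteq> 0" using ne by (auto simp: m_def max_def vec_eq_iff forall_2 split: if_splits)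
  moreover have "m q \<ge> 0" by (simp add: m_def max_def)
  ultimately have mq: "m q > 0" by simp
  show ?thesis
  proof (rule that[OF mq])
    fix s assume s: "0 \<le> s" "s \<le> m q"
    have "s \<in> m ` closed_segment p q"
      using connectedD_interval[OF conn, of "m p" "m q" s] s m0 by auto
    then show "\<exists>z\<in>closed_segment p q. h z \<in> square_boundary (h p) s"
      by (auto simp: m_def square_boundary_def)
  qed
qed

lemma exceptional_function:
  fixes h g :: "real^2 \<Rightarrow> real^2"
  assumes hom: "homeomorphism UNIV UNIV h g"
  obtains f S where "continuous_on UNIV f" "compact S" "\<And>x. x \<notin> S \<Longrightarrow> f x = (0::real)"
    "C1_on (h ` gasket_gaps) f" "energy (h ` gasket_gaps) f < \<infinity>" "f \<notin> sobolev_W12 UNIV"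
proof -
  note hg = homeomorphism_UNIV_D[OF hom]
  have inj: "h x = h y \<longleftrightarrow> x = y" for x y using hg(1) by metis
  have c0: "(0, 0) \<in> cells 0" by simp
  \<comment> \<open>The vertex of the central hole on the bottom side. \<open>M\<close> consists of
    the other two vertices, where the cusp is made to vanish by the choice of
    \<open>\<rho>\<close>.\<close>
  define p0 where "p0 = pt (1/2) 0"
  define M where "M = hole_cl 0 (0, 0) \<inter> settled 0 - {p0}"
  have "finite M" unfolding M_def using finite_hole_cl_settled[OF c0, of 0] by simp
  then have Ffin: "finite ((\<lambda>a. (h a, {h p0})) ` M)" by simp
  have "closed C \<and> a \<notin> C" if "(a, C) \<in> (\<lambda>a. (h a, {h p0})) ` M" for a C
    using that by (auto simp: M_def inj)
  then obtain \<rho> where \<rho>: "\<rho> > 0" "\<And>a C z. (a, C) \<in> (\<lambda>a. (h a, {h p0})) ` M \<Longrightarrow> z \<in> C \<Longrightarrow> \<rho> \<le> dist a z"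
    using uniform_separation[OF Ffin] by metis
  obtain G :: "real^2 \<Rightarrow> real" and c r where G: "continuous_on UNIV G" "G 0 = 0" "\<And>z. 0 \<le> G z \<and> G z \<le> 1"
    "\<And>z. \<rho> \<le> norm z \<Longrightarrow> G z = 0" "C1_on (-{0}) G" "energy (-{0}) G < \<infinity>" "c > 0" "0 < r" "r < 1"
    "\<And>z. 0 < norm z \<Longrightarrow> norm z < r \<Longrightarrow> G z \<ge> c / sqrt (- ln (norm z))"
    using log_cusp_exists[OF \<rho>(1)] by metis
  define E where "E z = G (h z - h p0)" for z
  have Ec: "continuous_on UNIV E"
    unfolding E_def[abs_def]
    by (intro continuous_on_compose2[OF G(1)] continuous_on_diff hg(3) continuous_on_const) auto
  have E0: "E z = 0" if "z \<in> hole_cl 0 (0, 0)" "z \<in> settled 0" for z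
  proof (cases "z = p0")
    case False
    then have "z \<in> M" using that by (simp add: M_def)
    then have "\<rho> \<le> norm (h z - h p0)" using \<rho>(2)[of "h z" "{h p0}" "h p0"] by (auto simp: dist_norm)
    then show ?thesis using G(4) by (simp add: E_def)
  qed (simp add: E_def G(2))
  \<comment> \<open>The data 0 and \<open>E\<close> agree where they meet, since \<open>E\<close>
    vanishes at all three vertices of the hole, at \<open>p0\<close> because the cusp does. The
    Tietze extension has values in [0, 1], which is the oscillation bound the staircase starts
    from.\<close>
  have "continuous_on (settled 0 \<union> hole_cl 0 (0, 0)) (\<lambda>z. if z \<in> settled 0 then 0 else E z)"
  proof (rule continuous_on_cases[OF closed_settled closed_hole_cl])
    show "continuous_on (hole_cl 0 (0, 0)) E" using Ec continuous_on_subset by blast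
  qed (use E0 in auto)
  then obtain u where u: "continuous_on UNIV u" "\<And>z. z \<in> settled 0 \<union> hole_cl 0 (0, 0) \<Longrightarrow> u z = (if z \<in> settled 0 then 0 else E z)"
    "\<And>z. u z \<in> cbox 0 (1::real)"
  proof (rule Tietze_closed_interval_1[of "settled 0 \<union> hole_cl 0 (0, 0)" _ UNIV 0 1])
    show "closedin (top_of_set UNIV) (settled 0 \<union> hole_cl 0 (0, 0))"
      using closed_Un[OF closed_settled closed_hole_cl] by simp
  qed (use G(3) in \<open>auto simp: E_def\<close>)
  have "\<bar>u z - u z'\<bar> \<le> 1" for z z' using u(3)[of z] u(3)[of z'] by auto
  then obtain v where v: "continuous_on UNIV v" "\<And>z. z \<in> settled 1 \<Longrightarrow> v z = u z"
    "C1_on (h ` (\<Union>m. holes 1 m)) (v \<circ> g)" "energy (h ` (\<Union>m. holes 1 m)) (v \<circ> g) < \<infinity>"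
    using staircase_limit[OF hom u(1), of 1] by metis
  have v0: "v z = 0" if "z \<in> settled 0" for z
    using v(2)[of z] u(2)[of z] settled_mono[of 0 1] that by auto
  have vE: "v z = E z" if "z \<in> hole_cl 0 (0, 0)" for z
    using v(2)[of z] u(2)[of z] hole_cl_subset_settled[OF c0, of 1] E0[of z] that by auto
  define f where "f = v \<circ> g"
  have fc: "continuous_on UNIV f" unfolding f_def by (intro continuous_on_compose hg(4) continuous_on_subset[OF v(1)]) auto
  have f0: "f (h z) = 0" if "z \<in> settled 0" for z using v0[OF that] by (simp add: f_def hg(1))
  have fE: "f (h z) = G (h z - h p0)" if "z \<in> hole_cl 0 (0, 0)" for z using vE[OF that] by (simp add: f_def hg(1) E_def)
  have out: "- cell 0 (0, 0) \<subseteq> settled 0" using cell_int_subset_cell[of 0 "(0, 0)"] by (auto simp: settled_def)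
  have Sc: "compact (h ` cell 0 (0, 0))"
    by (intro compact_continuous_image compact_cell continuous_on_subset[OF hg(3)]) auto
  have fS: "f x = 0" if "x \<notin> h ` cell 0 (0, 0)" for x
  proof -
    have "g x \<notin> cell 0 (0, 0)" using that hg(2)[of x] by (metis image_eqI)
    then show ?thesis using f0[of "g x"] out hg(2)[of x] by auto
  qed
  define V1 where "V1 = h ` (- cell 0 (0, 0))"
  define V2 where "V2 = h ` hole 0 (0, 0)"
  define V3 where "V3 = h ` (\<Union>m. holes 1 m)"
  have op: "open V1" "open V2" "open V3"
    unfolding V1_def V2_def V3_def using closed_cell open_hole open_holes
    by (auto intro!: homeomorphism_UNIV_open_image[OF hom] open_UN)
  have zero: "(0::real) = f w" if "w \<in> V1" for w using that f0 out by (auto simp: V1_def)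
  have "C1_on V1 (\<lambda>w. 0)" by (rule C1_onI[where G="\<lambda>w. 0"]) auto
  then have C1: "C1_on V1 f" using C1_on_cong[of V1 "\<lambda>w. 0" f] op(1) zero by simp
  have "energy V1 f = energy V1 (\<lambda>w. 0)" by (rule energy_cong[OF op(1)]) (use zero in auto)
  also have "\<dots> = 0"
  proof -
    have "grad (\<lambda>w::real^2. 0) w = 0" for w by (rule grad_eqI) simp
    then show ?thesis by (simp add: energy_def)
  qed
  finally have e1: "energy V1 f = 0" .
  have "p0 \<notin> hole 0 (0, 0)" by (simp add: hole_def p0_def)
  then have V2s: "V2 \<subseteq> - h ` {p0}" by (auto simp: V2_def inj)
  have V2eq: "0 + (\<Sum>a\<in>{p0}. 1 * G (w - h a)) = f w" if "w \<in> V2" for w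
    using that fE hole_subset_hole_cl by (fastforce simp: V2_def)
  have C2: "C1_on V2 f"
    by (rule C1_on_cong[OF op(2) V2eq C1_on_subset[OF C1_on_translated_sum[OF G(5)] V2s]])
  have "energy V2 f = energy V2 (\<lambda>w. 0 + (\<Sum>a\<in>{p0}. 1 * G (w - h a)))"
    by (rule energy_cong[OF op(2)]) (use V2eq in simp)
  also have "\<dots> \<le> energy (- h ` {p0}) (\<lambda>w. 0 + (\<Sum>a\<in>{p0}. 1 * G (w - h a)))"
    by (rule energy_mono[OF V2s])
  also have "\<dots> \<le> ennreal ((real (card {p0}))\<^sup>2 * 1\<^sup>2) * energy (-{0}) G"
    by (rule energy_translated_sum_le[OF G(5)]) auto
  finally have e2: "energy V2 f < \<infinity>" using G(6) by (simp add: le_less_trans)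
  have C3: "C1_on V3 f" "energy V3 f < \<infinity>" using v(3,4) by (simp_all add: V3_def f_def)
  note U12 = energy_Un[OF op(1,2) C1 C2]
  note U123 = energy_Un[OF open_Un[OF op(1,2)] op(3) U12(1) C3(1)]
  have gaps: "h ` gasket_gaps = V1 \<union> V2 \<union> V3"
    by (simp add: gasket_gaps_def V1_def V2_def V3_def image_Un)
  have "energy (h ` gasket_gaps) f < \<infinity>"
  proof -
    have "energy (V1 \<union> V2 \<union> V3) f \<le> energy V1 f + energy V2 f + energy V3 f"
      using order_trans[OF U123(2) add_right_mono[OF U12(2)]] .
    also have "\<dots> < \<infinity>" using e1 e2 C3(2) by simp
    finally show ?thesis by (simp add: gaps)
  qed
  moreover have "C1_on (h ` gasket_gaps) f" using U123(1) by (simp add: gaps)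
  moreover have "f \<notin> sobolev_W12 UNIV"
  proof -
    \<comment> \<open>The segment to \<open>p1\<close>, another vertex of the central hole, stays in
      the closed hole, where \<open>f\<close> is the cusp. The segment to \<open>p2\<close>, a point
      below the triangle, stays in the settled part, where \<open>f\<close> is 0. The images of both
      cross every small square around \<open>h p0\<close>.\<close>
    define p1 p2 where "p1 = pt 0 (1/2)" and "p2 = pt (1/2) (-1)"
    have "p0 $ 2 \<noteq> p1 $ 2" "p0 $ 2 \<noteq> p2 $ 2" by (simp_all add: p0_def p1_def p2_def)
    then have ne: "h p0 \<noteq> h p1" "h p0 \<noteq> h p2" unfolding inj by auto
    obtain \<mu>1 where \<mu>1: "\<mu>1 > 0" "\<And>s. 0 \<le> s \<Longrightarrow> s \<le> \<mu>1 \<Longrightarrow> \<exists>z\<in>closed_segment p0 p1. h z \<in> square_boundary (h p0) s"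
      using image_segment_meets_squares[OF hg(3) ne(1)] by metis
    obtain \<mu>2 where \<mu>2: "\<mu>2 > 0" "\<And>s. 0 \<le> s \<Longrightarrow> s \<le> \<mu>2 \<Longrightarrow> \<exists>z\<in>closed_segment p0 p2. h z \<in> square_boundary (h p0) s"
      using image_segment_meets_squares[OF hg(3) ne(2)] by metis
    have seg1: "closed_segment p0 p1 \<subseteq> hole_cl 0 (0, 0)"
      by (auto simp: in_segment hole_cl_def p0_def p1_def diff_divide_distrib)
    have seg2: "closed_segment p0 p2 \<subseteq> settled 0"
      by (auto simp: in_segment settled_def cell_int_def p0_def p2_def)
    \<comment> \<open>Points on the boundary of a square of half-side \<open>s\<close> have distance
      at most \<open>2 * s\<close> from its centre; the third of \<open>r\<close> keeps this below
      \<open>r\<close>, where the lower bound of the cusp holds.\<close>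
    define R where "R = min (min \<mu>1 \<mu>2) (r / 3)"
    have R: "0 < R" "R < 1" using \<mu>1 \<mu>2 G(8,9) by (auto simp: R_def)
    show ?thesis
    proof (rule forced_oscillation_not_W12[OF fc G(7) R, of "h p0"])
      fix s assume s: "0 < s" "s \<le> R"
      obtain z1 where z1: "z1 \<in> closed_segment p0 p1" "h z1 \<in> square_boundary (h p0) s"
        using \<mu>1(2)[of s] s by (auto simp: R_def)
      obtain z2 where z2: "z2 \<in> closed_segment p0 p2" "h z2 \<in> square_boundary (h p0) s"
        using \<mu>2(2)[of s] s by (auto simp: R_def)
      define w where "w = h z1 - h p0"
      have wm: "max \<bar>w $ 1\<bar> \<bar>w $ 2\<bar> = s" using z1(2) by (simp add: w_def square_boundary_def)
      have "max \<bar>w $ 1\<bar> \<bar>w $ 2\<bar> \<le> norm w" using component_le_norm_cart[of w] by simp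
      then have ws: "s \<le> norm w" using wm by simp
      have "norm w \<le> \<bar>w $ 1\<bar> + \<bar>w $ 2\<bar>" using norm_le_l1_cart[of w] by (simp add: sum_2)
      also have "\<dots> \<le> 2 * s" using wm by (auto simp: max_def split: if_splits)
      also have "\<dots> < r" using s G(8) by (auto simp: R_def)
      finally have wr: "norm w < r" .
      have w0: "0 < norm w" using ws s by linarith
      have "c / sqrt (- ln s) \<le> c / sqrt (- ln (norm w))"
      proof -
        have "- ln (norm w) \<le> - ln s" using ws s w0 by (subst neg_le_iff_le, subst ln_le_cancel_iff) auto
        moreover have "0 < - ln (norm w)" using w0 wr G(9) by simp
        ultimately show ?thesis using G(7) by (intro divide_left_mono) auto
      qed
      also have "\<dots> \<le> G w" using G(10) w0 wr by blast
      also have "\<dots> = \<bar>f (h z1) - f (h z2)\<bar>"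
      proof -
        have "f (h z1) = G w" using fE z1(1) seg1 unfolding w_def by blast
        moreover have "f (h z2) = 0" using f0 z2(1) seg2 by blast
        ultimately show ?thesis using G(3)[of w] by simp
      qed
      finally show "\<exists>a\<in>square_boundary (h p0) s. \<exists>b\<in>square_boundary (h p0) s. c / sqrt (- ln s) \<le> \<bar>f a - f b\<bar>"
        using z1(2) z2(2) by blast
    qed
  qed
  ultimately show ?thesis using that[OF fc Sc fS] by blast
qed

subsection \<open>The gasket in an affine frame\<close>

definition frame :: "real^2 \<Rightarrow> real^2 \<Rightarrow> real^2 \<Rightarrow> real^2 \<Rightarrow> real^2" where
  "frame a e d v = a + v $ 1 *\<^sub>R e + v $ 2 *\<^sub>R d"

text \<open>Lagrange's identity: the inner product of the two unit edges is 1/2, so the squared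
  determinant is 1 - 1/4.\<close>

lemma equilateral_det_nonzero:
  fixes a b c :: "real^2"
  assumes "equilateral_side_1 (a, b, c)"
  shows "(b - a) $ 1 * (c - a) $ 2 - (b - a) $ 2 * (c - a) $ 1 \<noteq> 0"
proof -
  define e d where "e = b - a" and "d = c - a"
  have n: "norm e = 1" "norm d = 1" "norm (e - d) = 1"
    using assms by (auto simp: e_def d_def dist_norm norm_minus_commute)
  have "e \<bullet> e = 1" "d \<bullet> d = 1" "(e - d) \<bullet> (e - d) = 1"
    using n by (simp_all add: dot_square_norm)
  then have q: "(e $ 1)\<^sup>2 + (e $ 2)\<^sup>2 = 1" "(d $ 1)\<^sup>2 + (d $ 2)\<^sup>2 = 1"
    "(e $ 1 - d $ 1)\<^sup>2 + (e $ 2 - d $ 2)\<^sup>2 = 1"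
    by (simp_all add: inner_vec_def sum_2 power2_eq_square)
  then have ip: "e $ 1 * d $ 1 + e $ 2 * d $ 2 = 1 / 2" by (simp add: power2_diff)
  have "(e $ 1 * d $ 2 - e $ 2 * d $ 1)\<^sup>2 =
      ((e $ 1)\<^sup>2 + (e $ 2)\<^sup>2) * ((d $ 1)\<^sup>2 + (d $ 2)\<^sup>2) - (e $ 1 * d $ 1 + e $ 2 * d $ 2)\<^sup>2"
    by (simp add: power2_eq_square algebra_simps)
  also have "\<dots> = 3 / 4" unfolding q ip by (simp add: power2_eq_square)
  finally show ?thesis unfolding e_def d_def by auto
qed

lemma homeomorphism_frame:
  fixes a e d :: "real^2"
  assumes D: "e $ 1 * d $ 2 - e $ 2 * d $ 1 \<noteq> 0"
  obtains B where "homeomorphism UNIV UNIV (frame a e d) B"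
proof -
  define L where "L v = v $ 1 *\<^sub>R e + v $ 2 *\<^sub>R d" for v :: "real^2"
  have lin: "linear L" by (auto simp: L_def linear_iff algebra_simps)
  have "v = 0" if "L v = 0" for v
  proof -
    have 0: "v $ 1 * e $ 1 + v $ 2 * d $ 1 = 0" "v $ 1 * e $ 2 + v $ 2 * d $ 2 = 0"
      using that by (simp_all add: L_def vec_eq_iff)
    have "v $ 1 * (e $ 1 * d $ 2 - e $ 2 * d $ 1) =
        (v $ 1 * e $ 1 + v $ 2 * d $ 1) * d $ 2 - (v $ 1 * e $ 2 + v $ 2 * d $ 2) * d $ 1"
      "v $ 2 * (e $ 1 * d $ 2 - e $ 2 * d $ 1) =
        (v $ 1 * e $ 2 + v $ 2 * d $ 2) * e $ 1 - (v $ 1 * e $ 1 + v $ 2 * d $ 1) * e $ 2"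
      by (simp_all add: algebra_simps)
    then show "v = 0" using D unfolding 0 by (simp add: vec_eq_iff forall_2)
  qed
  then have inj: "inj L" using linear_injective_0[OF lin] by blast
  obtain B where "homeomorphism (L ` UNIV) UNIV B L" using linear_homeomorphism_image[OF lin inj, of UNIV] by metis
  then have "homeomorphism UNIV UNIV B L" using linear_inj_imp_surj[OF lin inj] by simp
  moreover have "homeomorphism UNIV UNIV ((+) (- a)) ((+) a)" using homeomorphism_translation[of a UNIV] by simp
  ultimately have "homeomorphism UNIV UNIV ((+) a \<circ> L) (B \<circ> (+) (- a))"
    using homeomorphism_compose homeomorphism_symD by metis
  moreover have "(+) a \<circ> L = frame a e d" by (simp add: fun_eq_iff L_def frame_def add.assoc)
  ultimately show ?thesis using that by simp
qed

text \<open>The arithmetic identities bring the midpoint coordinates of a triangle of side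
  \<open>2 * t\<close> into the form \<open>w + t\<close> in which the next level of cells is
  written.\<close>

lemma midpoint_frame:
  "midpoint (frame a e d (pt x y)) (frame a e d (pt x' y')) = frame a e d (pt ((x + x') / 2) ((y + y') / 2))"
  "(w + (w + 2 * t)) / 2 = w + t" "(w + 2 * t + w) / 2 = w + t" "(w + w) / 2 = w" for w t :: real
  by (simp_all add: frame_def midpoint_def vec_eq_iff field_simps)

section \<open>The triangles of the gasket as cells\<close>

lemma gasket_triangles_frame:
  assumes "S \<in> gasket_triangles (a, b, c) n"
  obtains q where "q \<in> cells n" "S = (frame a (b - a) (c - a) (pt (fst q) (snd q)),
    frame a (b - a) (c - a) (pt (fst q + (1/2) ^ n) (snd q)), frame a (b - a) (c - a) (pt (fst q) (snd q + (1/2) ^ n)))"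
proof -
  let ?A = "\<lambda>x y. frame a (b - a) (c - a) (pt x y)"
  have "\<exists>q\<in>cells n. S = (?A (fst q) (snd q), ?A (fst q + (1/2) ^ n) (snd q), ?A (fst q) (snd q + (1/2) ^ n))"
    using assms
  proof (induction n arbitrary: S)
    case 0
    then show ?case by (simp add: frame_def)
  next
    case (Suc n)
    then obtain R where R: "R \<in> gasket_triangles (a, b, c) n" "S \<in> corner_triangles R" by auto
    obtain q where q: "q \<in> cells n" "R = (?A (fst q) (snd q), ?A (fst q + (1/2) ^ n) (snd q), ?A (fst q) (snd q + (1/2) ^ n))"
      using Suc.IH[OF R(1)] by blast
    define x y s where "x = fst q" and "y = snd q" and "s = (1/2::real) ^ Suc n"
    have s2: "(1/2) ^ n = 2 * s" by (simp add: s_def)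
    have c: "(x, y) \<in> cells (Suc n)" "(x + s, y) \<in> cells (Suc n)" "(x, y + s) \<in> cells (Suc n)"
      using q(1) by (auto simp: x_def y_def s_def)
    have "S = (?A x y, ?A (x + s) y, ?A x (y + s)) \<or> S = (?A (x + s) y, ?A (x + s + s) y, ?A (x + s) (y + s))
        \<or> S = (?A x (y + s), ?A (x + s) (y + s), ?A x (y + s + s))"
    proof -
      have "R = (?A x y, ?A (x + 2 * s) y, ?A x (y + 2 * s))" using q(2) by (simp only: s2 x_def y_def)
      then have "S \<in> {(?A x y, ?A (x + s) y, ?A x (y + s)), (?A (x + s) y, ?A (x + 2 * s) y, ?A (x + s) (y + s)),
          (?A x (y + s), ?A (x + s) (y + s), ?A x (y + 2 * s))}"
        using R(2) by (simp only: corner_triangles.simps midpoint_frame)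
      moreover have "x + 2 * s = x + s + s" "y + 2 * s = y + s + s" by simp_all
      ultimately show ?thesis by (simp only: insert_iff empty_iff simp_thms)
    qed
    then show ?case unfolding s_def[symmetric]
    proof (elim disjE)
      assume "S = (?A x y, ?A (x + s) y, ?A x (y + s))"
      then show "\<exists>q\<in>cells (Suc n). S = (?A (fst q) (snd q), ?A (fst q + s) (snd q), ?A (fst q) (snd q + s))"
        by (intro bexI[OF _ c(1)]) simp
    next
      assume "S = (?A (x + s) y, ?A (x + s + s) y, ?A (x + s) (y + s))"
      then show "\<exists>q\<in>cells (Suc n). S = (?A (fst q) (snd q), ?A (fst q + s) (snd q), ?A (fst q) (snd q + s))"
        by (intro bexI[OF _ c(2)]) simp
    next
      assume "S = (?A x (y + s), ?A (x + s) (y + s), ?A x (y + s + s))"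
      then show "\<exists>q\<in>cells (Suc n). S = (?A (fst q) (snd q), ?A (fst q + s) (snd q), ?A (fst q) (snd q + s))"
        by (intro bexI[OF _ c(3)]) simp
    qed
  qed
  then show ?thesis using that by blast
qed

text \<open>Each side is treated by itself: the interior of a closed half-plane is the open
  half-plane.\<close>

lemma interior_hole_cl: "interior (hole_cl n q) \<subseteq> hole n q"
proof -
  let ?s = "(1/2::real) ^ Suc n"
  have half: "interior (hole_cl n q) \<subseteq> {z. v \<bullet> z < r}" if "v \<noteq> 0" "hole_cl n q \<subseteq> {z. v \<bullet> z \<le> r}" for v r
    using interior_mono[OF that(2)] that(1) by simp
  have "interior (hole_cl n q) \<subseteq> {z. axis 1 1 \<bullet> z < fst q + ?s}"
    by (rule half) (auto simp: hole_cl_def inner_axis')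
  moreover have "interior (hole_cl n q) \<subseteq> {z. axis 2 1 \<bullet> z < snd q + ?s}"
    by (rule half) (auto simp: hole_cl_def inner_axis')
  moreover have "interior (hole_cl n q) \<subseteq> {z. (axis 1 (-1) + axis 2 (-1)) \<bullet> z < - (fst q + snd q + ?s)}"
  proof (rule half)
    show "axis 1 (-1) + axis 2 (-1) \<noteq> (0::real^2)" by (auto simp: vec_eq_iff axis_def forall_2)
  qed (auto simp: hole_cl_def inner_axis' inner_add_left)
  ultimately show ?thesis by (force simp: hole_def inner_axis' inner_add_left)
qed

text \<open>Barycentric coordinates place the closed middle triangle in the image of the closed
  hole. The inverse homeomorphism maps its interior to an open subset of the closed hole, hence into
  the open hole.\<close>

lemma middle_triangle_frame:
  assumes hom: "homeomorphism UNIV UNIV (frame a (b - a) (c - a)) B" and S: "S \<in> gasket_triangles (a, b, c) n"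
  shows "interior (closed_triangle (middle_triangle S)) \<subseteq> frame a (b - a) (c - a) ` (\<Union>q\<in>cells n. hole n q)"
proof -
  let ?F = "frame a (b - a) (c - a)"
  let ?A = "\<lambda>x y. ?F (pt x y)"
  note hB = homeomorphism_UNIV_D[OF hom]
  obtain q where q: "q \<in> cells n" "S = (?A (fst q) (snd q), ?A (fst q + (1/2) ^ n) (snd q), ?A (fst q) (snd q + (1/2) ^ n))"
    using gasket_triangles_frame[OF S] by metis
  define x y s where "x = fst q" and "y = snd q" and "s = (1/2::real) ^ Suc n"
  have s2: "(1/2) ^ n = 2 * s" and s0: "s > 0" by (simp_all add: s_def)
  have "S = (?A x y, ?A (x + 2 * s) y, ?A x (y + 2 * s))" using q(2) by (simp only: s2 x_def y_def)
  then have "middle_triangle S = (?A (x + s) (y + s), ?A x (y + s), ?A (x + s) y)"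
    by (simp only: middle_triangle.simps midpoint_frame)
  then have tri: "closed_triangle (middle_triangle S) = convex hull {?A (x + s) (y + s), ?A x (y + s), ?A (x + s) y}" by simp
  have "convex hull {?A (x + s) (y + s), ?A x (y + s), ?A (x + s) y} \<subseteq> ?F ` hole_cl n q"
  proof
    fix z assume "z \<in> convex hull {?A (x + s) (y + s), ?A x (y + s), ?A (x + s) y}"
    then obtain i j k where ijk: "0 \<le> i" "0 \<le> j" "0 \<le> k" "i + j + k = 1"
      "z = i *\<^sub>R ?A (x + s) (y + s) + j *\<^sub>R ?A x (y + s) + k *\<^sub>R ?A (x + s) y"
      unfolding convex_hull_3 by blast
    have k: "k = 1 - i - j" using ijk by simp
    have "z = ?A (x + (1 - j) * s) (y + (i + j) * s)"
      unfolding ijk(5) k by (simp add: frame_def vec_eq_iff algebra_simps)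
    moreover have "pt (x + (1 - j) * s) (y + (i + j) * s) \<in> hole_cl n q"
    proof -
      have "0 \<le> j * s" "0 \<le> i * s" "(i + j) * s \<le> 1 * s"
        using ijk s0 by (auto intro!: mult_nonneg_nonneg mult_right_mono)
      then show ?thesis
        unfolding hole_cl_def mem_Collect_eq s_def[symmetric] x_def[symmetric] y_def[symmetric] pt_nth
        by (simp add: algebra_simps)
    qed
    ultimately show "z \<in> ?F ` hole_cl n q" by blast
  qed
  then have sub: "interior (closed_triangle (middle_triangle S)) \<subseteq> ?F ` hole_cl n q"
    unfolding tri using interior_subset by blast
  let ?O = "interior (closed_triangle (middle_triangle S))"
  have "homeomorphism UNIV UNIV B ?F" using hom homeomorphism_symD by blast
  then have "open (B ` ?O)" using homeomorphism_UNIV_open_image open_interior by blast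
  moreover have "B ` ?O \<subseteq> hole_cl n q"
  proof -
    have "B ` ?O \<subseteq> B ` (?F ` hole_cl n q)" by (rule image_mono[OF sub])
    then show ?thesis by (simp only: image_image hB(1) image_ident)
  qed
  ultimately have BO: "B ` ?O \<subseteq> hole n q" by (rule order_trans[OF interior_maximal interior_hole_cl, rotated])
  have "?O = ?F ` (B ` ?O)" by (simp only: image_image hB(2) image_ident)
  also have "\<dots> \<subseteq> ?F ` hole n q" by (rule image_mono[OF BO])
  also have "\<dots> \<subseteq> ?F ` (\<Union>q\<in>cells n. hole n q)" by (intro image_mono UN_upper q(1))
  finally show ?thesis .
qed

text \<open>Continuous differentiability and finite energy pass to subsets, so this inclusion
  transfers them from the gaps to the complement of the gasket.\<close>

lemma complement_gasket_subset:
  assumes hom: "homeomorphism UNIV UNIV (frame a (b - a) (c - a)) B"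
  shows "- sierpinski_gasket (a, b, c) \<subseteq> frame a (b - a) (c - a) ` gasket_gaps"
proof -
  let ?F = "frame a (b - a) (c - a)"
  note hB = homeomorphism_UNIV_D[OF hom]
  have "- gasket_stage (a, b, c) n \<subseteq> ?F ` gasket_gaps" for n
  proof (induction n)
    case 0
    have "?F ` cell 0 (0, 0) \<subseteq> closed_triangle (a, b, c)"
    proof
      fix z assume "z \<in> ?F ` cell 0 (0, 0)"
      then obtain v where v: "z = ?F v" "0 \<le> v $ 1" "0 \<le> v $ 2" "v $ 1 + v $ 2 \<le> 1" by (auto simp: cell_def)
      then have "z = (1 - v $ 1 - v $ 2) *\<^sub>R a + v $ 1 *\<^sub>R b + v $ 2 *\<^sub>R c"
        by (simp add: frame_def algebra_simps)
      then show "z \<in> closed_triangle (a, b, c)"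
        unfolding closed_triangle.simps convex_hull_3 mem_Collect_eq
        by (intro exI[of _ "1 - v $ 1 - v $ 2"] exI[of _ "v $ 1"] exI[of _ "v $ 2"]) (use v in simp)
    qed
    moreover have "- ?F ` cell 0 (0, 0) = ?F ` (- cell 0 (0, 0))"
      unfolding hB(5) by auto
    ultimately have "- closed_triangle (a, b, c) \<subseteq> ?F ` (- cell 0 (0, 0))" by blast
    then show ?case by (auto simp: gasket_gaps_def)
  next
    case (Suc n)
    have "(\<Union>S\<in>gasket_triangles (a, b, c) n. interior (closed_triangle (middle_triangle S))) \<subseteq> ?F ` gasket_gaps"
    proof (rule UN_least)
      fix S assume "S \<in> gasket_triangles (a, b, c) n"
      note middle_triangle_frame[OF hom this]
      also have "?F ` (\<Union>q\<in>cells n. hole n q) \<subseteq> ?F ` gasket_gaps"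
        by (rule image_mono[OF hole_subset_gasket_gaps])
      finally show "interior (closed_triangle (middle_triangle S)) \<subseteq> ?F ` gasket_gaps" .
    qed
    moreover have "- gasket_stage (a, b, c) (Suc n) = - gasket_stage (a, b, c) n \<union>
        (\<Union>S\<in>gasket_triangles (a, b, c) n. interior (closed_triangle (middle_triangle S)))" by auto
    ultimately show ?case using Suc by (simp only: Un_least)
  qed
  then show ?thesis unfolding sierpinski_gasket_def by blast
qed

theorem theorem1p7:
  fixes T :: triangle and h :: "real^2 \<Rightarrow> real^2"
  assumes "equilateral_side_1 T"
    and "\<exists>g. homeomorphism UNIV UNIV h g"
  shows "\<not> W12_removable (h ` sierpinski_gasket T)"
proof
  let ?K = "sierpinski_gasket T"
  assume rem: "W12_removable (h ` ?K)"
  obtain g where g: "homeomorphism UNIV UNIV h g" using assms(2) by blast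
  obtain a b c where T: "T = (a, b, c)" by (cases T)
  let ?F = "frame a (b - a) (c - a)"
  obtain B where B: "homeomorphism UNIV UNIV ?F B"
    using homeomorphism_frame[OF equilateral_det_nonzero] assms(1) unfolding T by metis
  \<comment> \<open>The affine frame is absorbed into the homeomorphism: the construction is applied
    to \<open>h \<circ> ?F\<close> on the right-angled model.\<close>
  obtain f S where f: "continuous_on UNIV f" "compact S" "\<And>x. x \<notin> S \<Longrightarrow> f x = (0::real)"
    "C1_on ((h \<circ> ?F) ` gasket_gaps) f" "energy ((h \<circ> ?F) ` gasket_gaps) f < \<infinity>" "f \<notin> sobolev_W12 UNIV"
    using exceptional_function[OF homeomorphism_compose[OF B g]] by metis
  have "closed ?K" using compact_sierpinski_gasket compact_imp_closed by blast
  then have op: "open (- h ` ?K)" using homeomorphism_UNIV_closed_image[OF g] by (simp add: closed_def)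
  have "- h ` ?K = h ` (- ?K)" unfolding homeomorphism_UNIV_D(5)[OF g] by auto
  also have "\<dots> \<subseteq> h ` (?F ` gasket_gaps)"
    unfolding T by (rule image_mono[OF complement_gasket_subset[OF B]])
  finally have sub: "- h ` ?K \<subseteq> (h \<circ> ?F) ` gasket_gaps" by (simp only: image_comp)
  have "f \<in> sobolev_W12 (- h ` ?K)"
    by (rule sobolev_W12_I[OF op f(1) C1_on_subset[OF f(4) sub] f(2,3)])
      (use le_less_trans[OF energy_mono[OF sub] f(5)] in auto)
  then have "f \<in> sobolev_W12 UNIV"
    using rem f(1) unfolding W12_removable_def Compl_eq_Diff_UNIV by blast
  then show False using f(6) by blast
qed

end
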